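(* Let $d \geq 39$. Let $G$ be an infinite rooted tree of uniformly bounded degree each of whose vertices has at least $d$ offspring. Then for every $T \geq 429\, d^{-1}$, the random stirring model with parameter $T$ on $G$ contains infinite cycles almost surely.
   Context: The random stirring model on a graph $G$ is the process $(\sigma_t)_{t\ge 0}$ of permutations of $V(G)$ which starts at the identity at time $0$ and in which, independently for each edge $e\in E(G)$, the transposition of the two endpoints of $e$ is performed (composed) at each point of a rate-one Poisson process on $[0,\infty)$. The random stirring model with parameter $T$ is the random permutation $\sigma_T$. An infinite cycle is a cycle containing infinitely many vertices. The offspring of a vertex $v$ of a rooted tree are its neighbours farther from the root than $v$. *)

theory Defs
  imports "HOL-Probability.Probability" "HOL-Combinatorics.Orbits"
begin

definition simple_graph :: "'a set \<Rightarrow> ('a \<Rightarrow> 'a \<Rightarrow> bool) \<Rightarrow> bool" where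
  "simple_graph V adj \<longleftrightarrow> (\<forall>u w. adj u w \<longrightarrow> u \<in> V \<and> w \<in> V \<and> u \<noteq> w \<and> adj w u)"

definition gwalk :: "'a set \<Rightarrow> ('a \<Rightarrow> 'a \<Rightarrow> bool) \<Rightarrow> 'a list \<Rightarrow> bool" where
  "gwalk V adj xs \<longleftrightarrow> xs \<noteq> [] \<and> set xs \<subseteq> V \<and>
     (\<forall>i. Suc i < length xs \<longrightarrow> adj (xs ! i) (xs ! Suc i))"

definition gconnected :: "'a set \<Rightarrow> ('a \<Rightarrow> 'a \<Rightarrow> bool) \<Rightarrow> bool" where
  "gconnected V adj \<longleftrightarrow>
     (\<forall>u\<in>V. \<forall>w\<in>V. \<exists>xs. gwalk V adj xs \<and> hd xs = u \<and> last xs = w)"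

definition has_gcycle :: "'a set \<Rightarrow> ('a \<Rightarrow> 'a \<Rightarrow> bool) \<Rightarrow> bool" where
  "has_gcycle V adj \<longleftrightarrow>
     (\<exists>xs. gwalk V adj xs \<and> distinct xs \<and> 3 \<le> length xs \<and> adj (last xs) (hd xs))"

definition rooted_tree :: "'a set \<Rightarrow> ('a \<Rightarrow> 'a \<Rightarrow> bool) \<Rightarrow> 'a \<Rightarrow> bool" where
  "rooted_tree V adj r \<longleftrightarrow>
     simple_graph V adj \<and> gconnected V adj \<and> \<not> has_gcycle V adj \<and> r \<in> V"

definition gdist :: "'a set \<Rightarrow> ('a \<Rightarrow> 'a \<Rightarrow> bool) \<Rightarrow> 'a \<Rightarrow> 'a \<Rightarrow> nat" where
  "gdist V adj u w =
     (LEAST n. \<exists>xs. gwalk V adj xs \<and> hd xs = u \<and> last xs = w \<and> length xs = Suc n)"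

definition neighbours :: "'a set \<Rightarrow> ('a \<Rightarrow> 'a \<Rightarrow> bool) \<Rightarrow> 'a \<Rightarrow> 'a set" where
  "neighbours V adj v = {w \<in> V. adj v w}"

definition offspring :: "'a set \<Rightarrow> ('a \<Rightarrow> 'a \<Rightarrow> bool) \<Rightarrow> 'a \<Rightarrow> 'a \<Rightarrow> 'a set" where
  "offspring V adj r v = {w \<in> V. adj v w \<and> gdist V adj r v < gdist V adj r w}"

definition edges :: "'a set \<Rightarrow> ('a \<Rightarrow> 'a \<Rightarrow> bool) \<Rightarrow> 'a set set" where
  "edges V adj = {{u, w} | u w. u \<in> V \<and> w \<in> V \<and> adj u w}"

text \<open>Probability space: for every edge e an i.i.d. sequence (omega (e,i))_i of Exp(1)
  inter-arrival times; the partial sums are the points of a rate-one Poisson process on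
  [0,infinity), independently over edges.\<close>
definition stirring_space :: "'a set \<Rightarrow> ('a \<Rightarrow> 'a \<Rightarrow> bool) \<Rightarrow> ('a set \<times> nat \<Rightarrow> real) measure" where
  "stirring_space V adj =
     (\<Pi>\<^sub>M i \<in> edges V adj \<times> (UNIV :: nat set). density lborel (exponential_density 1))"

definition ring_time :: "('a set \<times> nat \<Rightarrow> real) \<Rightarrow> 'a set \<Rightarrow> nat \<Rightarrow> real" where
  "ring_time \<omega> e k = (\<Sum>i\<le>k. \<omega> (e, i))"

definition incident_rings ::
  "'a set \<Rightarrow> ('a \<Rightarrow> 'a \<Rightarrow> bool) \<Rightarrow> ('a set \<times> nat \<Rightarrow> real) \<Rightarrow> 'a \<Rightarrow> real \<Rightarrow> real \<Rightarrow> real set" where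
  "incident_rings V adj \<omega> u s t =
     {ring_time \<omega> e k | e k. e \<in> edges V adj \<and> u \<in> e \<and> s < ring_time \<omega> e k \<and> ring_time \<omega> e k \<le> t}"

definition stir_step ::
  "'a set \<Rightarrow> ('a \<Rightarrow> 'a \<Rightarrow> bool) \<Rightarrow> ('a set \<times> nat \<Rightarrow> real) \<Rightarrow> real \<Rightarrow> 'a \<times> real \<Rightarrow> 'a \<times> real" where
  "stir_step V adj \<omega> t p =
     (let u = fst p; s = snd p; R = incident_rings V adj \<omega> u s t in
      if R = {} then p
      else let s' = Inf R;
               e = (SOME e. e \<in> edges V adj \<and> u \<in> e \<and> (\<exists>k. ring_time \<omega> e k = s'))
           in (THE w. e = {u, w} \<and> w \<noteq> u, s'))"

text \<open>sigma_t(v): the position at time t of the label started at v at time 0, where at each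
  ring of an edge the transposition of its endpoints is composed (on the left) with the
  current permutation.  Almost surely only finitely many jumps happen (bounded degree), so
  the position is eventually constant.\<close>
definition stir_perm ::
  "'a set \<Rightarrow> ('a \<Rightarrow> 'a \<Rightarrow> bool) \<Rightarrow> real \<Rightarrow> ('a set \<times> nat \<Rightarrow> real) \<Rightarrow> 'a \<Rightarrow> 'a" where
  "stir_perm V adj t \<omega> v =
     (THE w. \<exists>N. \<forall>n\<ge>N. fst ((stir_step V adj \<omega> t ^^ n) (v, 0)) = w)"

end

theory Submission
  imports Defs
begin

text \<open>
  Cut \<open>[0, T]\<close> into \<open>M\<close> slots and record for each edge which slots contain a ring; as \<open>M\<close> grows,
  these bits are independent and, with high probability, no two rings of a finite subtree share
  a slot. Following a vertex and restarting at time \<open>0\<close> whenever time \<open>T\<close> is reached gives a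
  walk on vertices and cyclic time, which is unbounded only if the cycle of the vertex is infinite.

  Let \<open>q\<close> bound the probability that the walk, having just entered the subtree of \<open>v\<close> from the
  parent, leaves it again before reaching a given depth. The walk at \<open>v\<close> first meets the parent
  edge with probability about \<open>1 / (d + 1)\<close>; otherwise it enters a child \<open>w\<close>, and on leaving \<open>w\<close>
  (probability at most \<open>q\<close>) it soon enters a fresh child \<open>u\<close> unless it meets the edges of the
  parent or of \<open>w\<close>, or the part of the time circle already examined at \<open>v\<close>. Hence the next
  bound is at most \<open>a + b q + q\<^sup>2\<close> with small \<open>a, b\<close>, and \<open>q = 3 / 10\<close> is preserved by
  induction on the depth. All vertices of a large layer then fail simultaneously with small
  probability, since their subtrees are disjoint.
\<close>


section \<open>Expectations over independent bits\<close>

text \<open>Conditioning takes the form of editing finite sets: a bit found off is deleted from the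
  index set of \<open>bexp\<close>, a bit found on is inserted into the argument. This is why bounds
  on leaving a subtree are proved for an arbitrary set of still random bits on the entrance edge.
  The main obstacle is that the exit slot of \<open>w\<close> is determined by bits of
  \<open>w\<close> that also steer the walk afterwards; fixing everything below \<open>w\<close> and
  revealing the bits of \<open>w\<close> in the order of the run separates the two. With slot length
  \<open>\<delta> = T / M\<close>, a window has \<open>L\<close> slots, about
  \<open>3 / (d * \<delta>)\<close>, that is time \<open>3 / d\<close>. The losses are then a few
  multiples of \<open>1 / d\<close> plus terms near \<open>exp (-6)\<close> and
  \<open>exp (-3)\<close>, small enough at \<open>d = 39\<close> for
  \<open>a + b * q + q\<^sup>2 \<le> q\<close> at \<open>q = 3 / 10\<close>. The bound is uniform in
  large \<open>M\<close> and in the depth, so no limit of the discrete models is taken: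
  \<open>M\<close> is chosen as a function of the truncation level \<open>n\<close>, large enough
  for the probability of two rings in one slot to be summable in \<open>n\<close>, while the
  probability that the path from a fixed vertex reaches level \<open>n\<close> by time
  \<open>T\<close> decays geometrically for every \<open>M\<close>. Borel-Cantelli then removes both
  errors.\<close>

definition bexp :: "real \<Rightarrow> 'b set \<Rightarrow> ('b set \<Rightarrow> real) \<Rightarrow> real" where
  "bexp p S F = (\<Sum>A\<in>Pow S. p ^ card A * (1 - p) ^ card (S - A) * F A)"

lemma bexp_empty [simp]: "bexp p {} F = F {}"
  by (simp add: bexp_def)

text \<open>Conditioning on the single bit \<open>b\<close>. In the off half \<open>F\<close> is
  unchanged, because a bit missing from the index set is read as off. All explorations below iterate
  this identity.\<close>

lemma bexp_insert:
  assumes "finite S" "b \<notin> S"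
  shows "bexp p (insert b S) F = p * bexp p S (\<lambda>A. F (insert b A)) + (1 - p) * bexp p S F"
proof -
  let ?g = "\<lambda>A. p ^ card A * (1 - p) ^ card (insert b S - A) * F A"
  have fin: "finite (Pow S)" "finite (insert b ` Pow S)" using assms by auto
  have inj: "inj_on (insert b) (Pow S)" using assms by (auto simp: inj_on_def)
  have "bexp p (insert b S) F = sum ?g (Pow S) + sum ?g (insert b ` Pow S)"
    unfolding bexp_def Pow_insert using assms by (intro sum.union_disjoint fin) auto
  also have "sum ?g (Pow S) = (1 - p) * bexp p S F"
    unfolding bexp_def sum_distrib_left
  proof (rule sum.cong[OF refl])
    fix A assume A: "A \<in> Pow S"
    have "card (insert b S - A) = Suc (card (S - A))"
      using assms A by (subst insert_Diff_if) (auto simp: card_insert_if)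
    then show "?g A = (1 - p) * (p ^ card A * (1 - p) ^ card (S - A) * F A)" by simp
  qed
  also have "sum ?g (insert b ` Pow S) = (\<Sum>A\<in>Pow S. ?g (insert b A))"
    by (rule sum.reindex[OF inj, unfolded comp_def])
  also have "\<dots> = p * bexp p S (\<lambda>A. F (insert b A))"
    unfolding bexp_def sum_distrib_left
  proof (rule sum.cong[OF refl])
    fix A assume A: "A \<in> Pow S"
    have "card (insert b A) = Suc (card A)"
      using assms A finite_subset by (subst card_insert_disjoint) auto
    moreover have "insert b S - insert b A = S - A" using assms A by auto
    ultimately show "?g (insert b A) = p * (p ^ card A * (1 - p) ^ card (S - A) * F (insert b A))"
      by simp
  qed
  finally show ?thesis by simp
qed

lemma bexp_cong: "(\<And>A. A \<subseteq> S \<Longrightarrow> F A = G A) \<Longrightarrow> bexp p S F = bexp p S G"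
  unfolding bexp_def by (intro sum.cong) auto

lemma bexp_add: "bexp p S (\<lambda>A. F A + G A) = bexp p S F + bexp p S G"
  unfolding bexp_def by (simp add: algebra_simps sum.distrib)

lemma bexp_cmult: "bexp p S (\<lambda>A. c * F A) = c * bexp p S F"
  unfolding bexp_def by (simp add: algebra_simps sum_distrib_left)

lemma bexp_const: "finite S \<Longrightarrow> bexp p S (\<lambda>A. c) = c"
  by (induction S rule: finite_induct) (auto simp: bexp_insert algebra_simps)

lemma bexp_Un:
  assumes "finite S" "finite S'" "S \<inter> S' = {}"
  shows "bexp p (S \<union> S') F = bexp p S (\<lambda>A. bexp p S' (\<lambda>A'. F (A \<union> A')))"
  using assms(1,3)
proof (induction S arbitrary: F rule: finite_induct)
  case (insert b S)
  have "bexp p (insert b S \<union> S') F = p * bexp p (S \<union> S') (\<lambda>A. F (insert b A)) + (1 - p) * bexp p (S \<union> S') F"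
    using insert assms(2) by (simp add: bexp_insert)
  then show ?case using insert by (simp add: bexp_insert)
qed auto

lemma bexp_restrict:
  assumes "finite S" "S1 \<subseteq> S" "\<And>A. A \<subseteq> S \<Longrightarrow> F A = F (A \<inter> S1)"
  shows "bexp p S F = bexp p S1 F"
proof -
  have fin: "finite S1" "finite (S - S1)" using assms finite_subset by auto
  have "bexp p S F = bexp p (S1 \<union> (S - S1)) F" using assms(2) by (simp add: Un_absorb1)
  also have "\<dots> = bexp p S1 (\<lambda>A. bexp p (S - S1) (\<lambda>A'. F (A \<union> A')))"
    using fin by (intro bexp_Un) auto
  also have "\<dots> = bexp p S1 (\<lambda>A. bexp p (S - S1) (\<lambda>A'. F A))"
  proof (intro bexp_cong)
    fix A A' assume A: "A \<subseteq> S1" "A' \<subseteq> S - S1"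
    have "(A \<union> A') \<inter> S1 = A" using A by auto
    then show "F (A \<union> A') = F A" using assms(3)[of "A \<union> A'"] A assms(2) by auto
  qed
  finally show ?thesis using fin by (simp add: bexp_const)
qed

context
  fixes p :: real
  assumes p: "0 \<le> p" "p \<le> 1"
begin

lemma bexp_mono: "(\<And>A. A \<subseteq> S \<Longrightarrow> F A \<le> G A) \<Longrightarrow> bexp p S F \<le> bexp p S G"
  unfolding bexp_def using p by (intro sum_mono mult_left_mono) auto

lemma bexp_nonneg: "(\<And>A. A \<subseteq> S \<Longrightarrow> 0 \<le> F A) \<Longrightarrow> 0 \<le> bexp p S F"
  unfolding bexp_def using p by (intro sum_nonneg mult_nonneg_nonneg) auto

lemma bexp_le_const: "finite S \<Longrightarrow> (\<And>A. A \<subseteq> S \<Longrightarrow> F A \<le> c) \<Longrightarrow> bexp p S F \<le> c"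
  using bexp_mono[of S F "\<lambda>_. c"] by (simp add: bexp_const)

text \<open>Forces a bit to be off at the price of the probability \<open>p\<close> that it is on.
  Unwanted rings, such as one of the parent edge, are charged in this way.\<close>

lemma bexp_remove1_le:
  assumes "finite S" "\<And>A. A \<subseteq> S \<Longrightarrow> 0 \<le> F A" "\<And>A. A \<subseteq> S \<Longrightarrow> F A \<le> 1"
  shows "bexp p S F \<le> p + bexp p (S - {b}) F"
proof (cases "b \<in> S")
  case True
  have "bexp p S F = bexp p (insert b (S - {b})) F" using True by (simp add: insert_absorb)
  also have "\<dots> = p * bexp p (S - {b}) (\<lambda>A. F (insert b A)) + (1 - p) * bexp p (S - {b}) F"
    using assms by (intro bexp_insert) auto
  also have "\<dots> \<le> p * 1 + 1 * bexp p (S - {b}) F"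
    using p assms True
    by (intro add_mono mult_left_mono mult_right_mono bexp_le_const bexp_nonneg) (auto simp: subset_iff)
  finally show ?thesis by simp
qed (use p in auto)

lemma bexp_remove_le:
  assumes "finite S" "finite B" "\<And>A. A \<subseteq> S \<Longrightarrow> 0 \<le> F A" "\<And>A. A \<subseteq> S \<Longrightarrow> F A \<le> 1"
  shows "bexp p S F \<le> p * card B + bexp p (S - B) F"
  using assms(2)
proof (induction B rule: finite_induct)
  case (insert b B)
  have "bexp p (S - B) F \<le> p + bexp p (S - B - {b}) F"
    by (rule bexp_remove1_le) (use assms in auto)
  moreover have "S - B - {b} = S - insert b B" by auto
  ultimately show ?case using insert by (simp add: algebra_simps)
qed auto

text \<open>The bits of \<open>bs\<close> are revealed in order until one is on. Those before it are
  then off and those after it still fresh, which is what the index set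
  \<open>S - set (xs @ [b])\<close> expresses; the two weights are the probabilities of finding some
  bit on and of finding none.\<close>

lemma bexp_scan:
  assumes "finite S" "distinct bs" "set bs \<subseteq> S"
    and "\<And>xs b ys. bs = xs @ b # ys \<Longrightarrow>
      bexp p (S - set (xs @ [b])) (\<lambda>A. F (insert b A)) \<le> \<kappa>"
  shows "bexp p S F \<le> \<kappa> * (1 - (1 - p) ^ length bs) + (1 - p) ^ length bs * bexp p (S - set bs) F"
  using assms
proof (induction bs arbitrary: S)
  case (Cons b bs)
  let ?S = "S - {b}"
  have 1: "bexp p S F = p * bexp p ?S (\<lambda>A. F (insert b A)) + (1 - p) * bexp p ?S F"
    using bexp_insert[of ?S b p F] Cons.prems by (simp add: insert_absorb)
  have 2: "bexp p ?S (\<lambda>A. F (insert b A)) \<le> \<kappa>"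
    using Cons.prems(4)[of "[]" b bs] by simp
  have 3: "bexp p ?S F \<le> \<kappa> * (1 - (1 - p) ^ length bs) + (1 - p) ^ length bs * bexp p (?S - set bs) F"
  proof (rule Cons.IH)
    fix xs b' ys assume "bs = xs @ b' # ys"
    moreover have "?S - set (xs @ [b']) = S - set ((b # xs) @ [b'])" by auto
    ultimately show "bexp p (?S - set (xs @ [b'])) (\<lambda>A. F (insert b' A)) \<le> \<kappa>"
      using Cons.prems(4)[of "b # xs" b' ys] by simp
  qed (use Cons.prems in auto)
  have 4: "?S - set bs = S - set (b # bs)" by auto
  show ?case
    using mult_left_mono[OF 2 p(1)] mult_left_mono[OF 3, of "1 - p"] p 
    unfolding 1 4 by (simp add: algebra_simps)
qed auto

end

section \<open>The walk in discretised time\<close>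

text \<open>
  The slots examined at a vertex entered at slot \<open>m\<close>: \<open>B\<close> are the slots at which the edge to
  the parent rings, and \<open>e x\<close> is the slot at which the walk is back after an excursion into a
  child begun at slot \<open>x\<close>, \<open>None\<close> if the excursion reaches the target depth. Meeting an
  already examined slot counts as leaving through the entrance slot \<open>m\<close>; if all rings
  lie in different slots this can only happen at \<open>m\<close> itself. The fuel \<open>k = M\<close> never runs out.
\<close>

fun run :: "nat \<Rightarrow> nat \<Rightarrow> (nat \<Rightarrow> nat option) \<Rightarrow> nat set \<Rightarrow> nat set \<Rightarrow> nat \<Rightarrow> nat \<Rightarrow> nat option" where
  "run M m e B seen 0 x = Some m"
| "run M m e B seen (Suc k) x =
    (if x \<in> seen then Some m else if x \<in> B then Some x
     else case e x of None \<Rightarrow> None | Some y \<Rightarrow> run M m e B (insert x seen) k (Suc y mod M))"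

text \<open>Without a ringing child the walk stays put during slot \<open>x\<close>, so it is back
  at \<open>x\<close> itself. Taking the first ringing child in list order matches the order of
  \<open>bexp_scan\<close>; the link with the walk is made only when rings are alone in their
  slots.\<close>

definition probe :: "'a list \<Rightarrow> ('a \<Rightarrow> nat \<Rightarrow> nat option) \<Rightarrow> ('a \<times> nat) set \<Rightarrow> nat \<Rightarrow> nat option" where
  "probe ws E A x = (case find (\<lambda>w. (w, x) \<in> A) ws of None \<Rightarrow> Some x | Some w \<Rightarrow> E w x)"

text \<open>Height \<open>0\<close> is reached on arrival, hence \<open>None\<close>. The entrance
  slot \<open>m\<close> counts as examined from the start, and the run begins one slot
  later.\<close>

primrec exit_slot :: "nat \<Rightarrow> ('a \<Rightarrow> 'a list) \<Rightarrow> nat \<Rightarrow> 'a \<Rightarrow> ('a \<times> nat) set \<Rightarrow> nat \<Rightarrow> nat option" where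
  "exit_slot M ch 0 v A m = None"
| "exit_slot M ch (Suc h) v A m =
    run M m (probe (ch v) (\<lambda>w. exit_slot M ch h w A) A) {x. (v, x) \<in> A} {m} M (Suc m mod M)"

primrec dsc :: "('a \<Rightarrow> 'a list) \<Rightarrow> nat \<Rightarrow> 'a \<Rightarrow> 'a set" where
  "dsc ch 0 v = {}"
| "dsc ch (Suc h) v = (\<Union>w\<in>set (ch v). insert w (dsc ch h w))"

lemma finite_dsc [simp]: "finite (dsc ch h v)"
  by (induction h arbitrary: v) auto

lemma find_first: "\<lbrakk>P u; \<And>a. a \<in> set as \<Longrightarrow> \<not> P a\<rbrakk> \<Longrightarrow> find P (as @ u # bs) = Some u"
  by (induction as) auto

lemma run_cong:
  assumes "\<And>y. y \<notin> seen \<Longrightarrow> y \<in> B \<longleftrightarrow> y \<in> B'" "\<And>y. y \<notin> seen \<Longrightarrow> e y = e' y"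
  shows "run M m e B seen k x = run M m e' B' seen k x"
  using assms
proof (induction k arbitrary: seen x)
  case (Suc k)
  have "run M m e B (insert x seen) k y = run M m e' B' (insert x seen) k y" for y
    by (rule Suc.IH) (use Suc.prems in auto)
  then show ?case using Suc.prems by (auto split: option.splits)
qed auto

lemma probe_cong:
  assumes "\<And>w. w \<in> set ws \<Longrightarrow> (w, x) \<in> A \<longleftrightarrow> (w, x) \<in> A'"
    "\<And>w. w \<in> set ws \<Longrightarrow> E w x = E' w x"
  shows "probe ws E A x = probe ws E' A' x"
proof -
  have "find (\<lambda>w. (w, x) \<in> A) ws = find (\<lambda>w. (w, x) \<in> A') ws"
    by (rule find_cong) (use assms in auto)
  moreover have "w \<in> set ws" if "find (\<lambda>w. (w, x) \<in> A') ws = Some w" for w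
    using that by (auto simp: find_Some_iff)
  ultimately show ?thesis using assms(2) by (auto simp: probe_def split: option.splits)
qed

text \<open>The bit of \<open>v\<close> at \<open>m\<close> does not matter since \<open>run\<close>
  tests \<open>seen\<close> before \<open>B\<close>. So the entrance ring, which is known to be on,
  can be inserted or dropped at will.\<close>

lemma exit_slot_cong:
  assumes "\<And>u x. u \<in> dsc ch h v \<Longrightarrow> (u, x) \<in> A \<longleftrightarrow> (u, x) \<in> A'"
    "\<And>x. x \<noteq> m \<Longrightarrow> (v, x) \<in> A \<longleftrightarrow> (v, x) \<in> A'"
  shows "exit_slot M ch h v A m = exit_slot M ch h v A' m"
  using assms
proof (induction h arbitrary: v m)
  case (Suc h)
  have "exit_slot M ch h w A x = exit_slot M ch h w A' x" if "w \<in> set (ch v)" for w x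
    by (rule Suc.IH) (use that Suc.prems(1) in auto)
  moreover have "(w, x) \<in> A \<longleftrightarrow> (w, x) \<in> A'" if "w \<in> set (ch v)" for w x
    by (rule Suc.prems(1)) (use that in auto)
  ultimately show ?case unfolding exit_slot.simps
    by (intro run_cong probe_cong) (use Suc.prems(2) in auto)
qed auto

text \<open>Treats the bits in two layers: those below \<open>v\<close> are frozen to
  \<open>Z\<close>, which fixes the excursions, while those of \<open>v\<close> itself remain
  variable as \<open>B\<close>. This is the shape that \<open>run_scan\<close> expects.\<close>

lemma exit_slot_Suc_cong:
  assumes "\<And>u x. u \<in> dsc ch (Suc h) v \<Longrightarrow> (u, x) \<in> A \<longleftrightarrow> (u, x) \<in> Z"
    "\<And>x. x \<noteq> m \<Longrightarrow> (v, x) \<in> A \<longleftrightarrow> x \<in> B"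
  shows "exit_slot M ch (Suc h) v A m =
    run M m (probe (ch v) (\<lambda>w. exit_slot M ch h w Z) Z) B {m} M (Suc m mod M)"
proof -
  have "exit_slot M ch h w A x = exit_slot M ch h w Z x" if "w \<in> set (ch v)" for w x
    by (rule exit_slot_cong) (use that assms(1) in auto)
  moreover have "(w, x) \<in> A \<longleftrightarrow> (w, x) \<in> Z" if "w \<in> set (ch v)" for w x
    by (rule assms(1)) (use that in auto)
  ultimately show ?thesis unfolding exit_slot.simps
    by (intro run_cong probe_cong) (use assms(2) in auto)
qed

text \<open>
  Revealing the bits of \<open>w\<close> along the run makes the bits not yet examined independent of the
  exit slot, so \<open>\<kappa>\<close> only has to be bounded given that the examined bits (outside \<open>R'\<close>) are off.
\<close>

lemma run_scan:
  fixes Post :: "nat \<Rightarrow> ('a \<times> nat) set \<Rightarrow> real"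
  assumes p: "0 \<le> p" "p \<le> 1" and fin: "finite S'" "finite R" and w: "\<And>x. (w, x) \<notin> S'"
    and s: "\<And>R'. R' \<subseteq> R \<Longrightarrow> bexp p ({w} \<times> R' \<union> S') (Post s) \<le> \<kappa>"
    and y: "\<And>y R'. \<lbrakk>R' \<subseteq> R; y \<in> R - R'; y \<notin> W\<rbrakk> \<Longrightarrow>
      bexp p ({w} \<times> R' \<union> S') (\<lambda>A. Post y (insert (w, y) A)) \<le> \<kappa>"
    and le1: "\<And>y A. Post y A \<le> 1" and \<kappa>: "0 \<le> \<kappa>"
    and R': "R' \<subseteq> R"
  shows "bexp p ({w} \<times> R' \<union> S') (\<lambda>A. case run M s e {x. (w, x) \<in> A} seen k x of None \<Rightarrow> 0 | Some y \<Rightarrow> Post y A)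
    \<le> \<kappa> * bexp p ({w} \<times> R') (\<lambda>A. of_bool (run M s e {x. (w, x) \<in> A} seen k x \<noteq> None)) + p * card (R' \<inter> W)"
  using R'
proof (induction k arbitrary: R' seen x)
  case 0
  then have "finite R'" using fin finite_subset by auto
  then show ?case using s[OF 0] p by (simp add: bexp_const add_increasing2)
next
  case (Suc k)
  then have finR: "finite R'" using fin finite_subset by auto
  let ?F = "\<lambda>A. case run M s e {x. (w, x) \<in> A} seen (Suc k) x of None \<Rightarrow> 0 | Some y \<Rightarrow> Post y A"
  let ?G = "\<lambda>A. of_bool (run M s e {x. (w, x) \<in> A} seen (Suc k) x \<noteq> None) :: real"
  show ?case
  proof (cases "x \<in> seen")
    case True
    then show ?thesis using s[OF Suc.prems] p finR by (simp add: bexp_const add_increasing2)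
  next
    case x: False
    \<comment> \<open>Covers both ways in which the bit at \<open>x\<close> can be off: it is no
      longer random (\<open>x\<close> outside \<open>R'\<close>), or it is random and has just been
      revealed as off.\<close>
    have off: "bexp p ({w} \<times> R'' \<union> S') ?F \<le> \<kappa> * bexp p ({w} \<times> R'') ?G + p * card (R'' \<inter> W)"
      if R'': "R'' \<subseteq> R" "x \<notin> R''" for R''
    proof -
      have xA: "(w, x) \<notin> A" if "A \<subseteq> {w} \<times> R'' \<union> S'" for A using that R'' w by auto
      have xA': "(w, x) \<notin> A" if "A \<subseteq> {w} \<times> R''" for A using that R'' by auto
      show ?thesis
      proof (cases "e x")
        case None
        have "bexp p ({w} \<times> R'' \<union> S') ?F = bexp p ({w} \<times> R'' \<union> S') (\<lambda>_. 0)"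
          by (rule bexp_cong) (use x xA None in auto)
        also have "\<dots> = 0" by (simp add: bexp_def)
        also have "\<dots> \<le> \<kappa> * bexp p ({w} \<times> R'') ?G + p * card (R'' \<inter> W)"
          using p \<kappa> by (intro add_nonneg_nonneg mult_nonneg_nonneg bexp_nonneg) auto
        finally show ?thesis .
      next
        case (Some y)
        have "bexp p ({w} \<times> R'' \<union> S') ?F = bexp p ({w} \<times> R'' \<union> S')
          (\<lambda>A. case run M s e {x. (w, x) \<in> A} (insert x seen) k (Suc y mod M) of None \<Rightarrow> 0 | Some y \<Rightarrow> Post y A)"
          by (rule bexp_cong) (use x xA Some in auto)
        moreover have "bexp p ({w} \<times> R'') ?G = bexp p ({w} \<times> R'')
          (\<lambda>A. of_bool (run M s e {x. (w, x) \<in> A} (insert x seen) k (Suc y mod M) \<noteq> None))"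
          by (rule bexp_cong) (use x xA' Some in auto)
        ultimately show ?thesis using Suc.IH[OF R''(1), of "insert x seen" "Suc y mod M"] by simp
      qed
    qed
    show ?thesis
    proof (cases "x \<in> R'")
      case False
      then show ?thesis by (intro off Suc.prems)
    next
      case True
      let ?R = "R' - {x}"
      have R: "?R \<subseteq> R" "x \<notin> ?R" "finite ?R" using Suc.prems finR by auto
      have ins: "{w} \<times> R' \<union> S' = insert (w, x) ({w} \<times> ?R \<union> S')" "{w} \<times> R' = insert (w, x) ({w} \<times> ?R)"
        using True by auto
      have 1: "bexp p ({w} \<times> R' \<union> S') ?F =
          p * bexp p ({w} \<times> ?R \<union> S') (\<lambda>A. ?F (insert (w, x) A)) + (1 - p) * bexp p ({w} \<times> ?R \<union> S') ?F"
        unfolding ins(1) by (rule bexp_insert) (use R fin w in auto)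
      have 2: "bexp p ({w} \<times> R') ?G =
          p * bexp p ({w} \<times> ?R) (\<lambda>A. ?G (insert (w, x) A)) + (1 - p) * bexp p ({w} \<times> ?R) ?G"
        unfolding ins(2) by (rule bexp_insert) (use R in auto)
      have 3: "bexp p ({w} \<times> ?R) (\<lambda>A. ?G (insert (w, x) A)) = 1"
        using x R by (simp add: bexp_const)
      have 4: "bexp p ({w} \<times> ?R \<union> S') (\<lambda>A. ?F (insert (w, x) A)) = bexp p ({w} \<times> ?R \<union> S') (\<lambda>A. Post x (insert (w, x) A))"
        using x by simp
      \<comment> \<open>An exit in \<open>W\<close> gets only the trivial bound 1; multiplied by the
        probability \<open>p\<close> of the bit it contributes one unit to
        \<open>p * card (R' \<inter> W)\<close>.\<close>
      have 5: "bexp p ({w} \<times> ?R \<union> S') (\<lambda>A. Post x (insert (w, x) A)) \<le> \<kappa> + of_bool (x \<in> W)"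
      proof (cases "x \<in> W")
        case True
        have "bexp p ({w} \<times> ?R \<union> S') (\<lambda>A. Post x (insert (w, x) A)) \<le> 1"
          using p fin R le1 by (intro bexp_le_const) auto
        then show ?thesis using True \<kappa> by simp
      next
        case False
        then show ?thesis using y[of ?R x] R True Suc.prems by auto
      qed
      have 6: "real (card (R' \<inter> W)) = real (card (?R \<inter> W)) + of_bool (x \<in> W)"
      proof (cases "x \<in> W")
        case xW: True
        then have "R' \<inter> W = insert x (?R \<inter> W)" using True by auto
        then show ?thesis using xW finR by (simp add: card_insert_if)
      next
        case False
        then have "R' \<inter> W = ?R \<inter> W" by auto
        then show ?thesis using False by simp
      qed
      have key: "p * a + (1 - p) * b \<le> \<kappa> * (p * 1 + (1 - p) * g) + p * (c + z)"
        if h: "a \<le> \<kappa> + z" "b \<le> \<kappa> * g + p * c" "0 \<le> c" for a b g c z :: real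
      proof -
        have "(1 - p) * (p * c) \<le> p * c" using p h(3) by (intro mult_left_le_one_le) auto
        then show ?thesis
          using mult_left_mono[OF h(1) p(1)] mult_left_mono[OF h(2), of "1 - p"] p
          by (simp add: algebra_simps)
      qed
      show ?thesis
        unfolding 1 2 3 4 6 by (rule key[OF 5 off[OF R(1,2)]]) simp
    qed
  qed
qed

section \<open>Exploring the subtree of a vertex\<close>

lemma map_filter_split:
  "map f (filter P xs) = as @ b # bs \<Longrightarrow>
    \<exists>us u us'. xs = us @ u # us' \<and> b = f u \<and> P u \<and> as = map f (filter P us)"
proof (induction xs arbitrary: as)
  case (Cons x xs)
  show ?case
  proof (cases "P x \<and> as = []")
    case True
    then show ?thesis using Cons.prems by (intro exI[of _ "[]"] exI[of _ x] exI[of _ xs]) auto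
  next
    case False
    then obtain as' where as': "as = (if P x then f x # as' else as')" "map f (filter P xs) = as' @ b # bs"
      using Cons.prems by (cases "P x"; cases as) auto
    obtain us u us' where "xs = us @ u # us' \<and> b = f u \<and> P u \<and> as' = map f (filter P us)"
      using Cons.IH[OF as'(2)] by blast
    then show ?thesis using as'(1) by (intro exI[of _ "x # us"] exI[of _ u] exI[of _ us']) auto
  qed
qed simp

locale forest =
  fixes par :: "'a \<Rightarrow> 'a" and lev :: "'a \<Rightarrow> nat" and ch :: "'a \<Rightarrow> 'a list"
  assumes par_ch: "w \<in> set (ch v) \<Longrightarrow> par w = v"
    and lev_ch: "w \<in> set (ch v) \<Longrightarrow> lev w = Suc (lev v)"
    and distinct_ch: "distinct (ch v)"
begin

lemma dsc_lev: "u \<in> dsc ch h v \<Longrightarrow> lev v < lev u"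
proof (induction h arbitrary: v)
  case (Suc h)
  then obtain w where w: "w \<in> set (ch v)" "u = w \<or> u \<in> dsc ch h w" by auto
  then show ?case using Suc.IH[of w] lev_ch[OF w(1)] by auto
qed simp

lemma dsc_par: "u \<in> insert v (dsc ch h v) \<Longrightarrow> (par ^^ (lev u - lev v)) u = v"
proof (induction h arbitrary: v)
  case (Suc h)
  show ?case
  proof (cases "u = v")
    case False
    then obtain w where w: "w \<in> set (ch v)" "u \<in> insert w (dsc ch h w)" using Suc.prems by auto
    then have "lev w \<le> lev u" using dsc_lev by (auto intro: less_imp_le)
    then have "lev u - lev v = Suc (lev u - lev w)" using lev_ch[OF w(1)] by simp
    then show ?thesis using Suc.IH[OF w(2)] par_ch[OF w(1)] by simp
  qed auto
qed simp

text \<open>A shared vertex would have both \<open>u\<close> and \<open>w\<close> as its ancestor at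
  their common level, and that ancestor is computed by iterating \<open>par\<close>.\<close>

lemma dsc_disj:
  assumes "lev u = lev w" "u \<noteq> w"
  shows "insert u (dsc ch h u) \<inter> insert w (dsc ch h' w) = {}"
  using dsc_par[of _ u h] dsc_par[of _ w h'] assms by (metis disjoint_iff)

end

text \<open>
  In \<open>recursion\<close>, the first two terms bound the failure to find a child within \<open>2 * L\<close> slots
  before the parent edge rings, \<open>(L + 1) * p\<close> the event that the exit from that child lies less
  than \<open>L\<close> slots before the entrance slot, and the bracket the failure of the second attempt.
\<close>

locale stir_scan = forest +
  fixes M L d :: nat and p q :: real and V :: "'a set"
  assumes p: "0 < p" "p \<le> 1" and q0: "0 \<le> q"
    and V: "v \<in> V \<Longrightarrow> d \<le> length (ch v)" "v \<in> V \<Longrightarrow> set (ch v) \<subseteq> V"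
    and d: "1 \<le> d" and M: "3 * L < M"
    and recursion: "p / (1 - (1 - p) ^ d) + (1 - p) ^ (d * (2 * L)) + (L + 1) * p
      + (2 * L * p + q + (1 - p) ^ ((d - 1) * L)) * q \<le> q"
begin

section \<open>Induction step for the exit probability\<close>

definition retry_bound :: real where
  "retry_bound = 2 * L * p + q + (1 - p) ^ ((d - 1) * L)"

lemma retry_bound_nonneg: "0 \<le> retry_bound"
  using p q0 by (simp add: retry_bound_def)

definition fail :: "nat \<Rightarrow> 'a \<Rightarrow> nat \<Rightarrow> ('a \<times> nat) set \<Rightarrow> real" where
  "fail h v m A = of_bool (exit_slot M ch h v A m \<noteq> None)"

context
  fixes h m0 :: nat and v :: 'a
  assumes v: "v \<in> V" and m0: "m0 < M"
    and IH: "\<And>u s R. \<lbrakk>u \<in> set (ch v); s < M; R \<subseteq> {..<M}\<rbrakk> \<Longrightarrow>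
      bexp p (dsc ch h u \<times> {..<M} \<union> {u} \<times> R) (fail h u s) \<le> q"
begin

text \<open>Counting slots from the entrance around the circle turns the question whether a slot was
  already examined into a comparison of indices.\<close>

definition sl :: "nat \<Rightarrow> nat" where "sl i = (m0 + i) mod M"

lemma sl_less: "sl i < M"
  using m0 by (simp add: sl_def)

lemma sl_inj: "\<lbrakk>sl i = sl j; i < M; j < M\<rbrakk> \<Longrightarrow> i = j"
proof (induction i j rule: linorder_wlog)
  case (le i j)
  have "(m0 + j) mod M = (m0 + i) mod M" using le by (simp add: sl_def)
  then have "M dvd (m0 + j) - (m0 + i)" using le by (subst (asm) mod_eq_dvd_iff_nat) auto
  then show ?case using le by (auto dest: dvd_imp_le)
qed auto

lemma sl_Suc: "Suc (sl i) mod M = sl (Suc i)"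
  by (simp add: sl_def mod_Suc_eq)

lemma sl_0: "sl 0 = m0" using m0 by (simp add: sl_def)

lemma sl_surj: "s < M \<Longrightarrow> \<exists>i<M. s = sl i"
proof -
  assume s: "s < M"
  show ?thesis
  proof (cases "m0 \<le> s")
    case True
    then show ?thesis using s by (intro exI[of _ "s - m0"]) (auto simp: sl_def)
  next
    case False
    then have "(m0 + (M + s - m0)) mod M = s" using s m0 by simp
    then show ?thesis using False s m0 by (intro exI[of _ "M + s - m0"]) (auto simp: sl_def)
  qed
qed

definition cont :: "('a \<times> nat) set \<Rightarrow> nat set \<Rightarrow> nat \<Rightarrow> nat \<Rightarrow> nat option" where
  "cont A seen k x = run M m0 (probe (ch v) (\<lambda>u. exit_slot M ch h u A) A) {x. (v, x) \<in> A} seen k x"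

lemma v_notin: "u \<in> set (ch v) \<Longrightarrow> v \<notin> insert u (dsc ch h u)"
  using lev_ch[of u v] dsc_lev[of v h u] by auto

text \<open>The child \<open>w\<close> was entered at \<open>sl j\<close> and left at
  \<open>sl i\<close>; \<open>Z0\<close> holds bits already revealed in its subtree,
  \<open>Q\<close> the random ones. In the next \<open>L\<close> slots, rings of the parent edge and
  of \<open>w\<close> are excluded at cost \<open>2 * L * p\<close>. Then either a sibling is
  entered and must be left again, with probability at most \<open>q\<close>, or none of at least
  \<open>d - 1\<close> siblings rings in \<open>L\<close> slots. By \<open>i + L < M\<close> the
  window avoids the examined slots.\<close>

lemma retry:
  assumes w: "w \<in> set (ch v)" and ji: "1 \<le> j" "j \<le> i" "i + L < M"
    and Q: "finite Q" "Q \<subseteq> UNIV \<times> {..<M}"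
    and Z0: "Z0 \<subseteq> insert w (dsc ch h w) \<times> UNIV" "\<And>l. i < l \<Longrightarrow> l \<le> i + L \<Longrightarrow> (w, sl l) \<notin> Z0"
    and Qu: "\<And>u. \<lbrakk>u \<in> set (ch v); u \<noteq> w\<rbrakk> \<Longrightarrow> dsc ch h u \<times> {..<M} \<subseteq> Q"
      "\<And>u l. \<lbrakk>u \<in> set (ch v); u \<noteq> w; i < l; l \<le> i + L\<rbrakk> \<Longrightarrow> (u, sl l) \<in> Q"
  shows "bexp p Q (\<lambda>A. of_bool (cont (Z0 \<union> A) (sl ` {..j}) (M - j) (sl (Suc i)) \<noteq> None)) \<le> retry_bound"
proof -
  define W where "W = sl ` {i<..i + L}"
  define Q' where "Q' = Q - {v, w} \<times> W"
  define y where "y = (1 - p) ^ (d - 1)"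
  define seen where "seen l = sl ` ({..j} \<union> {i<..<l})" for l
  define Ql where "Ql l = Q' - set (ch v) \<times> sl ` {i<..<l}" for l
  define F where "F l A = (of_bool (cont (Z0 \<union> A) (seen l) (M - j - (l - Suc i)) (sl l) \<noteq> None) :: real)" for l A
  have y: "0 \<le> y" "y \<le> 1" using p by (auto simp: y_def power_le_one)
  \<comment> \<open>Here \<open>n\<close> is the number of slots left in the window; with none left,
    the trivial bound 1 is \<open>y ^ 0\<close>. \<open>Ql l\<close> omits the bits of the children
    in the part of the window already found silent.\<close>
  have step: "bexp p (Ql (i + 1 + L - n)) (F (i + 1 + L - n)) \<le> q + y ^ n" if "n \<le> L" for n
    using that
  proof (induction n)
    case 0
    have "bexp p (Ql (i + 1 + L)) (F (i + 1 + L)) \<le> 1"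
      using p Q by (intro bexp_le_const) (auto simp: Ql_def Q'_def F_def)
    then show ?case using q0 by simp
  next
    case (Suc n)
    define l where "l = i + L - n"
    have l: "i < l" "l \<le> i + L" "i + 1 + L - Suc n = l" "i + 1 + L - n = Suc l" "l < M"
      using Suc.prems ji by (auto simp: l_def)
    have lseen: "sl l \<notin> seen l"
      using sl_inj[of l] l ji by (auto simp: seen_def)
    define k where "k = M - j - (l - Suc i) - 1"
    \<comment> \<open>Fuel is left because \<open>j \<le> i\<close> and
      \<open>l < M\<close>.\<close>
    have k: "M - j - (l - Suc i) = Suc k" "M - j - (Suc l - Suc i) = k" using l ji by (auto simp: k_def)
    have seenS: "seen (Suc l) = insert (sl l) (seen l)"
      using l by (auto simp: seen_def less_Suc_eq)
    have slW: "sl l \<in> W" using l by (auto simp: W_def)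
    define bs where "bs = map (\<lambda>u. (u, sl l)) (filter (\<lambda>u. u \<noteq> w) (ch v))"
    have bs: "distinct bs" "set bs \<subseteq> Ql l" "length bs = length (ch v) - 1"
    proof -
      show "distinct bs" unfolding bs_def using distinct_ch by (auto simp: distinct_map inj_on_def)
      show "set bs \<subseteq> Ql l"
      proof
        fix b assume "b \<in> set bs"
        then obtain u where u: "b = (u, sl l)" "u \<in> set (ch v)" "u \<noteq> w" by (auto simp: bs_def)
        have "sl l \<notin> sl ` {i<..<l}" using sl_inj[of l] l by auto
        then show "b \<in> Ql l" using u Qu(2)[OF u(2,3) l(1,2)] v_notin[OF u(2)] by (auto simp: Ql_def Q'_def)
      qed
      have "filter (\<lambda>u. u \<noteq> w) (ch v) = removeAll w (ch v)" by (simp add: removeAll_filter_not_eq) metis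
      also have "\<dots> = remove1 w (ch v)" using distinct_ch by (simp add: distinct_remove1_removeAll)
      finally show "length bs = length (ch v) - 1" using w by (simp add: bs_def length_remove1)
    qed
    have finQ: "finite (Ql l)" using Q by (auto simp: Ql_def Q'_def)
    have ZA: "(v, x) \<notin> Z0" for x using Z0(1) v_notin[OF w] by auto
    have first: "bexp p (Ql l - set (xs @ [b])) (\<lambda>A. F l (insert b A)) \<le> q"
      if split: "bs = xs @ b # ys" for xs b ys
    proof -
      obtain us u us' where u: "ch v = us @ u # us'" "b = (u, sl l)" "u \<noteq> w"
        "xs = map (\<lambda>u. (u, sl l)) (filter (\<lambda>u. u \<noteq> w) us)"
        using map_filter_split[OF split[unfolded bs_def]] by auto
      then have uch: "u \<in> set (ch v)" by auto
      let ?Q = "Ql l - set (xs @ [b])"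
      define R where "R = {x. (u, x) \<in> ?Q}"
      have R: "R \<subseteq> {..<M}" using Q by (auto simp: R_def Ql_def Q'_def)
      have disj: "insert u (dsc ch h u) \<inter> insert w (dsc ch h w) = {}"
        by (rule dsc_disj) (use u(3) lev_ch[OF uch] lev_ch[OF w] in auto)
      \<comment> \<open>To leave \<open>v\<close> from here the walk must first leave
        \<open>u\<close>; everything after that is bounded by 1.\<close>
      have "F l (insert b A) \<le> fail h u (sl l) A" if A: "A \<subseteq> ?Q" for A
      proof -
        have "(w, sl l) \<notin> A" "(v, sl l) \<notin> A" using A slW by (auto simp: Ql_def Q'_def)
        then have nw: "(w, sl l) \<notin> Z0 \<union> insert b A" "(v, sl l) \<notin> Z0 \<union> insert b A"
          using Z0(2)[of l] l u v_notin[OF uch] ZA by auto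
        have "(a, sl l) \<notin> Z0 \<union> insert b A" if a: "a \<in> set us" for a
        proof (cases "a = w")
          case False
          have "a \<noteq> u" using a u(1) distinct_ch[of v] by auto
          moreover have "(a, sl l) \<notin> A" using a False A u(4) by auto
          moreover have "(a, sl l) \<notin> Z0"
          proof
            assume "(a, sl l) \<in> Z0"
            then have "a \<in> insert w (dsc ch h w)" using Z0(1) by auto
            moreover have "a \<in> insert a (dsc ch h a)" by auto
            moreover have "insert a (dsc ch h a) \<inter> insert w (dsc ch h w) = {}"
              by (rule dsc_disj) (use False a u(1) lev_ch[of _ v] w in auto)
            ultimately show False by blast
          qed
          ultimately show ?thesis using u by auto
        qed (use nw in auto)
        then have "find (\<lambda>a. (a, sl l) \<in> Z0 \<union> insert b A) (ch v) = Some u"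
          unfolding u(1) by (intro find_first) (use u in auto)
        then have "F l (insert b A) \<le> of_bool (exit_slot M ch h u (Z0 \<union> insert b A) (sl l) \<noteq> None)"
          unfolding F_def cont_def k run.simps using nw lseen by (auto simp: probe_def split: option.splits)
        also have "exit_slot M ch h u (Z0 \<union> insert b A) (sl l) = exit_slot M ch h u A (sl l)"
        proof (rule exit_slot_cong)
          fix u' x assume "u' \<in> dsc ch h u"
          then show "(u', x) \<in> Z0 \<union> insert b A \<longleftrightarrow> (u', x) \<in> A"
            using Z0(1) disj u dsc_lev[of u h u] by auto
        next
          fix x assume "x \<noteq> sl l"
          then show "(u, x) \<in> Z0 \<union> insert b A \<longleftrightarrow> (u, x) \<in> A"
            using Z0(1) disj u by auto
        qed
        finally show ?thesis by (simp add: fail_def)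
      qed
      then have "bexp p ?Q (\<lambda>A. F l (insert b A)) \<le> bexp p ?Q (fail h u (sl l))"
        using p by (intro bexp_mono) auto
      also have "\<dots> = bexp p (dsc ch h u \<times> {..<M} \<union> {u} \<times> R) (fail h u (sl l))"
      proof (rule bexp_restrict)
        show "finite ?Q" using finQ by auto
        have "(u', x) \<in> ?Q" if "u' \<in> dsc ch h u" "x < M" for u' x
        proof -
          have "lev v < lev u'" "u' \<notin> set (ch v)" "u' \<noteq> w" "u' \<noteq> v"
            using dsc_lev[OF that(1)] lev_ch[OF uch] lev_ch[of u' v] w by auto
          moreover have "(u', x) \<in> Q" using Qu(1)[OF uch u(3)] that by auto
          ultimately show ?thesis using u(1,2,4) by (auto simp: Ql_def Q'_def)
        qed
        then show sub: "dsc ch h u \<times> {..<M} \<union> {u} \<times> R \<subseteq> ?Q" by (auto simp: R_def)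
        fix A assume A: "A \<subseteq> ?Q"
        have "A \<subseteq> UNIV \<times> {..<M}" using A Q(2) by (auto simp: Ql_def Q'_def)
        then show "fail h u (sl l) A = fail h u (sl l) (A \<inter> (dsc ch h u \<times> {..<M} \<union> {u} \<times> R))"
          unfolding fail_def using A
          by (intro arg_cong[of _ _ "\<lambda>x. of_bool (x \<noteq> None)"] exit_slot_cong) (auto simp: R_def)
      qed
      also have "\<dots> \<le> q" by (rule IH[OF uch sl_less R])
      finally show ?thesis .
    qed
    have rest: "bexp p (Ql l - set bs) (F l) \<le> q + y ^ n"
    proof -
      have "Ql l - set bs = Ql (Suc l)"
        using l(1) slW by (auto simp: Ql_def bs_def Q'_def less_Suc_eq)
      moreover have "F l A = F (Suc l) A" if A: "A \<subseteq> Ql (Suc l)" for A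
      proof -
        have "(w, sl l) \<notin> A" "(v, sl l) \<notin> A" using A slW by (auto simp: Ql_def Q'_def)
        then have nw: "(w, sl l) \<notin> Z0 \<union> A" "(v, sl l) \<notin> Z0 \<union> A"
          using Z0(2)[of l] l ZA by auto
        have "(a, sl l) \<notin> Z0 \<union> A" if a: "a \<in> set (ch v)" for a
        proof (cases "a = w")
          case False
          have "(a, sl l) \<notin> A" using a False A l by (auto simp: Ql_def)
          moreover have "(a, sl l) \<notin> Z0"
          proof
            assume "(a, sl l) \<in> Z0"
            then have "a \<in> insert w (dsc ch h w)" using Z0(1) by auto
            moreover have "a \<in> insert a (dsc ch h a)" by auto
            moreover have "insert a (dsc ch h a) \<inter> insert w (dsc ch h w) = {}"
              by (rule dsc_disj) (use False a lev_ch[of _ v] w in auto)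
            ultimately show False by blast
          qed
          ultimately show ?thesis by auto
        qed (use nw in auto)
        then have "find (\<lambda>a. (a, sl l) \<in> Z0 \<union> A) (ch v) = None"
          by (auto simp: find_None_iff)
        then show ?thesis
          unfolding F_def cont_def k run.simps seenS using nw lseen by (simp add: probe_def sl_Suc)
      qed
      ultimately show ?thesis using Suc.IH Suc.prems l bexp_cong[of "Ql (Suc l)" "F l" "F (Suc l)" p] by simp
    qed
    have "bexp p (Ql l) (F l) \<le> q * (1 - (1 - p) ^ length bs) + (1 - p) ^ length bs * bexp p (Ql l - set bs) (F l)"
      by (rule bexp_scan) (use p finQ bs first in auto)
    also have "\<dots> \<le> q * (1 - (1 - p) ^ length bs) + (1 - p) ^ length bs * (q + y ^ n)"
      using rest p by (intro add_left_mono mult_left_mono) auto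
    also have "\<dots> = q + (1 - p) ^ length bs * y ^ n" by (simp add: algebra_simps)
    also have "\<dots> \<le> q + y * y ^ n"
      unfolding y_def using p V(1)[OF v] bs(3) y
      by (intro add_left_mono mult_right_mono power_decreasing) (auto simp: y_def)
    finally show ?case using l by simp
  qed
  have empty: "{i<..<Suc i} = {}" by auto
  have "bexp p Q (F (Suc i)) \<le> p * card ({v, w} \<times> W) + bexp p Q' (F (Suc i))"
    unfolding Q'_def by (rule bexp_remove_le) (use p Q in \<open>auto simp: W_def F_def\<close>)
  also have "card ({v, w} \<times> W) \<le> 2 * L"
  proof -
    have "card W \<le> L" unfolding W_def using card_image_le[of "{i<..i+L}" sl] by simp
    moreover have "card {v, w} \<le> 2" by (simp add: card_insert_if)
    ultimately show ?thesis unfolding card_cartesian_product by (rule mult_le_mono[rotated])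
  qed
  also have "bexp p Q' (F (Suc i)) \<le> q + y ^ L"
    using step[of L] by (simp add: Ql_def empty)
  finally have "bexp p Q (F (Suc i)) \<le> p * (2 * L) + (q + y ^ L)"
    using p by (simp add: mult_left_mono)
  also have "\<dots> = retry_bound" by (simp add: retry_bound_def y_def power_mult)
  finally show ?thesis by (simp add: F_def[abs_def] seen_def empty)
qed

text \<open>The child \<open>w\<close> has just been entered at \<open>sl j\<close>. Once all bits
  strictly below \<open>w\<close> are fixed, its excursions are a fixed function, and
  \<open>run_scan\<close> reveals the bits of \<open>w\<close> while \<open>retry\<close> bounds
  what follows the exit. Averaging over the fixed bits afterwards turns the probability of leaving
  \<open>w\<close> into at most \<open>q\<close>.\<close>

lemma attempt:
  assumes w: "w \<in> set (ch v)" and j: "1 \<le> j" "j \<le> 2 * L"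
    and S: "finite S" "S \<subseteq> UNIV \<times> {..<M}"
    and Sw: "\<And>l. \<lbrakk>1 \<le> l; l \<le> j\<rbrakk> \<Longrightarrow> (w, sl l) \<notin> S"
    and Su: "\<And>u. u \<in> set (ch v) \<Longrightarrow> dsc ch h u \<times> {..<M} \<subseteq> S"
      "\<And>u l. \<lbrakk>u \<in> set (ch v); u \<noteq> w; j < l; l < M\<rbrakk> \<Longrightarrow> (u, sl l) \<in> S"
  shows "bexp p S (\<lambda>A. case exit_slot M ch h w (insert (w, sl j) A) (sl j) of None \<Rightarrow> 0
      | Some y \<Rightarrow> of_bool (cont (insert (w, sl j) A) (sl ` {..j}) (M - j) (Suc y mod M) \<noteq> None))
    \<le> (L + 1) * p + retry_bound * q"
proof -
  define s where "s = sl j"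
  define D where "D = dsc ch h w \<times> {..<M}"
  define R where "R = {x. (w, x) \<in> S}"
  define S' where "S' = S - D - {w} \<times> R"
  \<comment> \<open>Bad exit slots: those from which a window of \<open>L\<close> slots would run
    around the circle into the entrance slot \<open>sl 0\<close>, and \<open>sl 0\<close> itself.
    There are at most \<open>L + 1\<close> of them.\<close>
  define W where "W = sl ` ({0} \<union> {M - L..<M})"
  define Post where "Post Z y A = (of_bool (cont (insert (w, s) (Z \<union> A)) (sl ` {..j}) (M - j) (Suc y mod M) \<noteq> None) :: real)" for Z y A
  have fin: "finite D" "finite R" "finite S'"
    using S unfolding D_def R_def S'_def by (auto intro: finite_subset[of _ "{..<M}"])
  have wD: "w \<notin> dsc ch h w" using dsc_lev[of w h w] by auto
  have R: "R \<subseteq> {..<M}" using S by (auto simp: R_def)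
  have Ssplit: "S = D \<union> ({w} \<times> R \<union> S')" using Su(1)[OF w] by (auto simp: S'_def D_def R_def)
  have disj: "D \<inter> ({w} \<times> R \<union> S') = {}" using wD by (auto simp: S'_def D_def)
  have wS': "(w, x) \<notin> S'" for x by (auto simp: S'_def R_def)
  let ?val = "\<lambda>A. case exit_slot M ch h w (insert (w, s) A) s of None \<Rightarrow> 0
      | Some y \<Rightarrow> of_bool (cont (insert (w, s) A) (sl ` {..j}) (M - j) (Suc y mod M) \<noteq> None)"
  have inner: "bexp p ({w} \<times> R \<union> S') (\<lambda>A. ?val (Z \<union> A))
      \<le> (L + 1) * p + retry_bound * bexp p ({w} \<times> R) (\<lambda>A. fail h w s (Z \<union> A))"
    if Z: "Z \<subseteq> D" for Z
  proof (cases h)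
    case 0
    then show ?thesis using p by (simp add: bexp_const fin fail_def)
  next
    case (Suc h')
    define e where "e = probe (ch w) (\<lambda>u. exit_slot M ch h' u Z) Z"
    have notZ: "(w, x) \<notin> Z" for x using Z wD by (auto simp: D_def)
    \<comment> \<open>Both forms of the argument are needed: without the entrance bit
      \<open>(w, s)\<close> for the hypothesis on leaving \<open>w\<close>, with it for the walk as
      it is.\<close>
    have ex: "exit_slot M ch h w A' s = run M s e {x. (w, x) \<in> A} {s} M (Suc s mod M)"
      if A: "A \<subseteq> {w} \<times> R \<union> S'" "A' = Z \<union> A \<or> A' = insert (w, s) (Z \<union> A)" for A A'
      unfolding Suc e_def
    proof (rule exit_slot_Suc_cong)
      fix u x assume u: "u \<in> dsc ch (Suc h') w"
      have "(u, x) \<notin> A"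
      proof
        assume "(u, x) \<in> A"
        then have "(u, x) \<in> S'" using A(1) u wD Suc by auto
        moreover have "x < M" using S \<open>(u, x) \<in> S'\<close> by (auto simp: S'_def)
        ultimately show False using u Suc by (auto simp: S'_def D_def)
      qed
      then show "(u, x) \<in> A' \<longleftrightarrow> (u, x) \<in> Z" using A u wD Suc by auto
    qed (use A notZ in auto)
    have rt: "bexp p ({w} \<times> R' \<union> S') (\<lambda>A. of_bool (cont (Z0 \<union> A) (sl ` {..j}) (M - j) (sl (Suc i)) \<noteq> None)) \<le> retry_bound"
      if "R' \<subseteq> R" "j \<le> i" "i + L < M" "Z0 = insert (w, s) (insert (w, sl i) Z)" for R' i Z0
    proof (rule retry[OF w, of j i])
      have "R' \<subseteq> {..<M}" using that R by auto
      then show "finite ({w} \<times> R' \<union> S')" "{w} \<times> R' \<union> S' \<subseteq> UNIV \<times> {..<M}"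
        using fin S finite_subset[of R' "{..<M}"] by (auto simp: S'_def)
      show "Z0 \<subseteq> insert w (dsc ch h w) \<times> UNIV" using Z that by (auto simp: D_def)
      show "(w, sl l) \<notin> Z0" if "i < l" "l \<le> i + L" for l
        using notZ \<open>Z0 = _\<close> that \<open>j \<le> i\<close> \<open>i + L < M\<close> sl_inj[of l i] sl_inj[of l j] by (auto simp: s_def)
      fix u assume u: "u \<in> set (ch v)" "u \<noteq> w"
      have dj: "insert u (dsc ch h u) \<inter> insert w (dsc ch h w) = {}"
        by (rule dsc_disj) (use u w lev_ch in auto)
      show "dsc ch h u \<times> {..<M} \<subseteq> {w} \<times> R' \<union> S'"
        using Su(1)[OF u(1)] dj by (auto simp: S'_def D_def)
      show "(u, sl l) \<in> {w} \<times> R' \<union> S'" if "i < l" "l \<le> i + L" for l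
        using Su(2)[OF u, of l] dj that \<open>j \<le> i\<close> \<open>i + L < M\<close> u by (auto simp: S'_def D_def)
    qed (use that j in auto)
    have "bexp p ({w} \<times> R \<union> S') (\<lambda>A. ?val (Z \<union> A)) =
      bexp p ({w} \<times> R \<union> S') (\<lambda>A. case run M s e {x. (w, x) \<in> A} {s} M (Suc s mod M) of None \<Rightarrow> 0 | Some y \<Rightarrow> Post Z y A)"
      by (rule bexp_cong) (simp add: ex Post_def split: option.split)
    also have "\<dots> \<le> retry_bound * bexp p ({w} \<times> R) (\<lambda>A. of_bool (run M s e {x. (w, x) \<in> A} {s} M (Suc s mod M) \<noteq> None))
        + p * card (R \<inter> W)"
    proof (rule run_scan[where R = R and Post = "Post Z"])
      fix R' assume R': "R' \<subseteq> R"
      show "bexp p ({w} \<times> R' \<union> S') (Post Z s) \<le> retry_bound"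
        using rt[OF R', of j "insert (w, s) Z"] j M by (simp add: Post_def[abs_def] s_def sl_Suc)
      fix y assume y: "y \<in> R - R'" "y \<notin> W"
      then obtain i where i: "i < M" "y = sl i" using R sl_surj[of y] by auto
      have "i \<noteq> 0" "\<not> M - L \<le> i" using y i by (auto simp: W_def)
      \<comment> \<open>By \<open>Sw\<close> the bits of \<open>w\<close> up to slot
        \<open>sl j\<close> are no longer random, so no random ring of \<open>w\<close> can let the
        walk out there; leaving through the entrance slot \<open>s\<close> was treated
        above.\<close>
      moreover have "\<not> (1 \<le> i \<and> i \<le> j)" using Sw[of i] y i by (auto simp: R_def)
      ultimately have ii: "j \<le> i" "i + L < M" by auto
      show "bexp p ({w} \<times> R' \<union> S') (\<lambda>A. Post Z y (insert (w, y) A)) \<le> retry_bound"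
        using rt[OF R' ii, of "insert (w, s) (insert (w, sl i) Z)"]
        by (simp add: Post_def i sl_Suc insert_commute)
    qed (use p fin wS' retry_bound_nonneg in \<open>auto simp: Post_def\<close>)
    also have "bexp p ({w} \<times> R) (\<lambda>A. of_bool (run M s e {x. (w, x) \<in> A} {s} M (Suc s mod M) \<noteq> None)) =
       bexp p ({w} \<times> R) (\<lambda>A. fail h w s (Z \<union> A))"
    proof (rule bexp_cong)
      fix A assume "A \<subseteq> {w} \<times> R"
      then have "exit_slot M ch h w (Z \<union> A) s = run M s e {x. (w, x) \<in> A} {s} M (Suc s mod M)"
        by (intro ex) auto
      then show "of_bool (run M s e {x. (w, x) \<in> A} {s} M (Suc s mod M) \<noteq> None) = fail h w s (Z \<union> A)"
        by (simp add: fail_def)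
    qed
    also have "p * card (R \<inter> W) \<le> (L + 1) * p"
    proof -
      have "card (R \<inter> W) \<le> card W" by (intro card_mono) (auto simp: W_def)
      also have "\<dots> \<le> card ({0} \<union> {M - L..<M})" unfolding W_def by (rule card_image_le) auto
      also have "\<dots> \<le> L + 1" using card_Un_le[of "{0}" "{M - L..<M}"] by simp
      finally have "real (card (R \<inter> W)) \<le> real L + 1" by linarith
      then show ?thesis using p by (simp add: mult.commute mult_left_mono)
    qed
    finally show ?thesis by (simp add: add.commute)
  qed
  have "bexp p S ?val = bexp p D (\<lambda>Z. bexp p ({w} \<times> R \<union> S') (\<lambda>A. ?val (Z \<union> A)))"
    unfolding Ssplit by (rule bexp_Un) (use fin disj in auto)
  also have "\<dots> \<le> bexp p D (\<lambda>Z. (L + 1) * p + retry_bound * bexp p ({w} \<times> R) (\<lambda>A. fail h w s (Z \<union> A)))"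
    using p by (intro bexp_mono inner) auto
  also have "\<dots> = (L + 1) * p + retry_bound * bexp p D (\<lambda>Z. bexp p ({w} \<times> R) (\<lambda>A. fail h w s (Z \<union> A)))"
    by (simp only: bexp_add bexp_cmult bexp_const fin)
  also have "bexp p D (\<lambda>Z. bexp p ({w} \<times> R) (\<lambda>A. fail h w s (Z \<union> A))) = bexp p (D \<union> {w} \<times> R) (fail h w s)"
    by (rule bexp_Un[symmetric]) (use fin wD in \<open>auto simp: D_def\<close>)
  also have "(L + 1) * p + retry_bound * bexp p (D \<union> {w} \<times> R) (fail h w s) \<le> (L + 1) * p + retry_bound * q"
    unfolding D_def by (intro add_left_mono mult_left_mono IH w R retry_bound_nonneg) (simp add: s_def sl_less)
  finally show ?thesis unfolding s_def .
qed

text \<open>In each of the first \<open>2 * L\<close> slots the parent edge is charged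
  \<open>p\<close>, then the children are scanned. With \<open>y = (1 - p) ^ d\<close> a slot
  without a ringing child has probability at most \<open>y\<close>, so the charges add up to at most
  \<open>p * (1 + y + ...)\<close>, which is \<open>p / (1 - y)\<close>; the first child found costs
  \<open>\<kappa>\<close>, and \<open>y ^ (2 * L)\<close> is left for finding none.\<close>

lemma exit_step:
  assumes R: "R \<subseteq> {..<M}"
  shows "bexp p (dsc ch (Suc h) v \<times> {..<M} \<union> {v} \<times> R) (fail (Suc h) v m0) \<le> q"
proof -
  define S where "S = dsc ch (Suc h) v \<times> {..<M} \<union> {v} \<times> R"
  define Sj where "Sj j = S - insert v (set (ch v)) \<times> sl ` {1..<j}" for j
  define F where "F j A = (of_bool (cont A (sl ` {..<j}) (Suc M - j) (sl j) \<noteq> None) :: real)" for j A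
  define \<kappa> where "\<kappa> = (L + 1) * p + retry_bound * q"
  define y where "y = (1 - p) ^ d"
  have \<kappa>: "0 \<le> \<kappa>" using p q0 retry_bound_nonneg by (simp add: \<kappa>_def)
  have y: "0 \<le> y" "y < 1" using p d by (auto simp: y_def power_less_one_iff)
  have finS: "finite S" "S \<subseteq> UNIV \<times> {..<M}" using R finite_subset[of R "{..<M}"] by (auto simp: S_def)
  have "bexp p (Sj (2 * L + 1 - n)) (F (2 * L + 1 - n)) \<le> p / (1 - y) + \<kappa> + y ^ n" if "n \<le> 2 * L" for n
    using that
  proof (induction n)
    case 0
    have "bexp p (Sj (2 * L + 1)) (F (2 * L + 1)) \<le> 1"
      using p finS by (intro bexp_le_const) (auto simp: Sj_def F_def)
    moreover have "0 \<le> p / (1 - y)" using p y by simp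
    ultimately show ?case using \<kappa> by simp
  next
    case (Suc n)
    define j where "j = 2 * L - n"
    have j: "1 \<le> j" "j \<le> 2 * L" "2 * L + 1 - Suc n = j" "2 * L + 1 - n = Suc j" "j < M"
      using Suc.prems M by (auto simp: j_def)
    have jseen: "sl j \<notin> sl ` {..<j}" using sl_inj[of j] j by auto
    have fuel: "Suc M - j = Suc (M - j)" "Suc M - Suc j = M - j" using j by auto
    have seenS: "insert (sl j) (sl ` {..<j}) = sl ` {..j}" "sl ` {..<Suc j} = sl ` {..j}"
      by (auto simp: lessThan_Suc_atMost simp flip: ivl_disj_un_singleton(2))
    define bs where "bs = map (\<lambda>u. (u, sl j)) (ch v)"
    define S' where "S' = Sj j - {(v, sl j)}"
    have S': "finite S'" "S' \<subseteq> UNIV \<times> {..<M}" using finS by (auto simp: S'_def Sj_def)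
    have chS: "(u, sl l) \<in> S" if "u \<in> set (ch v)" for u l
      using that sl_less by (auto simp: S_def)
    have bs: "distinct bs" "set bs \<subseteq> S'" "length bs = length (ch v)"
    proof -
      show "distinct bs" unfolding bs_def using distinct_ch by (auto simp: distinct_map inj_on_def)
      have "sl j \<notin> sl ` {1..<j}" using jseen by auto
      then show "set bs \<subseteq> S'" using chS v_notin by (auto simp: bs_def S'_def Sj_def)
    qed (simp add: bs_def)
    have first: "bexp p (S' - set (xs @ [b])) (\<lambda>A. F j (insert b A)) \<le> \<kappa>"
      if split: "bs = xs @ b # ys" for xs b ys
    proof -
      have "map (\<lambda>u. (u, sl j)) (filter (\<lambda>_. True) (ch v)) = xs @ b # ys"
        using split by (simp add: bs_def)
      from map_filter_split[OF this]
      obtain us w us' where w: "ch v = us @ w # us'" "b = (w, sl j)" "xs = map (\<lambda>u. (u, sl j)) us"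
        by auto
      then have wch: "w \<in> set (ch v)" by auto
      let ?S = "S' - set (xs @ [b])"
      have "F j (insert b A) = (case exit_slot M ch h w (insert (w, sl j) A) (sl j) of None \<Rightarrow> 0
          | Some y \<Rightarrow> of_bool (cont (insert (w, sl j) A) (sl ` {..j}) (M - j) (Suc y mod M) \<noteq> None))"
        if A: "A \<subseteq> ?S" for A
      proof -
        have "(v, sl j) \<notin> insert b A" using A w v_notin[OF wch] by (auto simp: S'_def)
        moreover have "(a, sl j) \<notin> insert b A" if "a \<in> set us" for a
          using that A w distinct_ch[of v] by auto
        then have "find (\<lambda>a. (a, sl j) \<in> insert b A) (ch v) = Some w"
          unfolding w(1) by (intro find_first) (use w in auto)
        ultimately show ?thesis
          unfolding F_def cont_def fuel run.simps seenS using jseen w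
          by (auto simp: probe_def split: option.split)
      qed
      then have "bexp p ?S (\<lambda>A. F j (insert b A)) = bexp p ?S (\<lambda>A. case exit_slot M ch h w (insert (w, sl j) A) (sl j) of None \<Rightarrow> 0
          | Some y \<Rightarrow> of_bool (cont (insert (w, sl j) A) (sl ` {..j}) (M - j) (Suc y mod M) \<noteq> None))"
        by (intro bexp_cong)
      also have "\<dots> \<le> \<kappa>"
        unfolding \<kappa>_def
      proof (rule attempt[OF wch j(1,2)])
        show "(w, sl l) \<notin> ?S" if "1 \<le> l" "l \<le> j" for l
          using that w wch by (cases "l = j") (auto simp: S'_def Sj_def)
        fix u assume u: "u \<in> set (ch v)"
        have "u' \<notin> insert v (set (ch v))" if "u' \<in> dsc ch h u" for u'
          using dsc_lev[OF that] lev_ch[OF u] lev_ch[of u' v] by auto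
        moreover have "dsc ch h u \<subseteq> dsc ch (Suc h) v" using u by auto
        ultimately show "dsc ch h u \<times> {..<M} \<subseteq> ?S"
          using w by (auto simp: S'_def Sj_def S_def)
        show "(u, sl l) \<in> ?S" if "u \<noteq> w" "j < l" "l < M" for l
        proof -
          have "sl l \<noteq> sl x" if "x \<le> j" for x using sl_inj[of l x] that \<open>j < l\<close> \<open>l < M\<close> by auto
          then have "sl l \<notin> sl ` {..j}" by blast
          then have "sl l \<notin> sl ` {1..<j}" "sl l \<noteq> sl j" by auto
          then show ?thesis using chS[OF u] v_notin[OF u] w that by (auto simp: S'_def Sj_def)
        qed
      qed (use S' in auto)
      finally show ?thesis .
    qed
    have rest: "bexp p (S' - set bs) (F j) \<le> p / (1 - y) + \<kappa> + y ^ n"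
    proof -
      have "S' - set bs = Sj (Suc j)"
        using j by (auto simp: S'_def Sj_def bs_def less_Suc_eq)
      moreover have "F j A = F (Suc j) A" if A: "A \<subseteq> Sj (Suc j)" for A
      proof -
        have "(a, sl j) \<notin> A" if "a \<in> insert v (set (ch v))" for a
          using that A j by (auto simp: Sj_def)
        then have "(v, sl j) \<notin> A" "find (\<lambda>a. (a, sl j) \<in> A) (ch v) = None"
          by (auto simp: find_None_iff)
        then show ?thesis
          unfolding F_def cont_def fuel run.simps seenS using jseen by (simp add: probe_def sl_Suc)
      qed
      ultimately show ?thesis using Suc.IH Suc.prems j bexp_cong[of "Sj (Suc j)" "F j" "F (Suc j)" p] by simp
    qed
    let ?z = "(1 - p) ^ length bs"
    have z: "0 \<le> ?z" "?z \<le> y"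
      using p V(1)[OF v] bs(3) by (auto simp: y_def intro!: power_decreasing)
    have "bexp p (Sj j) (F j) \<le> p + bexp p S' (F j)"
      unfolding S'_def by (rule bexp_remove1_le) (use p finS in \<open>auto simp: F_def Sj_def\<close>)
    also have "bexp p S' (F j) \<le> \<kappa> * (1 - ?z) + ?z * bexp p (S' - set bs) (F j)"
      by (rule bexp_scan) (use p S' bs first in auto)
    also have "\<dots> \<le> \<kappa> * (1 - ?z) + ?z * (p / (1 - y) + \<kappa> + y ^ n)"
      using rest z by (intro add_left_mono mult_left_mono) auto
    also have "\<dots> = \<kappa> + ?z * (p / (1 - y) + y ^ n)" by (simp add: algebra_simps)
    also have "\<dots> \<le> \<kappa> + y * (p / (1 - y) + y ^ n)"
      using z y p by (intro add_left_mono mult_right_mono) auto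
    \<comment> \<open>The bound reproduces itself because \<open>p / (1 - y)\<close> solves
      \<open>x = p + y * x\<close>.\<close>
    also have "p + (\<kappa> + y * (p / (1 - y) + y ^ n)) = p / (1 - y) + \<kappa> + y ^ Suc n"
      using y by (simp add: field_simps)
    finally show ?case using j by simp
  qed
  from this[of "2 * L"] have "bexp p (Sj 1) (F 1) \<le> p / (1 - y) + \<kappa> + y ^ (2 * L)" by simp
  also have "\<dots> \<le> q" using recursion by (simp add: \<kappa>_def y_def retry_bound_def power_mult)
  \<comment> \<open>For index 1 the examined set is just the entrance slot and the fuel is
    \<open>M\<close>, as in the definition of \<open>exit_slot\<close>.\<close>
  also have "F 1 = fail (Suc h) v m0"
    using sl_Suc[of 0] by (auto simp: F_def fail_def cont_def sl_0 lessThan_Suc)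
  also have "Sj 1 = S" by (simp add: Sj_def)
  finally show ?thesis by (simp add: S_def)
qed

end

text \<open>
  The bits of \<open>v\<close> outside \<open>R\<close> are off: they have been examined before the walk enters \<open>v\<close>.
\<close>

theorem exit_bound:
  assumes "v \<in> V" "m < M" "R \<subseteq> {..<M}"
  shows "bexp p (dsc ch h v \<times> {..<M} \<union> {v} \<times> R) (fail h v m) \<le> q"
  using assms
proof (induction h arbitrary: v m R)
  case 0
  have "finite R" using 0 finite_subset by auto
  then show ?case using q0 by (simp add: fail_def[abs_def] bexp_const)
next
  case (Suc h)
  show ?case
    by (rule exit_step[OF Suc.prems(1,2) _ Suc.prems(3)]) (use Suc.IH V(2)[OF Suc.prems(1)] in auto)
qed

end

section \<open>Exits are steps of a reversible walk\<close>

context forest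
begin

text \<open>If several edges ring in a slot, an arbitrary one is taken. Thus \<open>swp A m\<close>
  is always injective, and for \<open>bars A\<close> it raises the level by at most one, so that
  \<open>reach_bound\<close> applies before clumped rings are excluded.\<close>

definition swp :: "('a \<times> nat) set \<Rightarrow> nat \<Rightarrow> 'a \<Rightarrow> 'a" where
  "swp A m = (if \<exists>w. (w, m) \<in> A then let w = (SOME w. (w, m) \<in> A) in Transposition.transpose (par w) w else id)"

text \<open>The slot advances before its swap is applied: in a state \<open>(x, m)\<close> slot
  \<open>m\<close> is already processed. Starting at time 0 therefore means starting at slot
  \<open>M - 1\<close>.\<close>

definition walk :: "nat \<Rightarrow> ('a \<times> nat) set \<Rightarrow> 'a \<times> nat \<Rightarrow> 'a \<times> nat" where
  "walk M A s = (swp A (Suc (snd s) mod M) (fst s), Suc (snd s) mod M)"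

definition bars :: "('a \<times> nat) set \<Rightarrow> bool" where
  "bars A \<longleftrightarrow> (\<forall>w m. (w, m) \<in> A \<longrightarrow> w \<in> set (ch (par w)))"

definition simple_bars :: "('a \<times> nat) set \<Rightarrow> bool" where
  "simple_bars A \<longleftrightarrow> bars A \<and> (\<forall>w w' m. (w, m) \<in> A \<longrightarrow> (w', m) \<in> A \<longrightarrow> w = w')"

definition below :: "'a \<Rightarrow> 'a \<Rightarrow> bool" where
  "below v u \<longleftrightarrow> (\<exists>j. (par ^^ j) u = v \<and> lev u = lev v + j)"

lemma below_refl: "below v v"
  unfolding below_def by (intro exI[of _ 0]) simp

lemma below_ch: "\<lbrakk>w \<in> set (ch v); below w u\<rbrakk> \<Longrightarrow> below v u"
  unfolding below_def by (metis par_ch lev_ch add_Suc_right add_Suc comp_apply funpow.simps(2))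

lemma swp_eq: "\<lbrakk>simple_bars A; (w, m) \<in> A\<rbrakk> \<Longrightarrow> swp A m = Transposition.transpose (par w) w"
  unfolding swp_def simple_bars_def Let_def by (metis (mono_tags, lifting) someI)

lemma swp_par: "\<lbrakk>simple_bars A; (v, m) \<in> A\<rbrakk> \<Longrightarrow> swp A m v = par v"
  by (simp add: swp_eq)

lemma swp_ch: "\<lbrakk>simple_bars A; (w, m) \<in> A; w \<in> set (ch v)\<rbrakk> \<Longrightarrow> swp A m v = w"
  using par_ch by (simp add: swp_eq)

lemma swp_stay:
  assumes "simple_bars A" "(v, m) \<notin> A" "\<And>w. w \<in> set (ch v) \<Longrightarrow> (w, m) \<notin> A"
  shows "swp A m v = v"
proof (cases "\<exists>w. (w, m) \<in> A")
  case True
  then obtain w where w: "(w, m) \<in> A" by auto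
  then have "w \<in> set (ch (par w))" using assms(1) by (auto simp: simple_bars_def bars_def)
  then have "v \<noteq> w" "v \<noteq> par w" using w assms by auto
  then show ?thesis using swp_eq[OF assms(1) w] by (simp add: Transposition.transpose_def)
qed (simp add: swp_def)

lemma inj_swp: "inj (swp A m)"
  by (auto simp: swp_def Let_def)

lemma snd_walk: "0 < M \<Longrightarrow> snd s < M \<Longrightarrow> snd ((walk M A ^^ k) s) < M"
  by (induction k) (auto simp: walk_def)

lemma walk_inj:
  assumes "walk M A s = walk M A s'" "snd s < M" "snd s' < M"
  shows "s = s'"
proof -
  have "Suc (snd s) mod M = Suc (snd s') mod M" using assms(1) by (simp add: walk_def)
  then have "snd s = snd s'" using assms(2,3) by (auto simp: mod_Suc split: if_splits)
  moreover have "fst s = fst s'"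
    using assms(1) calculation inj_swp by (auto simp: walk_def dest: injD)
  ultimately show ?thesis by (simp add: prod_eq_iff)
qed

text \<open>Steps of the walk are injective and can be cancelled one by one, so a repeated state
  forces a return to the initial one.\<close>

lemma walk_return:
  assumes "(walk M A ^^ i) s = (walk M A ^^ (i + n)) s" "snd s < M"
  shows "(walk M A ^^ n) s = s"
  using assms(1)
proof (induction i)
  case (Suc i)
  have "0 < M" using assms(2) by simp
  then show ?case
    using Suc walk_inj[of M A "(walk M A ^^ i) s" "(walk M A ^^ (i + n)) s"] snd_walk assms(2) by simp
qed simp

text \<open>The first half also covers a vertex at which the walk is merely started, and is the half
  applied in the end. The second half, for a vertex entered through a ring at \<open>m\<close>,
  makes the induction work on excursions into children.\<close>

lemma exit_walk:
  assumes A: "simple_bars A" and m: "m < M"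
  shows "(exit_slot M ch h v A m = None \<longrightarrow> (\<exists>k. lev (fst ((walk M A ^^ k) (v, m))) = lev v + h)) \<and>
    (\<forall>m'. exit_slot M ch h v A m = Some m' \<longrightarrow> (v, m) \<in> A \<longrightarrow>
      m' < M \<and> (\<exists>k. (walk M A ^^ k) (v, m) = (par v, m') \<and> (\<forall>i<k. below v (fst ((walk M A ^^ i) (v, m))))))"
  using m
proof (induction h arbitrary: v m)
  case 0
  have "lev (fst ((walk M A ^^ 0) (v, m))) = lev v + 0" by simp
  then show ?case by (auto intro: exI[of _ 0])
next
  case (Suc h)
  note IHh = Suc.IH and \<open>m < M\<close>
  define e where "e = probe (ch v) (\<lambda>w. exit_slot M ch h w A) A"
  define s where "s k = (walk M A ^^ k) (v, m)" for k
  let ?goal = "\<lambda>res. (res = None \<longrightarrow> (\<exists>k. lev (fst (s k)) = lev v + Suc h)) \<and>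
    (\<forall>m'. res = Some m' \<longrightarrow> (v, m) \<in> A \<longrightarrow> m' < M \<and> (\<exists>k. s k = (par v, m') \<and> (\<forall>i<k. below v (fst (s i)))))"
  have sadd: "(walk M A ^^ i) (s j) = s (i + j)" for i j by (simp add: s_def funpow_add)
  have not_below: "\<not> below v (par v)" if "(v, m) \<in> A"
  proof -
    have "v \<in> set (ch (par v))" using that A by (auto simp: simple_bars_def bars_def)
    then have "lev v = Suc (lev (par v))" by (rule lev_ch)
    then show ?thesis by (auto simp: below_def)
  qed
  \<comment> \<open>Invariant of the run: at step \<open>K\<close> the walk is back at
    \<open>v\<close>, it has not left the subtree so far, and each examined slot other than
    \<open>m\<close> was entered from \<open>v\<close> at an earlier step. The equation for
    \<open>card seen\<close> shows that the fuel cannot run out.\<close>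
  have "?goal (run M m e {x. (v, x) \<in> A} seen k x)"
    if "s K = (v, y)" "y < M" "x = Suc y mod M" "\<And>i. i \<le> K \<Longrightarrow> below v (fst (s i))"
      "seen \<subseteq> {..<M}" "card seen + k = Suc M"
      "\<And>z. z \<in> seen - {m} \<Longrightarrow> \<exists>i<K. \<exists>y'. s i = (v, y') \<and> y' < M \<and> z = Suc y' mod M"
    for K y x seen k
    using that
  proof (induction k arbitrary: K y x seen)
    case 0
    have "card seen \<le> M" using 0 card_mono[of "{..<M}" seen] by simp
    then show ?case using 0 by simp
  next
    case (Suc k)
    have sS: "s (Suc K) = (swp A x v, x)" using Suc.prems by (simp add: s_def walk_def)
    have x: "x < M" using Suc.prems m by auto
    show ?case
    proof (cases "x \<in> seen")
      case True
      then have res: "run M m e {x. (v, x) \<in> A} seen (Suc k) x = Some m" by simp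
      have "\<exists>k. s k = (par v, m) \<and> (\<forall>i<k. below v (fst (s i)))" if vm: "(v, m) \<in> A"
      proof (cases "x = m")
        case True
        then show ?thesis using sS swp_par[OF A vm] Suc.prems(4) by (intro exI[of _ "Suc K"]) auto
      next
        case False
        then obtain i y' where i: "i < K" "s i = (v, y')" "y' < M" "x = Suc y' mod M"
          using Suc.prems(7)[of x] \<open>x \<in> seen\<close> by auto
        \<comment> \<open>An examined slot other than \<open>m\<close> would mean a repeated state.
          By reversibility the walk then returns to \<open>(v, m)\<close>; because of the ring at
          \<open>m\<close> the state just before that is at \<open>par v\<close>, although the walk
          has stayed below \<open>v\<close>.\<close>
        have "y' = y" using i(3,4) Suc.prems(2,3) by (auto simp: mod_Suc split: if_splits)
        then have "(walk M A ^^ i) (v, m) = (walk M A ^^ (i + (K - i))) (v, m)"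
          using i Suc.prems(1) by (simp add: s_def)
        then have "s (K - i) = (v, m)" using walk_return[where M = M and A = A and i = i and s = "(v, m)" and n = "K - i"] \<open>m < M\<close> by (simp add: s_def)
        moreover obtain n where n: "K - i = Suc n" using i by (metis Suc_diff_Suc)
        ultimately have wn: "walk M A (s n) = (v, m)" by (simp add: s_def)
        then have sm: "Suc (snd (s n)) mod M = m" by (simp add: walk_def)
        have "walk M A (s n) = walk M A (par v, snd (s n))"
          unfolding wn by (simp add: walk_def sm swp_eq[OF A vm])
        moreover have sn: "snd (s n) < M"
          using snd_walk[where M = M and A = A and s = "(v, m)" and k = n] \<open>m < M\<close> by (simp add: s_def)
        ultimately have "s n = (par v, snd (s n))"
          by (rule walk_inj) (simp add: sn)
        then have "fst (s n) = par v" by (metis fst_conv)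
        moreover have "n \<le> K" using n by linarith
        ultimately have False using Suc.prems(4)[of n] not_below[OF vm] by simp
        then show ?thesis ..
      qed
      then show ?thesis unfolding res using \<open>m < M\<close> by simp
    next
      case xs: False
      show ?thesis
      proof (cases "(v, x) \<in> A")
        case True
        then have res: "run M m e {x. (v, x) \<in> A} seen (Suc k) x = Some x" using xs by simp
        have "s (Suc K) = (par v, x) \<and> (\<forall>i<Suc K. below v (fst (s i)))"
          using sS swp_par[OF A True] Suc.prems(4) by auto
        then show ?thesis unfolding res using x by auto
      next
        case vx: False
        have card: "card (insert x seen) + k = Suc M"
          using Suc.prems(5,6) xs finite_subset[of seen "{..<M}"] by simp
        have seen: "\<exists>i<K'. \<exists>y'. s i = (v, y') \<and> y' < M \<and> z = Suc y' mod M"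
          if "z \<in> insert x seen - {m}" "K < K'" for z K'
        proof (cases "z = x")
          case True
          then show ?thesis using Suc.prems(1,2,3) that by blast
        next
          case False
          then show ?thesis using Suc.prems(7)[of z] that by (meson DiffD1 DiffD2 DiffI insertE less_trans)
        qed
        show ?thesis
        proof (cases "find (\<lambda>w. (w, x) \<in> A) (ch v)")
          case None
          then have "swp A x v = v" using vx by (intro swp_stay[OF A]) (auto simp: find_None_iff)
          then have sK: "s (Suc K) = (v, x)" using sS by simp
          have "?goal (run M m e {x. (v, x) \<in> A} (insert x seen) k (Suc x mod M))"
          proof (rule Suc.IH[OF sK x refl])
            show "below v (fst (s i))" if "i \<le> Suc K" for i
              using that sK below_refl Suc.prems(4) by (cases "i = Suc K") auto
          qed (use x Suc.prems(5) card in \<open>auto intro!: seen\<close>)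
          moreover have "run M m e {x. (v, x) \<in> A} seen (Suc k) x = run M m e {x. (v, x) \<in> A} (insert x seen) k (Suc x mod M)"
            using xs vx None by (simp add: e_def probe_def)
          ultimately show ?thesis by simp
        next
          case (Some w)
          then have w: "w \<in> set (ch v)" "(w, x) \<in> A" by (auto simp: find_Some_iff)
          have sK: "s (Suc K) = (w, x)" using sS swp_ch[OF A w(2,1)] by simp
          have e: "e x = exit_slot M ch h w A x" using Some by (simp add: e_def probe_def)
          show ?thesis
          proof (cases "e x")
            case None
            then obtain k' where "lev (fst ((walk M A ^^ k') (w, x))) = lev w + h"
              using IHh[OF x, of w] e by auto
            then have "lev (fst (s (k' + Suc K))) = lev v + Suc h"
              using sadd[of k' "Suc K"] sK lev_ch[OF w(1)] by simp
            moreover have "run M m e {x. (v, x) \<in> A} seen (Suc k) x = None" using xs vx None by simp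
            ultimately show ?thesis by auto
          next
            case (Some y')
            then obtain k' where k': "y' < M" "(walk M A ^^ k') (w, x) = (par w, y')"
              "\<And>i. i < k' \<Longrightarrow> below w (fst ((walk M A ^^ i) (w, x)))"
              using IHh[OF x, of w] e w by auto
            have sk': "s (k' + Suc K) = (v, y')"
              using sadd[of k' "Suc K"] sK k'(2) par_ch[OF w(1)] by simp
            have "?goal (run M m e {x. (v, x) \<in> A} (insert x seen) k (Suc y' mod M))"
            proof (rule Suc.IH[OF sk' k'(1) refl])
              show "below v (fst (s i))" if iK: "i \<le> k' + Suc K" for i
              proof -
                consider "i \<le> K" | "i = k' + Suc K" | "i = (i - Suc K) + Suc K" "i - Suc K < k'"
                  using iK by atomize_elim arith
                then show ?thesis
                proof cases
                  case 1
                  then show ?thesis by (rule Suc.prems(4))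
                next
                  case 2
                  then show ?thesis using sk' below_refl by simp
                next
                  case 3
                  have "below w (fst (s (i - Suc K + Suc K)))"
                    using k'(3)[OF 3(2)] unfolding sadd[symmetric] sK .
                  then show ?thesis using below_ch[OF w(1)] 3(1) by simp
                qed
              qed
            qed (use x Suc.prems(5) card in \<open>auto intro!: seen\<close>)
            moreover have "run M m e {x. (v, x) \<in> A} seen (Suc k) x = run M m e {x. (v, x) \<in> A} (insert x seen) k (Suc y' mod M)"
              using xs vx Some by simp
            ultimately show ?thesis by simp
          qed
        qed
      qed
    qed
  qed
  from this[of 0 m "Suc m mod M" "{m}" M] show ?case
    using Suc.prems below_refl by (simp add: s_def e_def)
qed

end

section \<open>Rooted trees\<close>

lemma gwalk_iff: "gwalk V adj xs \<longleftrightarrow> xs \<noteq> [] \<and> set xs \<subseteq> V \<and> successively adj xs"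
  by (auto simp: gwalk_def successively_conv_nth)

locale tree =
  fixes V :: "'a set" and adj :: "'a \<Rightarrow> 'a \<Rightarrow> bool" and r :: 'a
  assumes tree: "rooted_tree V adj r"
    and finite_neighbours: "v \<in> V \<Longrightarrow> finite (neighbours V adj v)"
begin

definition lev :: "'a \<Rightarrow> nat" where "lev = gdist V adj r"

definition par :: "'a \<Rightarrow> 'a" where "par w = (SOME u. adj u w \<and> Suc (lev u) = lev w)"

definition ch :: "'a \<Rightarrow> 'a list" where
  "ch v = (SOME xs. set xs = offspring V adj r v \<and> distinct xs)"

lemma adjD: "adj u w \<Longrightarrow> u \<in> V" "adj u w \<Longrightarrow> w \<in> V" "adj u w \<Longrightarrow> u \<noteq> w" "adj u w \<Longrightarrow> adj w u"
  using tree by (auto simp: rooted_tree_def simple_graph_def)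

lemma root: "r \<in> V" using tree by (simp add: rooted_tree_def)

lemma lev_walk:
  assumes "v \<in> V"
  obtains xs where "gwalk V adj xs" "hd xs = r" "last xs = v" "length xs = Suc (lev v)"
proof -
  obtain xs where xs: "gwalk V adj xs" "hd xs = r" "last xs = v"
    using tree assms root by (auto simp: rooted_tree_def gconnected_def)
  moreover have "length xs = Suc (length xs - 1)" using xs(1) by (cases xs) (auto simp: gwalk_def)
  ultimately have "\<exists>n xs. gwalk V adj xs \<and> hd xs = r \<and> last xs = v \<and> length xs = Suc n" by blast
  from LeastI_ex[OF this] show ?thesis using that by (auto simp: lev_def gdist_def)
qed

lemma lev_le: "\<lbrakk>gwalk V adj xs; hd xs = r; last xs = v; length xs = Suc n\<rbrakk> \<Longrightarrow> lev v \<le> n"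
  unfolding lev_def gdist_def by (rule Least_le) blast

lemma lev_root: "lev r = 0"
  using lev_le[of "[r]" r 0] root by (simp add: gwalk_def)

lemma lev_0: "\<lbrakk>v \<in> V; lev v = 0\<rbrakk> \<Longrightarrow> v = r"
  by (erule lev_walk) (auto simp: length_Suc_conv)

lemma adj_lev_le:
  assumes "adj u w"
  shows "lev w \<le> Suc (lev u)"
proof -
  obtain xs where xs: "gwalk V adj xs" "hd xs = r" "last xs = u" "length xs = Suc (lev u)"
    using lev_walk adjD(1)[OF assms] by blast
  show ?thesis
    by (rule lev_le[of "xs @ [w]"])
      (use xs assms adjD in \<open>auto simp: gwalk_iff successively_append_iff\<close>)
qed

lemma ex_par:
  assumes "w \<in> V" "w \<noteq> r"
  shows "\<exists>u. adj u w \<and> Suc (lev u) = lev w"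
proof -
  obtain xs where xs: "gwalk V adj xs" "hd xs = r" "last xs = w" "length xs = Suc (lev w)"
    using lev_walk assms(1) by blast
  have "lev w \<noteq> 0" using lev_0 assms by auto
  then obtain ys y where y: "xs = ys @ [y]" "ys \<noteq> []"
    using xs(4) by (cases xs rule: rev_cases) (auto, fastforce)
  have "y = w" using xs(3) y by simp
  then have "adj (last ys) w" using xs(1) y by (auto simp: gwalk_iff successively_append_iff)
  moreover have "lev (last ys) \<le> lev w - 1"
    by (rule lev_le[of ys]) (use xs y \<open>lev w \<noteq> 0\<close> in \<open>auto simp: gwalk_iff successively_append_iff\<close>)
  moreover have "lev w \<le> Suc (lev (last ys))" using calculation(1) by (rule adj_lev_le)
  ultimately show ?thesis using \<open>lev w \<noteq> 0\<close> by (intro exI[of _ "last ys"]) auto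
qed

lemma par:
  assumes "w \<in> V" "w \<noteq> r"
  shows "adj (par w) w" "lev w = Suc (lev (par w))" "par w \<in> V"
  using someI_ex[OF ex_par[OF assms], folded par_def] adjD by auto

lemma pars:
  assumes "v \<in> V" "i \<le> lev v"
  shows "(par ^^ i) v \<in> V \<and> lev ((par ^^ i) v) = lev v - i"
  using assms(2)
proof (induction i)
  case (Suc i)
  then have "(par ^^ i) v \<noteq> r" using lev_root by auto
  then show ?case using Suc par[of "(par ^^ i) v"] by auto
qed (use assms in auto)

lemma par_root: "v \<in> V \<Longrightarrow> (par ^^ lev v) v = r"
  using pars[of v "lev v"] lev_0 by auto

text \<open>Climb from \<open>u\<close> to the first vertex that is also an ancestor of
  \<open>w\<close>, then descend to \<open>w\<close>; minimality of the meeting index keeps the two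
  branches disjoint. If neither endpoint is the parent of the other, this path has at least three
  vertices and the edge between \<open>u\<close> and \<open>w\<close> closes it to a cycle.\<close>

lemma adj_cases:
  assumes uw: "adj u w"
  shows "(w \<noteq> r \<and> u = par w) \<or> (u \<noteq> r \<and> w = par u)"
proof (rule ccontr)
  assume no: "\<not> ?thesis"
  have V: "u \<in> V" "w \<in> V" "u \<noteq> w" using adjD uw by auto
  define P where "P i \<longleftrightarrow> (\<exists>j\<le>lev w. (par ^^ i) u = (par ^^ j) w)" for i
  have Pu: "P (lev u)" unfolding P_def using par_root V by auto
  define i where "i = (LEAST i. P i)"
  have i: "P i" "i \<le> lev u" "\<And>a. P a \<Longrightarrow> i \<le> a"
    unfolding i_def using Pu by (auto intro: LeastI Least_le)
  obtain j where j: "j \<le> lev w" "(par ^^ i) u = (par ^^ j) w" using i(1) by (auto simp: P_def)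
  define as where "as = map (\<lambda>a. (par ^^ a) u) [0..<Suc i]"
  define bs where "bs = map (\<lambda>b. (par ^^ b) w) [0..<j]"
  have adj_up: "adj ((par ^^ a) x) ((par ^^ Suc a) x)" if "x \<in> V" "Suc a \<le> lev x" for a x
  proof -
    have "(par ^^ a) x \<in> V" "(par ^^ a) x \<noteq> r" using pars[of x a] that lev_root by auto
    then show ?thesis using par adjD by auto
  qed
  have inj: "a = b" if "x \<in> V" "a \<le> lev x" "b \<le> lev x" "(par ^^ a) x = (par ^^ b) x" for a b x
    using pars[of x a] pars[of x b] that by auto
  have as: "successively adj as" "set as \<subseteq> V" "distinct as" "as \<noteq> []" "hd as = u" "last as = (par ^^ i) u"
  proof -
    show "successively adj as"
      unfolding as_def successively_conv_nth using adj_up[OF V(1)] i(2) by (auto simp del: upt_Suc funpow.simps)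
    show "set as \<subseteq> V" using pars V(1) i(2) by (auto simp: as_def)
    show "distinct as" unfolding as_def using inj[OF V(1)] i(2) by (auto simp: distinct_map inj_on_def simp del: upt_Suc)
    show "hd as = u" by (simp add: as_def hd_map del: upt_Suc) 
  qed (auto simp: as_def)
  have bs: "successively adj bs" "set bs \<subseteq> V" "distinct bs"
  proof -
    show "successively adj bs"
      unfolding bs_def successively_conv_nth using adj_up[OF V(2)] j(1) by (auto simp del: funpow.simps)
    show "set bs \<subseteq> V" using pars V(2) j(1) by (auto simp: bs_def)
    show "distinct bs" unfolding bs_def using inj[OF V(2)] j(1) by (auto simp: distinct_map inj_on_def)
  qed
  have flip: "successively (\<lambda>x y. adj y x) bs"
    by (rule successively_mono[OF bs(1)]) (rule adjD(4))
  have hd_bs: "j > 0 \<Longrightarrow> hd bs = w" by (auto simp: bs_def hd_map)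
  have last_bs: "j > 0 \<Longrightarrow> last bs = (par ^^ (j - 1)) w" by (cases j) (auto simp: bs_def)
  have bs_Nil: "bs = [] \<longleftrightarrow> j = 0" by (simp add: bs_def)
  have succ: "successively adj (as @ rev bs)"
  proof (cases "j = 0")
    case False
    have "adj ((par ^^ (j - 1)) w) ((par ^^ Suc (j - 1)) w)" by (rule adj_up) (use False j V in auto)
    then have "adj (last as) (hd (rev bs))"
      using as(6) j(2) False last_bs adjD(4) by (simp add: hd_rev del: funpow.simps)
    then show ?thesis using as(1) flip by (simp add: successively_append_iff)
  qed (use as bs_Nil in auto)
  have "set as \<inter> set bs = {}"
  proof (rule ccontr)
    assume "set as \<inter> set bs \<noteq> {}"
    then obtain a b where ab: "a \<le> i" "b < j" "(par ^^ a) u = (par ^^ b) w"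
      by (auto simp: as_def bs_def less_Suc_eq_le simp del: upt_Suc)
    then have "P a" using j(1) by (auto simp: P_def intro!: exI[of _ b])
    then have "a = i" using i(3) ab(1) by (simp add: le_antisym)
    then have "b = j" using inj[OF V(2), of b j] ab j by auto
    then show False using ab by simp
  qed
  then have dist: "distinct (as @ rev bs)" using as bs by auto
  have "last (as @ rev bs) = w"
  proof (cases "j = 0")
    case True
    then show ?thesis using as(6) j(2) bs_Nil by simp
  next
    case False
    then show ?thesis using hd_bs bs_Nil by (simp add: last_rev)
  qed
  then have closing: "adj (last (as @ rev bs)) (hd (as @ rev bs))" using as uw adjD(4) by simp
  have "3 \<le> length (as @ rev bs)"
  proof -
    have "\<not> (i = 0 \<and> j = 0)" using j(2) V(3) by (metis funpow_0)
    moreover have "\<not> (i = 1 \<and> j = 0)"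
    proof
      assume "i = 1 \<and> j = 0"
      then have "par u = w" "u \<noteq> r" using j(2) i(2) lev_root by (auto simp del: funpow.simps(1))
      then show False using no by blast
    qed
    moreover have "\<not> (i = 0 \<and> j = 1)"
    proof
      assume "i = 0 \<and> j = 1"
      then have "u = par w" "w \<noteq> r" using j lev_root by auto
      then show False using no by blast
    qed
    ultimately have "2 \<le> i + j" by linarith
    then show ?thesis by (simp add: as_def bs_def)
  qed
  then have "has_gcycle V adj"
    unfolding has_gcycle_def gwalk_iff using succ dist closing as bs
    by (intro exI[of _ "as @ rev bs"]) auto
  then show False using tree by (simp add: rooted_tree_def)
qed

lemma offspring_eq: "offspring V adj r v = {w \<in> V. w \<noteq> r \<and> par w = v}"
proof (intro equalityI subsetI)
  fix w assume "w \<in> offspring V adj r v"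
  then have w: "adj v w" "lev v < lev w" "w \<in> V" by (auto simp: offspring_def lev_def)
  then show "w \<in> {w \<in> V. w \<noteq> r \<and> par w = v}" using adj_cases[OF w(1)] par[of v] adjD[OF w(1)] by auto
next
  fix w assume "w \<in> {w \<in> V. w \<noteq> r \<and> par w = v}"
  then show "w \<in> offspring V adj r v" using par[of w] by (auto simp: offspring_def lev_def)
qed

lemma finite_offspring: "finite (offspring V adj r v)"
proof (cases "v \<in> V")
  case True
  have "offspring V adj r v \<subseteq> neighbours V adj v" by (auto simp: offspring_def neighbours_def)
  then show ?thesis using finite_neighbours[OF True] finite_subset by blast
next
  case False
  then have "offspring V adj r v = {}" using adjD by (auto simp: offspring_def)
  then show ?thesis by simp
qed

lemma ch: "set (ch v) = offspring V adj r v" "distinct (ch v)"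
  using someI_ex[OF finite_distinct_list[OF finite_offspring], folded ch_def] by auto

lemma in_ch: "w \<in> set (ch v) \<longleftrightarrow> w \<in> V \<and> w \<noteq> r \<and> par w = v"
  by (auto simp: ch offspring_eq)

sublocale forest par lev ch
  by standard (use in_ch par ch in auto)

lemma length_ch: "length (ch v) = card (offspring V adj r v)"
  using distinct_card[OF ch(2)[of v]] by (simp add: ch)

text \<open>Edges are named by their endpoint farther from the root. Since this naming is injective,
  the vertices other than \<open>r\<close> index the edges and hence the bits.\<close>

definition pedge :: "'a \<Rightarrow> 'a set" where "pedge w = {par w, w}"

lemma edges_eq: "edges V adj = pedge ` (V - {r})"
proof (intro equalityI subsetI)
  fix e assume "e \<in> edges V adj"
  then obtain u w where e: "e = {u, w}" "adj u w" by (auto simp: edges_def)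
  then show "e \<in> pedge ` (V - {r})" using adj_cases[OF e(2)] adjD[OF e(2)] by (auto simp: pedge_def)
next
  fix e assume "e \<in> pedge ` (V - {r})"
  then obtain w where "e = {par w, w}" "w \<in> V" "w \<noteq> r" by (auto simp: pedge_def)
  then show "e \<in> edges V adj" using par[of w] unfolding edges_def by blast
qed

lemma inj_pedge: "inj_on pedge (V - {r})"
proof (rule inj_onI)
  fix w w' assume w: "w \<in> V - {r}" "w' \<in> V - {r}" "pedge w = pedge w'"
  then have "w = w' \<or> (par w = w' \<and> par w' = w)" by (auto simp: pedge_def doubleton_eq_iff)
  then show "w = w'" using par(2)[of w] par(2)[of w'] w by auto
qed

section \<open>Layers and finite truncations of the tree\<close>

definition layer :: "nat \<Rightarrow> 'a set" where "layer l = {v \<in> V. lev v = l}"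

lemma layer_0: "layer 0 = {r}"
  using lev_0 lev_root root by (auto simp: layer_def)

lemma layer_Suc: "layer (Suc l) = (\<Union>v\<in>layer l. set (ch v))"
proof (intro equalityI subsetI)
  fix w assume "w \<in> layer (Suc l)"
  then have "w \<in> V" "w \<noteq> r" "lev w = Suc l" using lev_root by (auto simp: layer_def)
  then show "w \<in> (\<Union>v\<in>layer l. set (ch v))" using par[of w] by (auto simp: layer_def in_ch)
qed (use par in \<open>auto simp: layer_def in_ch\<close>)

lemma finite_layer: "finite (layer l)"
  by (induction l) (auto simp: layer_0 layer_Suc)

lemma card_layer:
  assumes "\<And>v. v \<in> V \<Longrightarrow> 2 \<le> length (ch v)"
  shows "2 ^ l \<le> card (layer l)"
proof (induction l)
  case (Suc l)
  have "card (layer (Suc l)) = (\<Sum>v\<in>layer l. card (set (ch v)))"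
    unfolding layer_Suc by (intro card_UN_disjoint finite_layer) (auto simp: in_ch)
  also have "\<dots> \<ge> (\<Sum>v\<in>layer l. 2)"
    using assms by (intro sum_mono) (auto simp: layer_def distinct_card[OF ch(2)])
  finally show ?case using Suc by simp
qed (simp add: layer_0)

definition nonroot :: "nat \<Rightarrow> 'a set" where "nonroot n = {v \<in> V. 1 \<le> lev v \<and> lev v \<le> n}"

lemma nonroot_eq: "nonroot n = (\<Union>l\<in>{1..n}. layer l)"
  by (auto simp: nonroot_def layer_def)

lemma finite_nonroot: "finite (nonroot n)"
  by (simp add: nonroot_eq finite_layer)

lemma nonroot_subset: "nonroot n \<subseteq> V - {r}"
  by (auto simp: nonroot_def lev_root)

lemma dsc_nonroot: "u \<in> dsc ch h v \<Longrightarrow> u \<in> nonroot (lev v + h)"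
proof (induction h arbitrary: v)
  case (Suc h)
  then obtain w where w: "w \<in> set (ch v)" "u = w \<or> u \<in> dsc ch h w" by auto
  have "lev w = Suc (lev v)" "w \<in> V" using lev_ch[OF w(1)] w(1) in_ch by auto
  then show ?case using w(2) Suc.IH[of w] by (auto simp: nonroot_def)
qed simp

lemma countable_V: "countable V"
proof -
  have "V = (\<Union>l. layer l)" by (auto simp: layer_def)
  then show ?thesis using finite_layer by (metis countable_UN countable_finite countableI_type)
qed

end

section \<open>The Poisson process of one edge\<close>

definition expd :: "real measure" where "expd = density lborel (exponential_density 1)"

definition part :: "(nat \<Rightarrow> real) \<Rightarrow> nat \<Rightarrow> real" where "part x k = (\<Sum>i\<le>k. x i)"

lemma sets_expd [measurable_cong, simp]: "sets expd = sets borel"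
  by (simp add: expd_def)

lemma space_expd [simp]: "space expd = UNIV"
  by (simp add: expd_def)

interpretation expd: prob_space expd
  unfolding expd_def by (rule prob_space_exponential_density) simp

interpretation expseq: sequence_space expd ..

abbreviation expS :: "(nat \<Rightarrow> real) measure" where "expS \<equiv> \<Pi>\<^sub>M i\<in>UNIV. expd"

lemma space_expS [simp]: "space expS = UNIV"
  by (simp add: space_PiM)

text \<open>Memorylessness of the exponential law in integral form: given that a gap exceeds
  \<open>a\<close>, the excess is exponential again.\<close>

lemma nn_integral_expd_shift:
  assumes [measurable]: "g \<in> borel_measurable borel" and a: "0 \<le> a"
  shows "(\<integral>\<^sup>+ y. indicator {a<..} y * g (y - a) \<partial>expd) = ennreal (exp (- a)) * (\<integral>\<^sup>+ y. g y \<partial>expd)"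
proof -
  have "(\<integral>\<^sup>+ y. indicator {a<..} y * g (y - a) \<partial>expd)
      = (\<integral>\<^sup>+ y. ennreal (exponential_density 1 y) * (indicator {a<..} y * g (y - a)) \<partial>lborel)"
    unfolding expd_def by (subst nn_integral_density) auto
  also have "\<dots> = (\<integral>\<^sup>+ z. ennreal (exponential_density 1 (a + z)) * (indicator {a<..} (a + z) * g (a + z - a)) \<partial>lborel)"
    by (subst lborel_distr_plus[symmetric, of a], subst nn_integral_distr) auto
  also have "\<dots> = (\<integral>\<^sup>+ z. ennreal (exp (- a)) * (ennreal (exponential_density 1 z) * g z) \<partial>lborel)"
  proof (rule nn_integral_cong_AE)
    \<comment> \<open>At \<open>z = 0\<close> the strict indicator vanishes while the exponential
      density on the right does not, so the integrands are compared off this null set.\<close>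
    have "AE z in lborel. z \<noteq> (0::real)" by (rule AE_lborel_singleton)
    then show "AE z in lborel. ennreal (exponential_density 1 (a + z)) * (indicator {a<..} (a + z) * g (a + z - a))
       = ennreal (exp (- a)) * (ennreal (exponential_density 1 z) * g z)"
    proof eventually_elim
      case (elim z)
      show ?case
      proof (cases "z < 0")
        case False
        then have "ennreal (exp (- a - z)) = ennreal (exp (- a)) * ennreal (exp (- z))"
          by (simp add: ennreal_mult'[symmetric] exp_add[symmetric])
        then show ?thesis using False elim a by (simp add: exponential_density_def mult.assoc)
      qed (simp add: exponential_density_def)
    qed
  qed
  also have "\<dots> = ennreal (exp (- a)) * (\<integral>\<^sup>+ z. ennreal (exponential_density 1 z) * g z \<partial>lborel)"
    by (rule nn_integral_cmult) auto
  also have "(\<integral>\<^sup>+ z. ennreal (exponential_density 1 z) * g z \<partial>lborel) = (\<integral>\<^sup>+ y. g y \<partial>expd)"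
    unfolding expd_def by (subst nn_integral_density) auto
  finally show ?thesis .
qed

lemma measurable_part [measurable]: "(\<lambda>x. part x k) \<in> borel_measurable expS"
  unfolding part_def by measurable

lemma emeasure_expd_gt: "0 \<le> a \<Longrightarrow> emeasure expd {a<..} = ennreal (exp (- a))"
  using nn_integral_expd_shift[of "\<lambda>_. 1" a] by (simp add: expd.emeasure_space_1[simplified])

lemma measure_expd_le: "0 \<le> a \<Longrightarrow> measure expd {..a} = 1 - exp (- a)"
proof -
  assume a: "0 \<le> a"
  have "{..a} = space expd - {a<..}" by auto
  then have "measure expd {..a} = 1 - measure expd {a<..}"
    using expd.prob_compl[of "{a<..}"] by simp
  then show ?thesis using emeasure_expd_gt[OF a] by (simp add: measure_def)
qed

lemma AE_expS_pos: "AE x in expS. \<forall>i. 0 < x i"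
proof -
  have "emeasure expd {..0} = 0"
    using measure_expd_le[of 0] by (simp add: expd.emeasure_eq_measure)
  then have "AE y in expd. 0 < y"
    by (intro AE_I[where N = "{..0}"]) auto
  then have "AE x in expS. 0 < x i" for i
    by (intro AE_PiM_component) (auto intro: expd.prob_space_axioms)
  then show ?thesis by (simp add: AE_all_countable)
qed

text \<open>A single gap longer than \<open>t\<close> suffices, and the probability that the first
  \<open>n\<close> gaps are all at most \<open>t\<close> tends to zero.\<close>

lemma AE_expS_part: "AE x in expS. \<exists>k. t < part x k"
proof (cases "t \<le> 0")
  case True
  from AE_expS_pos show ?thesis
    by eventually_elim (use True in \<open>auto simp: part_def intro!: exI[of _ 0] elim: order_le_less_trans\<close>)
next
  case False
  let ?N = "Pi UNIV (\<lambda>_::nat. {..t})"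
  have N: "?N \<in> sets expS" by (rule expseq.infprod_in_sets) simp
  have "(\<lambda>n. \<Prod>i\<le>n. measure expd {..t}) \<longlonglongrightarrow> measure expS ?N"
    by (rule expseq.measure_PiM_countable) simp
  moreover have "(\<lambda>n. \<Prod>i\<le>n. measure expd {..t}) \<longlonglongrightarrow> 0"
    using LIMSEQ_Suc[OF LIMSEQ_power_zero[of "1 - exp (- t)"]] False
    by (simp add: measure_expd_le)
  ultimately have "measure expS ?N = 0" by (rule LIMSEQ_unique)
  then have "AE x in expS. x \<notin> ?N"
    using N by (intro AE_not_in) (auto simp: null_sets_def expseq.P.emeasure_eq_measure)
  with AE_expS_pos show ?thesis
  proof eventually_elim
    case (elim x)
    then obtain i where "t < x i" by (auto simp: Pi_iff not_le)
    moreover have "x i \<le> part x i"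
      unfolding part_def by (rule member_le_sum) (use elim in \<open>auto intro: less_imp_le\<close>)
    ultimately show ?case by (intro exI[of _ i]) simp
  qed
qed

text \<open>
  \<open>restart t k x\<close> are the interarrival times after time \<open>t\<close> when ring \<open>k\<close> is the first one after \<open>t\<close>.
\<close>

definition restart :: "real \<Rightarrow> nat \<Rightarrow> (nat \<Rightarrow> real) \<Rightarrow> nat \<Rightarrow> real" where
  "restart t k x = case_nat (part x k - t) (\<lambda>i. x (k + Suc i))"

definition restart_set :: "real \<Rightarrow> nat \<Rightarrow> (nat \<Rightarrow> real) set \<Rightarrow> (nat \<Rightarrow> real) set" where
  "restart_set t k F = {x. (\<forall>i<k. part x i \<le> t) \<and> t < part x k \<and> restart t k x \<in> F}"

lemma measurable_restart [measurable]: "restart t k \<in> measurable expS expS"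
proof (rule measurable_PiM_single')
  fix i show "(\<lambda>x. restart t k x i) \<in> measurable expS expd"
    by (cases i) (simp_all add: restart_def)
qed (simp add: PiE_iff)

lemma restart_0: "restart t 0 x = case_nat (x 0 - t) (\<lambda>i. x (Suc i))"
  by (simp add: restart_def part_def)

lemma sets_restart_set [measurable]:
  assumes [measurable]: "F \<in> sets expS"
  shows "restart_set t k F \<in> sets expS"
proof -
  have "restart_set t k F = {x \<in> space expS. (\<forall>i<k. part x i \<le> t) \<and> t < part x k \<and> restart t k x \<in> F}"
    by (auto simp: restart_set_def)
  also have "\<dots> \<in> sets expS" by measurable
  finally show ?thesis .
qed

lemma part_comb: "part (comb_seq k \<omega> \<omega>') (k + i) = (\<Sum>j<k. \<omega> j) + part \<omega>' i"
proof (induction i)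
  case 0
  have "part (comb_seq k \<omega> \<omega>') k = (\<Sum>j<k. comb_seq k \<omega> \<omega>' j) + comb_seq k \<omega> \<omega>' k"
    by (simp add: part_def lessThan_Suc_atMost[symmetric])
  then show ?case by (simp add: part_def comb_seq_def)
next
  case (Suc i)
  have "comb_seq k \<omega> \<omega>' (Suc (k + i)) = \<omega>' (Suc i)"
    using comb_seq_add[of k \<omega> \<omega>' "Suc i"] by (simp add: add.commute)
  then show ?case using Suc by (simp add: part_def)
qed

lemma part_comb_less: "i < k \<Longrightarrow> part (comb_seq k \<omega> \<omega>') i = part \<omega> i"
  by (simp add: part_def comb_seq_def)

text \<open>Treats the gap that straddles \<open>t\<close>, with \<open>s\<close> in the role of the
  time of the last ring before it; the rest is memorylessness.\<close>

lemma emeasure_restart_tail: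
  assumes F [measurable]: "F \<in> sets expS" and s: "s \<le> t"
  shows "emeasure expS {x. t < s + x 0 \<and> case_nat (s + x 0 - t) (\<lambda>i. x (Suc i)) \<in> F}
    = ennreal (exp (- (t - s))) * emeasure expS F"
proof -
  let ?A = "{x. t < s + x 0 \<and> case_nat (s + x 0 - t) (\<lambda>i. x (Suc i)) \<in> F}"
  have A: "?A \<in> sets expS"
  proof -
    have "?A = {x \<in> space expS. t - s < x 0 \<and> restart (t - s) 0 x \<in> F}"
      by (auto simp: restart_0 algebra_simps)
    also have "\<dots> \<in> sets expS" by measurable
    finally show ?thesis .
  qed
  interpret pair_sigma_finite expd expS
    by (intro pair_sigma_finite.intro) unfold_locales
  have it: "emeasure expS B = (\<integral>\<^sup>+ \<omega>. \<integral>\<^sup>+ y. indicator B (case_nat y \<omega>) \<partial>expd \<partial>expS)"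
    if [measurable]: "B \<in> sets expS" for B
  proof -
    have "emeasure expS B = emeasure (distr (expd \<Otimes>\<^sub>M expS) expS (\<lambda>(s, \<omega>). case_nat s \<omega>)) B"
      by (simp add: expseq.PiM_iter)
    also have "\<dots> = (\<integral>\<^sup>+ z. indicator B (case_nat (fst z) (snd z)) \<partial>(expd \<Otimes>\<^sub>M expS))"
      by (subst nn_integral_indicator[symmetric], simp, subst nn_integral_distr) (auto simp: split_beta')
    also have "\<dots> = (\<integral>\<^sup>+ \<omega>. \<integral>\<^sup>+ y. indicator B (case_nat y \<omega>) \<partial>expd \<partial>expS)"
      by (subst nn_integral_snd[symmetric]) (auto simp: split_beta')
    finally show ?thesis .
  qed
  have "emeasure expS ?A = (\<integral>\<^sup>+ \<omega>. \<integral>\<^sup>+ y. indicator ?A (case_nat y \<omega>) \<partial>expd \<partial>expS)"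
    by (rule it[OF A])
  also have "\<dots> = (\<integral>\<^sup>+ \<omega>. \<integral>\<^sup>+ y. indicator {t - s<..} y * indicator F (case_nat (y - (t - s)) \<omega>) \<partial>expd \<partial>expS)"
    by (intro nn_integral_cong) (auto simp: indicator_def algebra_simps)
  also have "\<dots> = (\<integral>\<^sup>+ \<omega>. ennreal (exp (- (t - s))) * (\<integral>\<^sup>+ y. indicator F (case_nat y \<omega>) \<partial>expd) \<partial>expS)"
  proof (intro nn_integral_cong)
    fix \<omega> assume "\<omega> \<in> space expS"
    have [measurable]: "(\<lambda>y. case_nat y \<omega>) \<in> measurable borel expS"
      by (rule measurable_PiM_single') (auto split: nat.split)
    show "(\<integral>\<^sup>+ y. indicator {t - s<..} y * indicator F (case_nat (y - (t - s)) \<omega>) \<partial>expd)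
        = ennreal (exp (- (t - s))) * (\<integral>\<^sup>+ y. indicator F (case_nat y \<omega>) \<partial>expd)"
      using s by (intro nn_integral_expd_shift) auto
  qed
  also have "\<dots> = ennreal (exp (- (t - s))) * (\<integral>\<^sup>+ \<omega>. \<integral>\<^sup>+ y. indicator F (case_nat y \<omega>) \<partial>expd \<partial>expS)"
    by (rule nn_integral_cmult) measurable
  also have "\<dots> = ennreal (exp (- (t - s))) * emeasure expS F" by (simp add: it)
  finally show ?thesis .
qed

text \<open>Independence of the number \<open>k\<close> of rings up to \<open>t\<close> and of the
  process after \<open>t\<close>: split off the first \<open>k\<close> gaps and apply
  \<open>emeasure_restart_tail\<close> to the others. Only the product form is recorded; inserting
  \<open>UNIV\<close> identifies \<open>c\<close> afterwards.\<close>

lemma emeasure_restart_set: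
  assumes t: "0 \<le> t"
  obtains c where "\<And>F. F \<in> sets expS \<Longrightarrow> emeasure expS (restart_set t k F) = c * emeasure expS F"
proof
  fix F assume F [measurable]: "F \<in> sets expS"
  have "emeasure expS (restart_set t k F) = emeasure (distr (expS \<Otimes>\<^sub>M expS) expS (\<lambda>(\<omega>, \<omega>'). comb_seq k \<omega> \<omega>')) (restart_set t k F)"
    by (simp add: expseq.PiM_comb_seq)
  also have "\<dots> = (\<integral>\<^sup>+ z. indicator (restart_set t k F) (comb_seq k (fst z) (snd z)) \<partial>(expS \<Otimes>\<^sub>M expS))"
    by (subst nn_integral_indicator[symmetric], simp, subst nn_integral_distr) (auto simp: split_beta')
  also have "\<dots> = (\<integral>\<^sup>+ \<omega>. \<integral>\<^sup>+ \<omega>'. indicator (restart_set t k F) (comb_seq k \<omega> \<omega>') \<partial>expS \<partial>expS)"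
    by (subst expseq.P.nn_integral_fst[symmetric]) (auto simp: split_beta')
  also have "\<dots> = (\<integral>\<^sup>+ \<omega>. indicator {\<omega>. \<forall>i<k. part \<omega> i \<le> t} \<omega> * ennreal (exp (- (t - (\<Sum>j<k. \<omega> j)))) * emeasure expS F \<partial>expS)"
  proof (intro nn_integral_cong)
    fix \<omega> :: "nat \<Rightarrow> real"
    let ?s = "\<Sum>j<k. \<omega> j"
    let ?A = "{x. t < ?s + x 0 \<and> case_nat (?s + x 0 - t) (\<lambda>i. x (Suc i)) \<in> F}"
    have A: "?A \<in> sets expS"
    proof -
      have "?A = {x \<in> space expS. t - ?s < x 0 \<and> restart (t - ?s) 0 x \<in> F}"
        by (auto simp: restart_0 algebra_simps)
      also have "\<dots> \<in> sets expS" by measurable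
      finally show ?thesis .
    qed
    have "comb_seq k \<omega> \<omega>' \<in> restart_set t k F \<longleftrightarrow> (\<forall>i<k. part \<omega> i \<le> t) \<and> \<omega>' \<in> ?A" for \<omega>'
    proof -
      have "part (comb_seq k \<omega> \<omega>') k = ?s + \<omega>' 0"
        using part_comb[of k \<omega> \<omega>' 0] by (simp add: part_def)
      moreover have "comb_seq k \<omega> \<omega>' (k + Suc i) = \<omega>' (Suc i)" for i
        using comb_seq_add[of k \<omega> \<omega>' "Suc i"] by (simp add: add.commute)
      ultimately show ?thesis by (auto simp: restart_set_def restart_def part_comb_less)
    qed
    then have "(\<integral>\<^sup>+ \<omega>'. indicator (restart_set t k F) (comb_seq k \<omega> \<omega>') \<partial>expS) =
       (\<integral>\<^sup>+ \<omega>'. indicator {\<omega>. \<forall>i<k. part \<omega> i \<le> t} \<omega> * indicator ?A \<omega>' \<partial>expS)"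
      by (intro nn_integral_cong) (auto simp: indicator_def)
    also have "\<dots> = indicator {\<omega>. \<forall>i<k. part \<omega> i \<le> t} \<omega> * emeasure expS ?A"
      using A by (simp add: nn_integral_cmult)
    also have "\<dots> = indicator {\<omega>. \<forall>i<k. part \<omega> i \<le> t} \<omega> * (ennreal (exp (- (t - ?s))) * emeasure expS F)"
    proof (cases "\<forall>i<k. part \<omega> i \<le> t")
      case True
      have "?s \<le> t"
      proof (cases k)
        case (Suc k')
        then show ?thesis using True by (auto simp: part_def lessThan_Suc_atMost)
      qed (use t in simp)
      then show ?thesis by (simp add: emeasure_restart_tail[OF F])
    qed simp
    finally show "(\<integral>\<^sup>+ \<omega>'. indicator (restart_set t k F) (comb_seq k \<omega> \<omega>') \<partial>expS) =
      indicator {\<omega>. \<forall>i<k. part \<omega> i \<le> t} \<omega> * ennreal (exp (- (t - ?s))) * emeasure expS F"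
      by (simp add: mult.assoc)
  qed
  also have "\<dots> = (\<integral>\<^sup>+ \<omega>. indicator {\<omega>. \<forall>i<k. part \<omega> i \<le> t} \<omega> * ennreal (exp (- (t - (\<Sum>j<k. \<omega> j)))) \<partial>expS) * emeasure expS F"
  proof (rule nn_integral_multc)
    have [measurable]: "{\<omega>. \<forall>i<k. part \<omega> i \<le> t} \<in> sets expS"
    proof -
      have "{\<omega>. \<forall>i<k. part \<omega> i \<le> t} = {\<omega> \<in> space expS. \<forall>i<k. part \<omega> i \<le> t}" by auto
      also have "\<dots> \<in> sets expS" by measurable
      finally show ?thesis .
    qed
    show "(\<lambda>\<omega>. indicator {\<omega>. \<forall>i<k. part \<omega> i \<le> t} \<omega> * ennreal (exp (- (t - (\<Sum>j<k. \<omega> j))))) \<in> borel_measurable expS"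
      by measurable
  qed
  finally show "emeasure expS (restart_set t k F) =
    (\<integral>\<^sup>+ \<omega>. indicator {\<omega>. \<forall>i<k. part \<omega> i \<le> t} \<omega> * ennreal (exp (- (t - (\<Sum>j<k. \<omega> j)))) \<partial>expS) * emeasure expS F" .
qed

lemma restart_set_disjoint: "disjoint_family (\<lambda>k. restart_set t k F)"
  unfolding disjoint_family_on_def
proof (intro ballI impI)
  fix m n :: nat assume "m \<noteq> n"
  then show "restart_set t m F \<inter> restart_set t n F = {}"
    by (cases "m < n") (force simp: restart_set_def not_less le_less)+
qed

lemma emeasure_restart_UN:
  assumes F: "F \<in> sets expS" and t: "0 \<le> t"
  shows "emeasure expS (\<Union>k\<in>K. restart_set t k F) = emeasure expS (\<Union>k\<in>K. restart_set t k UNIV) * emeasure expS F"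
proof -
  have S: "UNIV \<in> sets expS" using sets.top[of expS] by simp
  have 1: "emeasure expS (restart_set t k F) = emeasure expS (restart_set t k UNIV) * emeasure expS F" for k
  proof -
    obtain c where c: "\<And>F. F \<in> sets expS \<Longrightarrow> emeasure expS (restart_set t k F) = c * emeasure expS F"
      using emeasure_restart_set[OF t, of k] by blast
    have "emeasure expS UNIV = 1" using expseq.P.emeasure_space_1 by simp
    then show ?thesis using c[OF F] c[OF S] by simp
  qed
  have dj: "disjoint_family_on (\<lambda>k. restart_set t k G) K" for G
    by (rule disjoint_family_on_mono[OF _ restart_set_disjoint]) simp
  have "emeasure expS (\<Union>k\<in>K. restart_set t k F) = (\<integral>\<^sup>+k. emeasure expS (restart_set t k UNIV) * emeasure expS F \<partial>count_space K)"
    using F by (subst emeasure_UN_countable) (auto simp: dj 1)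
  also have "\<dots> = (\<integral>\<^sup>+k. emeasure expS (restart_set t k UNIV) \<partial>count_space K) * emeasure expS F"
    by (rule nn_integral_multc) simp
  also have "(\<integral>\<^sup>+k. emeasure expS (restart_set t k UNIV) \<partial>count_space K) = emeasure expS (\<Union>k\<in>K. restart_set t k UNIV)"
    using S by (subst emeasure_UN_countable) (auto simp: dj)
  finally show ?thesis .
qed

lemma measure_restart_UN:
  assumes F: "F \<in> sets expS" and t: "0 \<le> t"
  shows "measure expS (\<Union>k\<in>K. restart_set t k F) = measure expS (\<Union>k\<in>K. restart_set t k UNIV) * measure expS F"
  using emeasure_restart_UN[OF F t, of K] by (simp add: measure_def enn2real_mult)

lemma sets_restart_UNIV [measurable]: "restart_set t k UNIV \<in> sets expS"
  using sets.top[of expS] by (intro sets_restart_set) simp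

lemma AE_restart_UNIV: "AE x in expS. x \<in> (\<Union>k. restart_set t k UNIV)"
  using AE_expS_part[of t]
proof eventually_elim
  case (elim x)
  define k where "k = (LEAST k. t < part x k)"
  have "t < part x k" using elim unfolding k_def by (rule LeastI_ex)
  moreover have "\<forall>i<k. part x i \<le> t" unfolding k_def using not_less_Least[of _ "\<lambda>k. t < part x k"] by (auto simp: not_less)
  ultimately show ?case by (auto simp: restart_set_def)
qed

lemma measure_restart_0:
  assumes t: "0 \<le> t" shows "measure expS (\<Union>k\<in>{0}. restart_set t k UNIV) = exp (- t)"
proof -
  have "UNIV \<in> sets expS" using sets.top[of expS] by simp
  from emeasure_restart_tail[OF this t] have "emeasure expS {x. t < x 0} = ennreal (exp (- t))"
    using expseq.P.emeasure_space_1 by simp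
  moreover have "(\<Union>k\<in>{0}. restart_set t k UNIV) = {x. t < x 0}"
    by (auto simp: restart_set_def part_def)
  ultimately show ?thesis by (simp add: measure_def)
qed

lemma measure_restart_pos:
  assumes t: "0 \<le> t" shows "measure expS (\<Union>k\<in>{1..}. restart_set t k UNIV) = 1 - exp (- t)"
proof -
  let ?A = "\<lambda>K. \<Union>k\<in>K. restart_set t k UNIV"
  have [measurable]: "?A K \<in> sets expS" for K by (intro sets.countable_UN'') auto
  have "measure expS (?A UNIV) = 1"
    using AE_restart_UNIV[of t] by (intro expseq.P.prob_eq_1[THEN iffD2]) auto
  moreover have "?A UNIV = ?A {0} \<union> ?A {1..}"
  proof -
    have "UNIV = {0} \<union> {1::nat..}" by auto
    then show ?thesis by (metis UN_Un)
  qed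
  moreover have "?A {0} \<inter> ?A {1..} = {}"
    using restart_set_disjoint[of t UNIV] by (auto simp: disjoint_family_on_def dest!: Suc_le_lessD)
  ultimately have "measure expS (?A {0}) + measure expS (?A {1..}) = 1"
    by (metis expseq.P.finite_measure_Union \<open>\<And>K. ?A K \<in> sets expS\<close>)
  then show ?thesis using measure_restart_0[OF t] by simp
qed

section \<open>Rings of one edge in the time slots\<close>

definition slot_hit :: "real \<Rightarrow> nat \<Rightarrow> (nat \<Rightarrow> real) \<Rightarrow> bool" where
  "slot_hit \<delta> m x \<longleftrightarrow> (\<exists>k. real m * \<delta> < part x k \<and> part x k \<le> real (Suc m) * \<delta>)"

text \<open>Consecutive rings are enough to detect any two rings in a slot, because almost surely
  the ring times increase.\<close>

definition slot_double :: "real \<Rightarrow> nat \<Rightarrow> (nat \<Rightarrow> real) \<Rightarrow> bool" where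
  "slot_double \<delta> m x \<longleftrightarrow> (\<exists>k. real m * \<delta> < part x k \<and> part x (Suc k) \<le> real (Suc m) * \<delta>)"

lemma sets_slot [measurable]:
  "{x. slot_hit \<delta> m x} \<in> sets expS" "{x. slot_double \<delta> m x} \<in> sets expS"
proof -
  have "{x \<in> space expS. slot_hit \<delta> m x} \<in> sets expS" "{x \<in> space expS. slot_double \<delta> m x} \<in> sets expS"
    unfolding slot_hit_def slot_double_def by measurable
  then show "{x. slot_hit \<delta> m x} \<in> sets expS" "{x. slot_double \<delta> m x} \<in> sets expS" by simp_all
qed

lemma part_restart: "part (restart t k x) i = part x (k + i) - t"
  by (induction i) (simp_all add: part_def restart_def)

lemma part_mono: "\<lbrakk>\<forall>i. 0 < x i; i \<le> j\<rbrakk> \<Longrightarrow> part x i \<le> part x j"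
  unfolding part_def by (intro sum_mono2) (auto intro: less_imp_le)

text \<open>Rings with index below \<open>k\<close> come at or before time \<open>\<delta>\<close>,
  hence in no slot after the first; the others are the rings of the restarted process delayed by
  \<open>\<delta>\<close>.\<close>

lemma slot_restart:
  assumes x: "x \<in> restart_set \<delta> k F" and \<delta>: "0 \<le> \<delta>"
  shows "slot_hit \<delta> (Suc m) x \<longleftrightarrow> slot_hit \<delta> m (restart \<delta> k x)"
    "slot_double \<delta> (Suc m) x \<longleftrightarrow> slot_double \<delta> m (restart \<delta> k x)"
proof -
  have k: "k \<le> i" if "real (Suc m) * \<delta> < part x i" for i
  proof (rule ccontr)
    assume "\<not> k \<le> i"
    then have "part x i \<le> \<delta>" using x by (auto simp: restart_set_def)
    moreover have "1 * \<delta> \<le> real (Suc m) * \<delta>" using \<delta> by (intro mult_right_mono) auto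
    ultimately show False using that by simp
  qed
  have shift: "(\<exists>i. real (Suc m) * \<delta> < part x i \<and> Q (part x i) (part x (Suc i))) \<longleftrightarrow>
      (\<exists>i. real (Suc m) * \<delta> < part x (k + i) \<and> Q (part x (k + i)) (part x (Suc (k + i))))" for Q
    by (metis k le_add_diff_inverse)
  have e: "real m * \<delta> < a - \<delta> \<longleftrightarrow> real (Suc m) * \<delta> < a"
    "a - \<delta> \<le> real (Suc m) * \<delta> \<longleftrightarrow> a \<le> real (Suc (Suc m)) * \<delta>" for a
    by (auto simp: algebra_simps)
  show "slot_hit \<delta> (Suc m) x \<longleftrightarrow> slot_hit \<delta> m (restart \<delta> k x)"
    unfolding slot_hit_def part_restart e by (rule shift)
  show "slot_double \<delta> (Suc m) x \<longleftrightarrow> slot_double \<delta> m (restart \<delta> k x)"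
    unfolding slot_double_def part_restart e add_Suc_right by (rule shift)
qed

lemma slot_hit_0:
  assumes x: "x \<in> restart_set \<delta> k F" and pos: "\<forall>i. 0 < x i"
  shows "slot_hit \<delta> 0 x \<longleftrightarrow> k \<noteq> 0"
proof
  assume "slot_hit \<delta> 0 x"
  then obtain i where "part x i \<le> \<delta>" by (auto simp: slot_hit_def)
  then have "part x 0 \<le> \<delta>" using part_mono[OF pos, of 0 i] by simp
  then show "k \<noteq> 0" using x by (cases "k = 0") (auto simp: restart_set_def)
next
  assume "k \<noteq> 0"
  then have "part x 0 \<le> \<delta>" using x by (auto simp: restart_set_def)
  moreover have "0 < part x 0" using pos by (simp add: part_def)
  ultimately show "slot_hit \<delta> 0 x" by (auto simp: slot_hit_def intro!: exI[of _ 0])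
qed

text \<open>Makes the slot bits of one edge independent with parameter
  \<open>1 - exp (- \<delta>)\<close>. The process is restarted at time \<open>\<delta>\<close>:
  slot 0 is hit exactly if some ring precedes the restart, and the remaining bits are those of an
  independent process with one slot fewer.\<close>

lemma measure_pattern:
  assumes \<delta>: "0 \<le> \<delta>"
  shows "measure expS {x. \<forall>m<M. slot_hit \<delta> m x \<longleftrightarrow> m \<in> B}
    = (\<Prod>m<M. if m \<in> B then 1 - exp (- \<delta>) else exp (- \<delta>))"
proof (induction M arbitrary: B)
  case 0
  then show ?case using expseq.P.prob_space by simp
next
  case (Suc M)
  define B' where "B' = {m. Suc m \<in> B}"
  define K where "K = (if 0 \<in> B then {1..} else {0::nat})"
  define pat where "pat M B = {x. \<forall>m<M. slot_hit \<delta> m x \<longleftrightarrow> m \<in> B}" for M :: nat and B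
  have pat [measurable]: "pat M B \<in> sets expS" for M B
  proof -
    have "{x \<in> space expS. \<forall>m<M. slot_hit \<delta> m x \<longleftrightarrow> m \<in> B} \<in> sets expS"
      unfolding slot_hit_def by measurable
    then show ?thesis by (simp add: pat_def)
  qed
  have "measure expS (pat (Suc M) B) = measure expS (\<Union>k\<in>K. restart_set \<delta> k (pat M B'))"
  proof (rule measure_eq_AE)
    show "AE x in expS. x \<in> pat (Suc M) B \<longleftrightarrow> x \<in> (\<Union>k\<in>K. restart_set \<delta> k (pat M B'))"
      using AE_restart_UNIV[of \<delta>] AE_expS_pos
    proof eventually_elim
      case (elim x)
      then obtain k where k: "x \<in> restart_set \<delta> k UNIV" by auto
      have K: "k \<in> K \<longleftrightarrow> (k \<noteq> 0 \<longleftrightarrow> 0 \<in> B)" by (auto simp: K_def)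
      have uniq: "k' = k" if "x \<in> restart_set \<delta> k' F" for k' F
      proof (rule ccontr)
        assume "k' \<noteq> k"
        moreover have "x \<in> restart_set \<delta> k' UNIV" using that by (auto simp: restart_set_def)
        ultimately show False using k restart_set_disjoint[of \<delta> UNIV] by (auto simp: disjoint_family_on_def)
      qed
      have "x \<in> pat (Suc M) B \<longleftrightarrow> (slot_hit \<delta> 0 x \<longleftrightarrow> 0 \<in> B) \<and> (\<forall>m<M. slot_hit \<delta> (Suc m) x \<longleftrightarrow> Suc m \<in> B)"
        by (auto simp: pat_def All_less_Suc2)
      also have "\<dots> \<longleftrightarrow> k \<in> K \<and> restart \<delta> k x \<in> pat M B'"
        unfolding slot_hit_0[OF k elim(2)] slot_restart[OF k \<delta>] K by (simp add: pat_def B'_def)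
      also have "\<dots> \<longleftrightarrow> x \<in> (\<Union>k\<in>K. restart_set \<delta> k (pat M B'))"
        using k uniq by (auto simp: restart_set_def)
      finally show ?case .
    qed
  qed (auto intro!: sets.countable_UN'')
  also have "\<dots> = measure expS (\<Union>k\<in>K. restart_set \<delta> k UNIV) * measure expS (pat M B')"
    by (rule measure_restart_UN[OF pat \<delta>])
  also have "measure expS (\<Union>k\<in>K. restart_set \<delta> k UNIV) = (if 0 \<in> B then 1 - exp (- \<delta>) else exp (- \<delta>))"
    using measure_restart_0[OF \<delta>] measure_restart_pos[OF \<delta>] by (simp add: K_def)
  also have "measure expS (pat M B') = (\<Prod>m<M. if Suc m \<in> B then 1 - exp (- \<delta>) else exp (- \<delta>))"
    unfolding pat_def Suc.IH by (simp add: B'_def)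
  finally show ?case unfolding pat_def prod.lessThan_Suc_shift by (simp add: o_def)
qed

text \<open>In slot 0 two rings force the first two gaps to be at most \<open>\<delta>\<close>, each
  with probability \<open>1 - exp (- \<delta>)\<close>, which is at most \<open>\<delta>\<close>.
  Restarting at \<open>\<delta>\<close> carries the bound to later slots.\<close>

lemma measure_slot_double:
  assumes \<delta>: "0 \<le> \<delta>"
  shows "measure expS {x. slot_double \<delta> m x} \<le> \<delta>\<^sup>2"
proof (induction m)
  case 0
  let ?B = "{x. x 0 \<le> \<delta> \<and> x 1 \<le> \<delta>}"
  have B: "?B = prod_emb UNIV (\<lambda>_. expd) {0, 1} (\<Pi>\<^sub>E i\<in>{0, 1::nat}. {..\<delta>})"
    by (rule set_eqI) (simp add: prod_emb_iff restrict_PiE_iff conj_commute)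
  have "measure expS {x. slot_double \<delta> 0 x} \<le> measure expS ?B"
  proof (rule expseq.P.finite_measure_mono_AE)
    show "AE x in expS. x \<in> {x. slot_double \<delta> 0 x} \<longrightarrow> x \<in> ?B"
      using AE_expS_pos
    proof eventually_elim
      case (elim x)
      have "x 0 \<le> \<delta>" "x 1 \<le> \<delta>" if "part x (Suc k) \<le> \<delta>" for k
        using part_mono[OF elim, of 1 "Suc k"] that elim[rule_format, of 0] elim[rule_format, of 1]
        by (auto simp: part_def)
      then show ?case by (auto simp: slot_double_def)
    qed
  next
    show "?B \<in> sets expS" unfolding B by (rule sets_PiM_I) auto
  qed
  also have "measure expS ?B = (\<Prod>i\<in>{0, 1::nat}. measure expd {..\<delta>})"
    unfolding B by (rule expseq.measure_PiM_emb) auto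
  also have "\<dots> = (1 - exp (- \<delta>))\<^sup>2" using \<delta> by (simp add: measure_expd_le power2_eq_square)
  also have "\<dots> \<le> \<delta>\<^sup>2"
    using exp_ge_add_one_self[of "- \<delta>"] \<delta> by (intro power_mono) auto
  finally show ?case .
next
  case (Suc m)
  let ?D = "\<lambda>m. {x. slot_double \<delta> m x}"
  have "measure expS (?D (Suc m)) = measure expS (\<Union>k\<in>UNIV. restart_set \<delta> k (?D m))"
  proof (rule measure_eq_AE)
    show "AE x in expS. x \<in> ?D (Suc m) \<longleftrightarrow> x \<in> (\<Union>k\<in>UNIV. restart_set \<delta> k (?D m))"
      using AE_restart_UNIV[of \<delta>]
    proof eventually_elim
      case (elim x)
      then obtain k where k: "x \<in> restart_set \<delta> k UNIV" by auto
      have "x \<in> restart_set \<delta> k (?D m)" if "slot_double \<delta> (Suc m) x"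
        using that k slot_restart(2)[OF k \<delta>] by (auto simp: restart_set_def)
      moreover have "slot_double \<delta> (Suc m) x" if "x \<in> restart_set \<delta> k' (?D m)" for k'
        using that slot_restart(2)[OF that \<delta>] by (auto simp: restart_set_def)
      ultimately show ?case by auto
    qed
  qed (auto intro!: sets.countable_UN'')
  also have "\<dots> = measure expS (\<Union>k\<in>UNIV. restart_set \<delta> k UNIV) * measure expS (?D m)"
    by (rule measure_restart_UN[OF sets_slot(2) \<delta>])
  also have "\<dots> \<le> 1 * measure expS (?D m)"
    by (intro mult_right_mono) auto
  finally show ?case using Suc by simp
qed

section \<open>Independence of different edges\<close>

abbreviation expI :: "'e set \<Rightarrow> ('e \<times> nat \<Rightarrow> real) measure" where
  "expI I \<equiv> \<Pi>\<^sub>M i\<in>I \<times> UNIV. expd"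

lemma prob_space_expI: "prob_space (expI I)"
  by (intro prob_space_PiM expd.prob_space_axioms)

definition seq_of :: "'e \<Rightarrow> ('e \<times> nat \<Rightarrow> real) \<Rightarrow> nat \<Rightarrow> real" where
  "seq_of e \<omega> i = \<omega> (e, i)"

lemma measurable_seq_of: "e \<in> I \<Longrightarrow> seq_of e \<in> measurable (expI I) expS"
  unfolding seq_of_def
  by (rule measurable_PiM_single') (auto simp: space_PiM PiE_iff intro!: measurable_component_singleton)

lemma distr_seq_of:
  assumes "e \<in> I"
  shows "distr (expI I) expS (seq_of e) = expS"
proof -
  have "distr (Pi\<^sub>M (I \<times> UNIV) (\<lambda>_. expd)) (\<Pi>\<^sub>M i\<in>UNIV. expd) (\<lambda>\<omega>. \<lambda>n\<in>UNIV. \<omega> (e, n)) = expS"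
    by (rule distr_PiM_reindex) (use assms in \<open>auto simp: inj_on_def expd.prob_space_axioms\<close>)
  moreover have "(\<lambda>\<omega>. \<lambda>n\<in>UNIV. \<omega> (e, n)) = (seq_of e :: ('a \<times> nat \<Rightarrow> real) \<Rightarrow> _)"
    by (auto simp: fun_eq_iff seq_of_def)
  ultimately show ?thesis by simp
qed

text \<open>Different edges read disjoint blocks of coordinates of the product space, and each block
  has the law \<open>expS\<close>.\<close>

lemma prob_seq_of:
  assumes K: "finite K" "K \<subseteq> I" and B: "\<And>e. e \<in> K \<Longrightarrow> B e \<in> sets expS"
  shows "measure (expI I) {\<omega> \<in> space (expI I). \<forall>e\<in>K. seq_of e \<omega> \<in> B e} = (\<Prod>e\<in>K. measure expS (B e))"
proof (cases "K = {}")
  case True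
  then show ?thesis using prob_space.prob_space[OF prob_space_expI[of I]] by simp
next
  case False
  interpret prob_space "expI I" by (rule prob_space_expI)
  let ?I = "I \<times> (UNIV :: nat set)"
  have ind: "indep_vars (\<lambda>_. expd) (\<lambda>i \<omega>. \<omega> i) ?I"
  proof (subst indep_vars_iff_distr_eq_PiM')
    show "?I \<noteq> {}" using False K by auto
    have "distr (expI I) (expI I) (\<lambda>x. restrict x ?I) = distr (expI I) (expI I) (\<lambda>x. x)"
      by (rule distr_cong) (auto simp: space_PiM)
    also have "\<dots> = expI I" by simp
    also have "\<dots> = (\<Pi>\<^sub>M i\<in>?I. distr (expI I) expd (\<lambda>\<omega>. \<omega> i))"
    proof (rule PiM_cong[OF refl])
      fix i assume "i \<in> ?I"
      then show "expd = distr (expI I) expd (\<lambda>\<omega>. \<omega> i)"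
        using distr_PiM_component[of ?I "\<lambda>_. expd" i] by (simp add: expd.prob_space_axioms)
    qed
    finally show "distr (expI I) (expI I) (\<lambda>x. \<lambda>i\<in>?I. x i) = (\<Pi>\<^sub>M i\<in>?I. distr (expI I) expd (\<lambda>\<omega>. \<omega> i))" .
  qed (auto intro!: measurable_component_singleton)
  have "indep_vars (\<lambda>e. PiM ({e} \<times> UNIV) (\<lambda>_. expd)) (\<lambda>e \<omega>. restrict (\<lambda>i. \<omega> i) ({e} \<times> UNIV)) K"
    by (rule indep_vars_restrict[OF ind]) (use K in \<open>auto simp: disjoint_family_on_def\<close>)
  then have "indep_vars (\<lambda>_. expS) (\<lambda>e \<omega>. seq_of e (restrict (\<lambda>i. \<omega> i) ({e} \<times> UNIV))) K"
    by (rule indep_vars_compose2) (auto intro!: measurable_seq_of)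
  moreover have "seq_of e (restrict (\<lambda>i. \<omega> i) ({e} \<times> UNIV)) = seq_of e \<omega>" for e and \<omega> :: "'a \<times> nat \<Rightarrow> real"
    by (auto simp: seq_of_def)
  ultimately have "indep_vars (\<lambda>_. expS) seq_of K" by simp
  then have "prob (\<Inter>e\<in>K. seq_of e -` B e \<inter> space (expI I)) = (\<Prod>e\<in>K. prob (seq_of e -` B e \<inter> space (expI I)))"
    using False K B by (intro indep_varsD_finite)
  moreover have "(\<Inter>e\<in>K. seq_of e -` B e \<inter> space (expI I)) = {\<omega> \<in> space (expI I). \<forall>e\<in>K. seq_of e \<omega> \<in> B e}"
    using False by auto
  moreover have "prob (seq_of e -` B e \<inter> space (expI I)) = measure expS (B e)" if "e \<in> K" for e
    using measure_distr[OF measurable_seq_of B, of e I e] distr_seq_of[of e I] that K by auto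
  ultimately show ?thesis by simp
qed

section \<open>From rings to bits\<close>

lemma ring_time_eq: "ring_time \<omega> e k = part (seq_of e \<omega>) k"
  by (simp add: ring_time_def part_def seq_of_def)

context tree
begin

definition bits_of :: "real \<Rightarrow> nat \<Rightarrow> nat \<Rightarrow> ('a set \<times> nat \<Rightarrow> real) \<Rightarrow> ('a \<times> nat) set" where
  "bits_of T n M \<omega> = {(w, m). w \<in> nonroot n \<and> m < M \<and> slot_hit (T / M) m (seq_of (pedge w) \<omega>)}"

abbreviation P :: "('a set \<times> nat \<Rightarrow> real) measure" where "P \<equiv> stirring_space V adj"

lemma P_eq: "P = expI (edges V adj)"
  by (simp add: stirring_space_def expd_def)

lemma prob_space_P: "prob_space P"
  unfolding P_eq by (rule prob_space_expI)

lemma pedge_in_edges: "w \<in> nonroot n \<Longrightarrow> pedge w \<in> edges V adj"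
  using nonroot_subset edges_eq by auto

lemma measurable_seq_pedge: "w \<in> nonroot n \<Longrightarrow> seq_of (pedge w) \<in> measurable P expS"
  unfolding P_eq by (rule measurable_seq_of[OF pedge_in_edges])

lemma sets_slot_hit: "w \<in> nonroot n \<Longrightarrow> {\<omega> \<in> space P. slot_hit \<delta> m (seq_of (pedge w) \<omega>)} \<in> sets P"
  using measurable_sets[OF measurable_seq_pedge sets_slot(1)[of \<delta> m]] by (simp add: vimage_def Int_def conj_commute)

lemma sets_slot_double: "w \<in> nonroot n \<Longrightarrow> {\<omega> \<in> space P. slot_double \<delta> m (seq_of (pedge w) \<omega>)} \<in> sets P"
  using measurable_sets[OF measurable_seq_pedge sets_slot(2)[of \<delta> m]] by (simp add: vimage_def Int_def conj_commute)

lemma bits_of_subset: "bits_of T n M \<omega> \<subseteq> nonroot n \<times> {..<M}"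
  by (auto simp: bits_of_def)

lemma sets_bits_eq: "{\<omega> \<in> space P. bits_of T n M \<omega> = A} \<in> sets P"
proof (cases "A \<subseteq> nonroot n \<times> {..<M}")
  case True
  have "{\<omega> \<in> space P. bits_of T n M \<omega> = A} =
    {\<omega> \<in> space P. \<forall>w\<in>nonroot n. \<forall>m\<in>{..<M}. slot_hit (T / M) m (seq_of (pedge w) \<omega>) \<longleftrightarrow> (w, m) \<in> A}"
    using True by (fastforce simp: bits_of_def)
  also have "\<dots> \<in> sets P"
  proof (intro sets.sets_Collect_finite_All finite_nonroot finite_lessThan)
    fix w m assume w: "w \<in> nonroot n"
    show "{\<omega> \<in> space P. slot_hit (T / M) m (seq_of (pedge w) \<omega>) \<longleftrightarrow> (w, m) \<in> A} \<in> sets P"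
      using sets_slot_hit[OF w, of "T / M" m] by (cases "(w, m) \<in> A") (auto intro: sets.sets_Collect_neg)
  qed
  finally show ?thesis .
next
  case False
  then have "{\<omega> \<in> space P. bits_of T n M \<omega> = A} = {}" using bits_of_subset by blast
  then show ?thesis by (simp only: sets.empty_sets)
qed

lemma prod_bits:
  assumes "finite S" "A \<subseteq> S"
  shows "(\<Prod>b\<in>S. if b \<in> A then x else y) = x ^ card A * (y :: real) ^ card (S - A)"
proof -
  have "{b \<in> S. b \<in> A} = A" "{b \<in> S. b \<notin> A} = S - A" using assms by auto
  then show ?thesis using assms by (simp add: prod.If_cases Int_def conj_commute Collect_neg_eq[symmetric] set_diff_eq)
qed

lemma prob_bits_eq:
  assumes T: "0 \<le> T" and A: "A \<subseteq> nonroot n \<times> {..<M}"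
  shows "measure P {\<omega> \<in> space P. bits_of T n M \<omega> = A}
    = (1 - exp (- (T / M))) ^ card A * exp (- (T / M)) ^ card (nonroot n \<times> {..<M} - A)"
proof -
  let ?K = "pedge ` nonroot n" and ?\<delta> = "T / M"
  define B where "B e = {m. \<exists>w\<in>nonroot n. pedge w = e \<and> (w, m) \<in> A}" for e
  have inj: "inj_on pedge (nonroot n)" using inj_pedge nonroot_subset by (rule inj_on_subset)
  have Bp: "B (pedge w) = {m. (w, m) \<in> A}" if "w \<in> nonroot n" for w
    using that inj by (auto simp: B_def inj_on_def)
  have "{\<omega> \<in> space P. bits_of T n M \<omega> = A} =
    {\<omega> \<in> space (expI (edges V adj)). \<forall>e\<in>?K. seq_of e \<omega> \<in> {x. \<forall>m<M. slot_hit ?\<delta> m x \<longleftrightarrow> m \<in> B e}}"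
    unfolding P_eq using A by (fastforce simp: bits_of_def Bp)
  then have "measure P {\<omega> \<in> space P. bits_of T n M \<omega> = A} = (\<Prod>e\<in>?K. measure expS {x. \<forall>m<M. slot_hit ?\<delta> m x \<longleftrightarrow> m \<in> B e})"
  proof (simp only: P_eq, intro prob_seq_of)
    show "?K \<subseteq> edges V adj" using pedge_in_edges by auto
    fix e
    have "{x \<in> space expS. \<forall>m<M. slot_hit ?\<delta> m x \<longleftrightarrow> m \<in> B e} \<in> sets expS"
      unfolding slot_hit_def by measurable
    then show "{x. \<forall>m<M. slot_hit ?\<delta> m x \<longleftrightarrow> m \<in> B e} \<in> sets expS" by simp
  qed (simp add: finite_nonroot)
  also have "\<dots> = (\<Prod>w\<in>nonroot n. \<Prod>m<M. if m \<in> B (pedge w) then 1 - exp (- ?\<delta>) else exp (- ?\<delta>))"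
    using T by (simp add: prod.reindex[OF inj] measure_pattern)
  also have "\<dots> = (\<Prod>w\<in>nonroot n. \<Prod>m<M. if (w, m) \<in> A then 1 - exp (- ?\<delta>) else exp (- ?\<delta>))"
    by (intro prod.cong) (auto simp: Bp)
  also have "\<dots> = (\<Prod>b\<in>nonroot n \<times> {..<M}. if b \<in> A then 1 - exp (- ?\<delta>) else exp (- ?\<delta>))"
    by (subst prod.cartesian_product) (auto intro: prod.cong)
  also have "\<dots> = (1 - exp (- ?\<delta>)) ^ card A * exp (- ?\<delta>) ^ card (nonroot n \<times> {..<M} - A)"
    using A finite_nonroot by (intro prod_bits) auto
  finally show ?thesis .
qed

text \<open>The bridge from ring times to \<open>bexp\<close>. The bits take finitely many values,
  so \<open>Q\<close> can be an arbitrary predicate and measurability comes for free.\<close>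

lemma bits_event:
  assumes T: "0 \<le> T"
  shows "{\<omega> \<in> space P. Q (bits_of T n M \<omega>)} \<in> sets P"
    "measure P {\<omega> \<in> space P. Q (bits_of T n M \<omega>)} =
      bexp (1 - exp (- (T / M))) (nonroot n \<times> {..<M}) (\<lambda>A. of_bool (Q A))"
proof -
  interpret prob_space P by (rule prob_space_P)
  let ?S = "nonroot n \<times> {..<M}" and ?E = "\<lambda>A. {\<omega> \<in> space P. bits_of T n M \<omega> = A}"
  have fin: "finite (Pow ?S)" using finite_nonroot by simp
  have eq: "{\<omega> \<in> space P. Q (bits_of T n M \<omega>)} = (\<Union>A\<in>{A\<in>Pow ?S. Q A}. ?E A)"
    using bits_of_subset by fastforce
  show "{\<omega> \<in> space P. Q (bits_of T n M \<omega>)} \<in> sets P"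
    unfolding eq using fin sets_bits_eq by (intro sets.finite_UN) auto
  have "measure P (\<Union>A\<in>{A\<in>Pow ?S. Q A}. ?E A) = (\<Sum>A\<in>{A\<in>Pow ?S. Q A}. measure P (?E A))"
    using fin sets_bits_eq by (intro finite_measure_finite_Union) (auto simp: disjoint_family_on_def)
  also have "\<dots> = (\<Sum>A\<in>Pow ?S. measure P (?E A) * of_bool (Q A))"
    using fin by (intro sum.mono_neutral_cong_left) auto
  also have "\<dots> = bexp (1 - exp (- (T / M))) ?S (\<lambda>A. of_bool (Q A))"
    unfolding bexp_def using T by (intro sum.cong refl) (simp add: prob_bits_eq)
  finally show "measure P {\<omega> \<in> space P. Q (bits_of T n M \<omega>)} =
      bexp (1 - exp (- (T / M))) ?S (\<lambda>A. of_bool (Q A))"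
    unfolding eq .
qed

lemma AE_pos: "AE \<omega> in P. \<forall>w\<in>V - {r}. \<forall>i. 0 < seq_of (pedge w) \<omega> i"
proof (subst AE_ball_countable)
  show "countable (V - {r})" using countable_V by auto
  show "\<forall>w\<in>V - {r}. AE \<omega> in P. \<forall>i. 0 < seq_of (pedge w) \<omega> i"
  proof
    fix w assume "w \<in> V - {r}"
    then have e: "pedge w \<in> edges V adj" by (simp add: edges_eq)
    show "AE \<omega> in P. \<forall>i. 0 < seq_of (pedge w) \<omega> i"
      by (rule AE_distrD[OF measurable_seq_of[OF e, folded P_eq], of "\<lambda>x. \<forall>i. 0 < x i"])
        (simp only: P_eq distr_seq_of[OF e] AE_expS_pos)
  qed
qed

section \<open>Comparison of the stirring process with the walk\<close>

definition separated :: "real \<Rightarrow> nat \<Rightarrow> nat \<Rightarrow> ('a set \<times> nat \<Rightarrow> real) \<Rightarrow> bool" where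
  "separated T n M \<omega> \<longleftrightarrow> simple_bars (bits_of T n M \<omega>) \<and>
    (\<forall>w\<in>nonroot n. \<forall>m<M. \<not> slot_double (T / M) m (seq_of (pedge w) \<omega>))"

lemma bars_bits: "A \<subseteq> nonroot n \<times> {..<M} \<Longrightarrow> bars A"
  using nonroot_subset by (fastforce simp: bars_def in_ch)

lemma incident_edge:
  assumes "x \<in> V" "lev x < n" "e \<in> edges V adj" "x \<in> e"
  obtains w where "w \<in> nonroot n" "e = pedge w" "x = w \<or> x = par w"
proof -
  obtain w where w: "w \<in> V - {r}" "e = pedge w" using assms(3) by (auto simp: edges_eq)
  then have "x = w \<or> x = par w" using assms(4) by (auto simp: pedge_def)
  moreover have "w \<in> nonroot n" using calculation w par(2)[of w] assms(2) by (auto simp: nonroot_def)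
  ultimately show ?thesis using that w by blast
qed

lemma unique_ring:
  assumes sep: "separated T n M \<omega>" and pos: "\<forall>w\<in>V - {r}. \<forall>i. 0 < seq_of (pedge w) \<omega> i"
    and m: "m < M" and w: "w \<in> nonroot n" "w' \<in> nonroot n"
    and \<rho>: "real m * (T / M) < ring_time \<omega> (pedge w) k" "ring_time \<omega> (pedge w) k \<le> real (Suc m) * (T / M)"
    and \<rho>': "real m * (T / M) < ring_time \<omega> (pedge w') k'" "ring_time \<omega> (pedge w') k' \<le> real (Suc m) * (T / M)"
  shows "w = w' \<and> k = k'"
proof -
  have "(w, m) \<in> bits_of T n M \<omega>" "(w', m) \<in> bits_of T n M \<omega>"
    using \<rho> \<rho>' m w unfolding bits_of_def slot_hit_def ring_time_eq by blast+
  then have ww: "w = w'" using sep unfolding separated_def simple_bars_def by blast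
  have pw: "\<forall>i. 0 < seq_of (pedge w) \<omega> i" using pos w nonroot_subset by auto
  have "False" if "real m * (T / M) < ring_time \<omega> (pedge w) k" "ring_time \<omega> (pedge w) l \<le> real (Suc m) * (T / M)" "k < l" for k l
  proof -
    have "part (seq_of (pedge w) \<omega>) (Suc k) \<le> part (seq_of (pedge w) \<omega>) l"
      by (rule part_mono[OF pw]) (use that in simp)
    then have "slot_double (T / M) m (seq_of (pedge w) \<omega>)"
      using that unfolding slot_double_def ring_time_eq by force
    then show False using sep m w by (auto simp: separated_def)
  qed
  then show ?thesis using ww \<rho> \<rho>' by (metis linorder_neqE_nat)
qed

lemma stir_step_empty: "incident_rings V adj \<omega> x t T = {} \<Longrightarrow> stir_step V adj \<omega> T (x, t) = (x, t)"
  by (simp add: stir_step_def)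

lemma stir_step_first:
  assumes e: "e \<in> edges V adj" "x \<in> e" "ring_time \<omega> e k = \<rho>" "t < \<rho>" "\<rho> \<le> T"
    and first: "\<And>\<rho>'. \<rho>' \<in> incident_rings V adj \<omega> x t T \<Longrightarrow> \<rho> \<le> \<rho>'"
    and uniq: "\<And>e' k. \<lbrakk>e' \<in> edges V adj; x \<in> e'; ring_time \<omega> e' k = \<rho>\<rbrakk> \<Longrightarrow> e' = e"
    and y: "e = {x, y}" "y \<noteq> x"
  shows "stir_step V adj \<omega> T (x, t) = (y, \<rho>)"
proof -
  have \<rho>: "\<rho> \<in> incident_rings V adj \<omega> x t T" using e by (auto simp: incident_rings_def)
  have "Inf (incident_rings V adj \<omega> x t T) = \<rho>" using \<rho> first by (rule cInf_eq_minimum)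
  moreover have "(SOME e. e \<in> edges V adj \<and> x \<in> e \<and> (\<exists>k. ring_time \<omega> e k = \<rho>)) = e"
    using e uniq by (intro some_equality) blast+
  moreover have "(THE w. e = {x, w} \<and> w \<noteq> x) = y"
    using y by (intro the_equality) (auto simp: doubleton_eq_iff)
  ultimately show ?thesis using \<rho> by (auto simp: stir_step_def Let_def)
qed

lemma snd_walk_from_start: "0 < M \<Longrightarrow> snd ((walk M A ^^ i) (u, M - 1)) = (M - 1 + i) mod M"
  by (induction i) (auto simp: walk_def mod_Suc_eq)

text \<open>As long as the path stays at levels below \<open>n\<close>, all edges at its current
  vertex have their bits recorded, and with one ring per slot each jump is the swap of a slot.
  Starting at \<open>M - 1\<close> makes the first swap that of slot 0.\<close>

lemma stir_walk:
  assumes T: "0 < T" and M: "0 < M" and sep: "separated T n M \<omega>"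
    and pos: "\<forall>w\<in>V - {r}. \<forall>i. 0 < seq_of (pedge w) \<omega> i" and u: "u \<in> V"
    and low: "\<And>i. i \<le> M \<Longrightarrow> lev (fst ((walk M (bits_of T n M \<omega>) ^^ i) (u, M - 1))) < n"
  shows "stir_perm V adj T \<omega> u = fst ((walk M (bits_of T n M \<omega>) ^^ M) (u, M - 1))"
    "fst ((walk M (bits_of T n M \<omega>) ^^ M) (u, M - 1)) \<in> V"
proof -
  define A where "A = bits_of T n M \<omega>"
  define s where "s i = fst ((walk M A ^^ i) (u, M - 1))" for i
  define \<delta> where "\<delta> = T / M"
  have \<delta>: "0 < \<delta>" "real M * \<delta> = T" using T M by (auto simp: \<delta>_def)
  have simple: "simple_bars A" using sep by (simp add: separated_def A_def)
  have low: "lev (s i) < n" if "i \<le> M" for i using low[OF that] by (simp add: s_def A_def)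
  have sSuc: "s (Suc i) = swp A i (s i)" if "i < M" for i
  proof -
    have "Suc (M - 1 + i) mod M = i" using that M by simp
    then have "Suc (snd ((walk M A ^^ i) (u, M - 1))) mod M = i"
      by (subst snd_walk_from_start[OF M]) (simp only: mod_Suc_eq)
    then show ?thesis unfolding s_def by (simp only: funpow.simps comp_apply walk_def fst_conv)
  qed
  \<comment> \<open>A stirring step jumps to the next ring while the walk advances slot by slot.
    They are synchronised by the condition that no ring at the current vertex lies between the last
    jump time \<open>t\<close> and the start of slot \<open>i\<close>.\<close>
  have main: "\<exists>N t. (stir_step V adj \<omega> T ^^ N) (u, 0) = (s i, t) \<and> t \<le> real i * \<delta> \<and>
      incident_rings V adj \<omega> (s i) t (real i * \<delta>) = {} \<and> s i \<in> V" if "i \<le> M" for i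
    using that
  proof (induction i)
    case 0
    show ?case using u by (intro exI[of _ 0]) (auto simp: s_def incident_rings_def)
  next
    case (Suc i)
    define x where "x = s i"
    obtain N t where IH: "(stir_step V adj \<omega> T ^^ N) (u, 0) = (x, t)" "t \<le> real i * \<delta>"
      "incident_rings V adj \<omega> x t (real i * \<delta>) = {}" "x \<in> V"
      using Suc by (auto simp: x_def)
    have x: "lev x < n" using low Suc.prems by (simp add: x_def)
    have iM: "i < M" using Suc.prems by simp
    have slots: "real i * \<delta> \<le> real (Suc i) * \<delta>" "real (Suc i) * \<delta> \<le> T"
    proof -
      show "real i * \<delta> \<le> real (Suc i) * \<delta>" using \<delta> by (intro mult_right_mono) auto
      have "real (Suc i) * \<delta> \<le> real M * \<delta>" using \<delta> iM by (intro mult_right_mono) auto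
      then show "real (Suc i) * \<delta> \<le> T" using \<delta> by simp
    qed
    show ?case
    proof (cases "\<exists>w. (w, i) \<in> A \<and> x \<in> pedge w")
      case False
      have "swp A i x = x"
        by (rule swp_stay[OF simple]) (use False in \<open>auto simp: in_ch pedge_def\<close>)
      then have sx: "s (Suc i) = x" using sSuc[OF iM] by (simp add: x_def)
      have "incident_rings V adj \<omega> x t (real (Suc i) * \<delta>) = {}"
      proof (rule ccontr)
        assume "incident_rings V adj \<omega> x t (real (Suc i) * \<delta>) \<noteq> {}"
        then obtain e k where ek: "e \<in> edges V adj" "x \<in> e" "t < ring_time \<omega> e k" "ring_time \<omega> e k \<le> real (Suc i) * \<delta>"
          by (auto simp: incident_rings_def)
        then have "real i * \<delta> < ring_time \<omega> e k" using IH(3) by (force simp: incident_rings_def)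
        moreover obtain w where w: "w \<in> nonroot n" "e = pedge w"
          using incident_edge[OF IH(4) x ek(1,2)] by blast
        ultimately have "(w, i) \<in> A"
          unfolding A_def bits_of_def slot_hit_def using ek iM by (auto simp: ring_time_eq \<delta>_def)
        then show False using False ek w by auto
      qed
      then show ?thesis using IH slots sx by (intro exI[of _ N] exI[of _ t]) auto
    next
      case True
      then obtain w where w: "(w, i) \<in> A" "x \<in> pedge w" by auto
      then obtain k where wn: "w \<in> nonroot n" and k: "real i * \<delta> < ring_time \<omega> (pedge w) k"
        "ring_time \<omega> (pedge w) k \<le> real (Suc i) * \<delta>"
        by (auto simp: A_def bits_of_def slot_hit_def ring_time_eq \<delta>_def)
      define \<rho> where "\<rho> = ring_time \<omega> (pedge w) k"
      define y where "y = swp A i x"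
      have wV: "w \<in> V" "w \<noteq> r" using wn nonroot_subset by auto
      have parw: "par w \<noteq> w" using par(2)[OF wV] by auto
      have y: "pedge w = {x, y}" "y \<noteq> x" "y \<in> V"
      proof -
        consider "x = w" | "x = par w" using w by (auto simp: pedge_def)
        then have "pedge w = {x, y} \<and> y \<noteq> x \<and> y \<in> V"
        proof cases
          case 1
          then have "y = par w" using swp_par[OF simple w(1)] by (simp add: y_def)
          then show ?thesis using 1 parw par(3)[OF wV] by (auto simp: pedge_def)
        next
          case 2
          then have "y = w" using swp_ch[OF simple w(1)] wV by (simp add: y_def in_ch)
          then show ?thesis using 2 parw wV by (auto simp: pedge_def)
        qed
        then show "pedge w = {x, y}" "y \<noteq> x" "y \<in> V" by auto
      qed
      have sy: "s (Suc i) = y" using sSuc[OF iM] by (simp add: x_def y_def)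
      then have ylow: "lev y < n" using low Suc.prems by metis
      \<comment> \<open>Used at both endpoints: at \<open>x\<close> it identifies the next ring, at
        \<open>y\<close> it rules out a second jump within the slot.\<close>
      have uniq: "e' = pedge w \<and> ring_time \<omega> e' k' = \<rho>"
        if z: "z = x \<or> z = y" and e': "e' \<in> edges V adj" "z \<in> e'"
          "real i * \<delta> < ring_time \<omega> e' k'" "ring_time \<omega> e' k' \<le> real (Suc i) * \<delta>" for z e' k'
      proof -
        have "z \<in> V" "lev z < n" using z x ylow y IH(4) by auto
        then obtain w' where w': "w' \<in> nonroot n" "e' = pedge w'"
          using incident_edge[OF _ _ e'(1,2)] by blast
        have "w = w' \<and> k = k'"
          by (rule unique_ring[OF sep pos iM wn w'(1)]) (use k e' w' in \<open>auto simp: \<delta>_def\<close>)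
        then show ?thesis using w' by (simp add: \<rho>_def)
      qed
      have "stir_step V adj \<omega> T (x, t) = (y, \<rho>)"
      proof (rule stir_step_first)
        show "pedge w \<in> edges V adj" by (rule pedge_in_edges[OF wn])
        show "x \<in> pedge w" by (rule w)
        show "ring_time \<omega> (pedge w) k = \<rho>" by (simp add: \<rho>_def)
        show "t < \<rho>" "\<rho> \<le> T" using IH(2) k slots by (auto simp: \<rho>_def)
        show "pedge w = {x, y}" "y \<noteq> x" by (rule y)+
        show "e' = pedge w" if "e' \<in> edges V adj" "x \<in> e'" "ring_time \<omega> e' k' = \<rho>" for e' k'
          using uniq[of x e' k'] that k by (auto simp: \<rho>_def)
        fix \<rho>' assume "\<rho>' \<in> incident_rings V adj \<omega> x t T"
        then obtain e' k' where e': "e' \<in> edges V adj" "x \<in> e'" "\<rho>' = ring_time \<omega> e' k'" "t < \<rho>'"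
          by (auto simp: incident_rings_def)
        have "real i * \<delta> < \<rho>'" using IH(3) e' by (force simp: incident_rings_def)
        show "\<rho> \<le> \<rho>'"
        proof (cases "\<rho>' \<le> real (Suc i) * \<delta>")
          case True
          then show ?thesis using uniq[of x e' k'] e' \<open>real i * \<delta> < \<rho>'\<close> by auto
        next
          case False
          then show ?thesis using k by (simp add: \<rho>_def)
        qed
      qed
      moreover have "incident_rings V adj \<omega> y \<rho> (real (Suc i) * \<delta>) = {}"
      proof (rule ccontr)
        assume "incident_rings V adj \<omega> y \<rho> (real (Suc i) * \<delta>) \<noteq> {}"
        then obtain e' k' where "e' \<in> edges V adj" "y \<in> e'" "\<rho> < ring_time \<omega> e' k'" "ring_time \<omega> e' k' \<le> real (Suc i) * \<delta>"
          by (auto simp: incident_rings_def)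
        then show False using uniq[of y e' k'] k by (auto simp: \<rho>_def)
      qed
      ultimately have "(stir_step V adj \<omega> T ^^ Suc N) (u, 0) = (s (Suc i), \<rho>) \<and> \<rho> \<le> real (Suc i) * \<delta> \<and>
        incident_rings V adj \<omega> (s (Suc i)) \<rho> (real (Suc i) * \<delta>) = {} \<and> s (Suc i) \<in> V"
        using IH(1) k y by (simp add: sy \<rho>_def)
      then show ?thesis by blast
    qed
  qed
  obtain N t where N: "(stir_step V adj \<omega> T ^^ N) (u, 0) = (s M, t)"
    "incident_rings V adj \<omega> (s M) t T = {}" "s M \<in> V"
    using main[of M] \<delta> by auto
  have const: "(stir_step V adj \<omega> T ^^ n) (u, 0) = (s M, t)" if "N \<le> n" for n
    using that by (induction n rule: dec_induct) (simp_all add: N stir_step_empty)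
  have "stir_perm V adj T \<omega> u = s M"
    unfolding stir_perm_def
  proof (rule the_equality)
    show "\<exists>N. \<forall>n\<ge>N. fst ((stir_step V adj \<omega> T ^^ n) (u, 0)) = s M"
      using const by (intro exI[of _ N]) auto
    fix w assume "\<exists>N. \<forall>n\<ge>N. fst ((stir_step V adj \<omega> T ^^ n) (u, 0)) = w"
    then obtain N' where "\<forall>n\<ge>N'. fst ((stir_step V adj \<omega> T ^^ n) (u, 0)) = w" by blast
    then show "w = s M" using const[of "max N N'"] by (metis fst_conv max.cobounded1 max.cobounded2)
  qed
  then show "stir_perm V adj T \<omega> u = fst ((walk M (bits_of T n M \<omega>) ^^ M) (u, M - 1))"
    "fst ((walk M (bits_of T n M \<omega>) ^^ M) (u, M - 1)) \<in> V"
    using N(3) by (simp_all add: s_def A_def)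
qed

end

section \<open>Union bounds for the discretised model\<close>

text \<open>Factors that read disjoint blocks of bits are independent; each block will hold the bits
  of one subtree.\<close>

lemma bexp_prod_le:
  assumes p: "0 \<le> p" "p \<le> 1" and X: "finite X" and S: "\<And>v. v \<in> X \<Longrightarrow> finite (S v)"
    and dj: "disjoint_family_on S X"
    and loc: "\<And>v A. v \<in> X \<Longrightarrow> F v A = F v (A \<inter> S v)"
    and F: "\<And>v A. v \<in> X \<Longrightarrow> 0 \<le> F v A" "\<And>v. v \<in> X \<Longrightarrow> bexp p (S v) (F v) \<le> q"
  shows "bexp p (\<Union>v\<in>X. S v) (\<lambda>A. \<Prod>v\<in>X. F v A) \<le> q ^ card X"
  using X S dj loc F
proof (induction X rule: finite_induct)
  case empty
  show ?case by simp
next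
  case (insert x X)
  let ?U = "\<Union>v\<in>X. S v"
  have sx: "S v \<inter> S x = {}" if "v \<in> X" for v
    using insert.prems(2) insert.hyps that by (auto simp: disjoint_family_on_def)
  have q: "0 \<le> bexp p (S x) (F x)" using p insert.prems(4) by (intro bexp_nonneg) auto
  have prod_nonneg: "0 \<le> (\<Prod>v\<in>X. F v A)" for A using insert.prems(4) by (intro prod_nonneg) auto
  have "bexp p (S x \<union> ?U) (\<lambda>A. \<Prod>v\<in>insert x X. F v A) =
      bexp p (S x) (\<lambda>A. bexp p ?U (\<lambda>A'. \<Prod>v\<in>insert x X. F v (A \<union> A')))"
    by (rule bexp_Un) (use insert.hyps insert.prems(1) sx in auto)
  also have "\<dots> = bexp p (S x) (\<lambda>A. bexp p ?U (\<lambda>A'. F x A * (\<Prod>v\<in>X. F v A')))"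
  proof (intro bexp_cong)
    fix A A' assume A: "A \<subseteq> S x" "A' \<subseteq> ?U"
    have "F x (A \<union> A') = F x ((A \<union> A') \<inter> S x)" "F x A = F x (A \<inter> S x)"
      by (intro insert.prems(3); simp)+
    moreover have "(A \<union> A') \<inter> S x = A \<inter> S x" using A sx by auto
    ultimately have "F x (A \<union> A') = F x A" by simp
    moreover have "F v (A \<union> A') = F v A'" if v: "v \<in> X" for v
    proof -
      have "F v (A \<union> A') = F v ((A \<union> A') \<inter> S v)" "F v A' = F v (A' \<inter> S v)"
        by (intro insert.prems(3); use v in simp)+
      moreover have "(A \<union> A') \<inter> S v = A' \<inter> S v" using A sx[OF v] by auto
      ultimately show ?thesis by simp
    qed
    ultimately show "(\<Prod>v\<in>insert x X. F v (A \<union> A')) = F x A * (\<Prod>v\<in>X. F v A')"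
      using insert.hyps by simp
  qed
  also have "\<dots> = bexp p ?U (\<lambda>A. \<Prod>v\<in>X. F v A) * bexp p (S x) (F x)"
    unfolding bexp_cmult[of p ?U] by (subst mult.commute) (rule bexp_cmult)
  also have "\<dots> \<le> q ^ card X * q"
  proof (intro mult_mono)
    show "bexp p ?U (\<lambda>A. \<Prod>v\<in>X. F v A) \<le> q ^ card X"
    proof (rule insert.IH)
      show "F v A = F v (A \<inter> S v)" if "v \<in> X" for v A
        by (rule insert.prems(3)) (use that in simp)
      show "disjoint_family_on S X"
        by (rule disjoint_family_on_mono[OF _ insert.prems(2)]) auto
    qed (use insert.prems(1,4,5) in auto)
    show "0 \<le> q ^ card X" using q insert.prems(5)[of x] by simp
    show "bexp p (S x) (F x) \<le> q" using insert.prems(5) by simp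
  qed (rule q)
  finally show ?case using insert.hyps by (simp add: mult.commute[of q])
qed

lemma bexp_mem:
  assumes "finite S" "b \<in> S"
  shows "bexp p S (\<lambda>A. of_bool (b \<in> A)) = p"
proof -
  have "bexp p S (\<lambda>A. of_bool (b \<in> A)) = bexp p (insert b (S - {b})) (\<lambda>A. of_bool (b \<in> A))"
    using assms by (simp add: insert_absorb)
  also have "\<dots> = p * bexp p (S - {b}) (\<lambda>A. 1) + (1 - p) * bexp p (S - {b}) (\<lambda>A. of_bool (b \<in> A))"
    using assms by (subst bexp_insert) auto
  also have "bexp p (S - {b}) (\<lambda>A. of_bool (b \<in> A)) = bexp p (S - {b}) (\<lambda>A. 0)"
    by (rule bexp_cong) auto
  finally show ?thesis using assms by (simp add: bexp_const)
qed

lemma bexp_mem2: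
  assumes "finite S" "b \<in> S" "b' \<in> S" "b \<noteq> b'"
  shows "bexp p S (\<lambda>A. of_bool (b \<in> A \<and> b' \<in> A)) = p\<^sup>2"
proof -
  have "bexp p S (\<lambda>A. of_bool (b \<in> A \<and> b' \<in> A)) = bexp p (insert b (S - {b})) (\<lambda>A. of_bool (b \<in> A \<and> b' \<in> A))"
    using assms by (simp add: insert_absorb)
  also have "\<dots> = p * bexp p (S - {b}) (\<lambda>A. of_bool (b' \<in> A)) + (1 - p) * bexp p (S - {b}) (\<lambda>A. of_bool (b \<in> A \<and> b' \<in> A))"
    using assms by (subst bexp_insert) auto
  also have "bexp p (S - {b}) (\<lambda>A. of_bool (b \<in> A \<and> b' \<in> A)) = bexp p (S - {b}) (\<lambda>A. 0)"
    by (rule bexp_cong) auto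
  also have "bexp p (S - {b}) (\<lambda>A. of_bool (b' \<in> A)) = p" using assms by (intro bexp_mem) auto
  finally show ?thesis using assms by (simp add: bexp_const power2_eq_square)
qed

lemma bexp_sum: "bexp p S (\<lambda>A. \<Sum>i\<in>I. F i A) = (\<Sum>i\<in>I. bexp p S (F i))"
  unfolding bexp_def sum_distrib_left by (rule sum.swap)

section \<open>Growth of the level along a path\<close>

context forest
begin

text \<open>The path of the walk over one period, unrolled from its first slot so that this slot can
  be split off by \<open>bexp_Un\<close>.\<close>

primrec trail :: "('a \<times> nat) set \<Rightarrow> nat \<Rightarrow> nat \<Rightarrow> 'a \<Rightarrow> 'a" where
  "trail A i 0 u = u"
| "trail A i (Suc j) u = trail A (Suc i) j (swp A i u)"

lemma swp_cong: "(\<And>w. (w, m) \<in> A \<longleftrightarrow> (w, m) \<in> A') \<Longrightarrow> swp A m = swp A' m"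
  by (simp add: swp_def)

lemma trail_cong:
  "(\<And>w m. i \<le> m \<Longrightarrow> (w, m) \<in> A \<longleftrightarrow> (w, m) \<in> A') \<Longrightarrow> trail A i j u = trail A' i j u"
proof (induction j arbitrary: i u)
  case (Suc j)
  have "swp A i = swp A' i" by (rule swp_cong) (use Suc.prems in auto)
  then show ?case using Suc by simp
qed simp

lemma trail_Suc: "trail A i (Suc j) u = swp A (i + j) (trail A i j u)"
proof (induction j arbitrary: i u)
  case (Suc j)
  have "trail A i (Suc (Suc j)) u = trail A (Suc i) (Suc j) (swp A i u)" by simp
  also have "\<dots> = swp A (Suc i + j) (trail A (Suc i) j (swp A i u))" by (rule Suc)
  finally show ?case by simp
qed simp

lemma swp_lev:
  assumes "bars A"
  shows "lev (swp A m u) \<le> lev u + of_bool (\<exists>w\<in>set (ch u). (w, m) \<in> A)"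
proof (cases "\<exists>w. (w, m) \<in> A")
  case True
  define w where "w = (SOME w. (w, m) \<in> A)"
  have w: "(w, m) \<in> A" unfolding w_def using True by (rule someI_ex)
  then have wc: "w \<in> set (ch (par w))" using assms by (auto simp: bars_def)
  have s: "swp A m u = Transposition.transpose (par w) w u"
    using True by (simp add: swp_def Let_def w_def)
  show ?thesis
  proof (cases "u = par w")
    case True
    then have "swp A m u = w" unfolding s by simp
    moreover have "\<exists>w\<in>set (ch u). (w, m) \<in> A" unfolding True using w wc by blast
    ultimately show ?thesis using lev_ch[OF wc] True by simp
  next
    case False
    show ?thesis
    proof (cases "u = w")
      case True
      then have "swp A m u = par w" unfolding s by simp
      then show ?thesis using lev_ch[OF wc] True by simp
    next
      case ne: False
      then have "swp A m u = u" unfolding s using False by simp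
      then show ?thesis by simp
    qed
  qed
qed (simp add: swp_def)

text \<open>\<open>2 ^ lev\<close> is a potential. A slot can double it only if an edge to one of at
  most \<open>D\<close> children rings, so its mean grows by a factor of at most
  \<open>1 + p * D\<close>; reaching level \<open>n\<close> makes it at least \<open>2 ^ n\<close>,
  and the quotient is a Markov bound.\<close>

lemma reach_bound:
  assumes p: "0 \<le> p" "p \<le> 1" and N: "finite N" and D: "\<And>v. length (ch v) \<le> D"
    and bars: "\<And>A. A \<subseteq> N \<times> UNIV \<Longrightarrow> bars A"
  shows "bexp p (N \<times> {i..<i + k}) (\<lambda>A. of_bool (\<exists>j\<le>k. n \<le> lev (trail A i j u)))
    \<le> (1 + p * D) ^ k * 2 ^ lev u / 2 ^ n"
proof (induction k arbitrary: i u)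
  case 0
  then show ?case using power_increasing[of n "lev u" "2::real"] by simp
next
  case (Suc k)
  have pD: "1 \<le> 1 + p * D" using p by simp
  show ?case
  proof (cases "n \<le> lev u")
    case True
    have "bexp p (N \<times> {i..<i + Suc k}) (\<lambda>A. of_bool (\<exists>j\<le>Suc k. n \<le> lev (trail A i j u))) \<le> 1"
      using p N by (intro bexp_le_const) auto
    also have "1 \<le> (2 ^ lev u / 2 ^ n :: real)" using power_increasing[OF True, of "2::real"] by simp
    also have "\<dots> \<le> (1 + p * D) ^ Suc k * 2 ^ lev u / 2 ^ n"
      using one_le_power[OF pD, of "Suc k"] by (simp add: divide_right_mono mult_right_mono del: power_Suc)
    finally show ?thesis .
  next
    case False
    let ?S = "N \<times> {i}" and ?S' = "N \<times> {Suc i..<Suc i + k}"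
    have split: "N \<times> {i..<i + Suc k} = ?S \<union> ?S'" by auto
    have "bexp p (?S \<union> ?S') (\<lambda>A. of_bool (\<exists>j\<le>Suc k. n \<le> lev (trail A i j u))) =
      bexp p ?S (\<lambda>A. bexp p ?S' (\<lambda>A'. of_bool (\<exists>j\<le>Suc k. n \<le> lev (trail (A \<union> A') i j u))))"
      by (rule bexp_Un) (use N in auto)
    also have "\<dots> \<le> bexp p ?S (\<lambda>A. ((1 + p * D) ^ k * 2 ^ lev u / 2 ^ n) * (1 + (\<Sum>w\<in>set (ch u) \<inter> N. of_bool ((w, i) \<in> A))))"
    proof (rule bexp_mono[OF p])
      fix A assume A: "A \<subseteq> ?S"
      have "bexp p ?S' (\<lambda>A'. of_bool (\<exists>j\<le>Suc k. n \<le> lev (trail (A \<union> A') i j u))) =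
        bexp p ?S' (\<lambda>A'. of_bool (\<exists>j\<le>k. n \<le> lev (trail A' (Suc i) j (swp A i u))))"
      proof (rule bexp_cong)
        fix A' assume A': "A' \<subseteq> ?S'"
        have "swp (A \<union> A') i = swp A i" by (rule swp_cong) (use A' in auto)
        moreover have "trail (A \<union> A') (Suc i) j x = trail A' (Suc i) j x" for j x
          by (rule trail_cong) (use A in auto)
        ultimately have "trail (A \<union> A') i (Suc j) u = trail A' (Suc i) j (swp A i u)" for j by simp
        moreover have "(\<exists>j\<le>Suc k. n \<le> lev (trail (A \<union> A') i j u)) \<longleftrightarrow> (\<exists>j\<le>k. n \<le> lev (trail (A \<union> A') i (Suc j) u))"
        proof
          assume "\<exists>j\<le>Suc k. n \<le> lev (trail (A \<union> A') i j u)"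
          then obtain j where j: "j \<le> Suc k" "n \<le> lev (trail (A \<union> A') i j u)" by auto
          then have "j \<noteq> 0" using False by (intro notI) simp
          then obtain j' where "j = Suc j'" using not0_implies_Suc by blast
          then show "\<exists>j\<le>k. n \<le> lev (trail (A \<union> A') i (Suc j) u)" using j by auto
        qed auto
        ultimately show "of_bool (\<exists>j\<le>Suc k. n \<le> lev (trail (A \<union> A') i j u)) =
          of_bool (\<exists>j\<le>k. n \<le> lev (trail A' (Suc i) j (swp A i u)))" by simp
      qed
      also have "\<dots> \<le> (1 + p * D) ^ k * 2 ^ lev (swp A i u) / 2 ^ n" by (rule Suc.IH)
      also have "\<dots> \<le> (1 + p * D) ^ k * (2 ^ lev u * (1 + (\<Sum>w\<in>set (ch u) \<inter> N. of_bool ((w, i) \<in> A)))) / 2 ^ n"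
      proof (intro divide_right_mono mult_left_mono)
        have "(2::real) ^ lev (swp A i u) \<le> 2 ^ (lev u + of_bool (\<exists>w\<in>set (ch u). (w, i) \<in> A))"
          using A by (intro power_increasing swp_lev bars) auto
        also have "\<dots> = 2 ^ lev u * (1 + of_bool (\<exists>w\<in>set (ch u). (w, i) \<in> A))" by simp
        also have "\<dots> \<le> 2 ^ lev u * (1 + (\<Sum>w\<in>set (ch u) \<inter> N. of_bool ((w, i) \<in> A)))"
        proof (cases "\<exists>w\<in>set (ch u). (w, i) \<in> A")
          case True
          then obtain w where "w \<in> set (ch u) \<inter> N" "(w, i) \<in> A" using A by auto
          then have "1 \<le> (\<Sum>w\<in>set (ch u) \<inter> N. of_bool ((w, i) \<in> A) :: real)"
            using member_le_sum[of w "set (ch u) \<inter> N" "\<lambda>w. of_bool ((w, i) \<in> A) :: real"] by simp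
          then show ?thesis using True by simp
        qed (simp add: sum_nonneg)
        finally show "(2::real) ^ lev (swp A i u) \<le> 2 ^ lev u * (1 + (\<Sum>w\<in>set (ch u) \<inter> N. of_bool ((w, i) \<in> A)))" .
      qed (use pD in auto)
      finally show "bexp p ?S' (\<lambda>A'. of_bool (\<exists>j\<le>Suc k. n \<le> lev (trail (A \<union> A') i j u)))
        \<le> ((1 + p * D) ^ k * 2 ^ lev u / 2 ^ n) * (1 + (\<Sum>w\<in>set (ch u) \<inter> N. of_bool ((w, i) \<in> A)))"
        by (simp add: mult.assoc)
    qed
    also have "\<dots> = ((1 + p * D) ^ k * 2 ^ lev u / 2 ^ n) * (1 + (\<Sum>w\<in>set (ch u) \<inter> N. p))"
    proof -
      have "(\<Sum>w\<in>set (ch u) \<inter> N. bexp p ?S (\<lambda>A. of_bool ((w, i) \<in> A))) = (\<Sum>w\<in>set (ch u) \<inter> N. p)"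
        by (intro sum.cong refl bexp_mem) (use N in auto)
      then show ?thesis using N by (simp only: bexp_cmult bexp_add bexp_sum bexp_const finite_cartesian_product finite.intros)
    qed
    also have "\<dots> \<le> ((1 + p * D) ^ k * 2 ^ lev u / 2 ^ n) * (1 + p * D)"
    proof (intro mult_left_mono add_left_mono)
      have "card (set (ch u) \<inter> N) \<le> D"
        using card_mono[of "set (ch u)" "set (ch u) \<inter> N"] card_length[of "ch u"] D[of u] by simp
      then show "(\<Sum>w\<in>set (ch u) \<inter> N. p) \<le> p * D" using p by (simp add: mult.commute mult_left_mono)
    qed (use pD in simp)
    also have "\<dots> = (1 + p * D) ^ Suc k * 2 ^ lev u / 2 ^ n" by simp
    finally show ?thesis unfolding split .
  qed
qed

end

text \<open>With the rational bounds \<open>t1\<close> to \<open>t5\<close> proved below, the left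
  side is about 0.274. The main contributions are \<open>1 / 39\<close> for the parent edge,
  \<open>3 / 39\<close> for \<open>L * p\<close>, and \<open>3 / 10\<close> times a bracket of about
  0.54.\<close>

lemma recursion_parameters:
  fixes d M :: nat and T p \<delta> :: real
  assumes d: "39 \<le> d" and T: "429 / real d \<le> T" and M: "1000 * real d * T \<le> real M"
  defines "\<delta> \<equiv> T / real M" and "p \<equiv> 1 - exp (- (T / real M))"
  obtains L :: nat where "3 * L < M"
    "p / (1 - (1 - p) ^ d) + (1 - p) ^ (d * (2 * L)) + (L + 1) * p
      + (2 * L * p + 3 / 10 + (1 - p) ^ ((d - 1) * L)) * (3 / 10) \<le> 3 / 10"
proof -
  have d0: "39 \<le> real d" "0 < real d" using d by auto
  have T0: "0 < T" using T d0 by (metis divide_pos_pos less_le_trans zero_less_numeral)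
  have M0: "0 < real M" using M T0 d0 by (metis less_le_trans mult_pos_pos zero_less_numeral)
  have \<delta>: "0 < \<delta>" "real M * \<delta> = T" using T0 M0 by (auto simp: \<delta>_def)
  \<comment> \<open>The factor 1000 makes the rounding of \<open>L\<close> and the discretisation
    errors, which are of order \<open>d * \<delta>\<close>, fit into the numerical slack.\<close>
  have d\<delta>: "real d * \<delta> \<le> 1 / 1000" using M M0 by (simp add: \<delta>_def field_simps)
  have \<delta>s: "\<delta> \<le> 1 / 39000"
  proof -
    have "39 * \<delta> \<le> real d * \<delta>" using d0 \<delta> by (intro mult_right_mono) auto
    then show ?thesis using d\<delta> by simp
  qed
  have p: "1 - p = exp (- \<delta>)" "0 < p" "p \<le> \<delta>"
    using \<delta> exp_ge_add_one_self[of "- \<delta>"] by (auto simp: p_def \<delta>_def)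
  have pw: "(1 - p) ^ n = exp (- (real n * \<delta>))" for n
    unfolding p(1) exp_of_nat_mult[symmetric] by simp
  define L where "L = nat \<lfloor>3 / (real d * \<delta>)\<rfloor>"
  have x0: "0 \<le> 3 / (real d * \<delta>)" using d0 \<delta> by simp
  have L1: "real L \<le> 3 / (real d * \<delta>)" using x0 by (simp add: L_def)
  have L2: "3 / (real d * \<delta>) \<le> real L + 1" using x0 by (simp add: L_def)
  have Ld: "real d * (real L * \<delta>) \<le> 3" using L1 d0 \<delta> by (simp add: field_simps)
  have Ld': "3 - real d * \<delta> \<le> real d * (real L * \<delta>)" using L2 d0 \<delta> by (simp add: field_simps)
  have L\<delta>: "real L * \<delta> \<le> 3 / 39"
  proof -
    have "39 * (real L * \<delta>) \<le> real d * (real L * \<delta>)" using d0 \<delta> by (intro mult_right_mono) auto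
    then show ?thesis using Ld by simp
  qed
  have "3 * L < M"
  proof -
    have "real d * (3 * real L * \<delta>) \<le> 9" using Ld by (simp add: algebra_simps)
    \<comment> \<open>The lower bound on \<open>T\<close> enters: three windows, of total time at
      most \<open>9 / d\<close>, must fit into the time circle of length \<open>T\<close>.\<close>
    also have "9 < real d * T" using T d0 by (simp add: field_simps)
    also have "\<dots> = real d * (real M * \<delta>)" using \<delta> by simp
    finally have "3 * real L * \<delta> < real M * \<delta>" using d0 by (simp only: mult_less_cancel_left_pos)
    then have "3 * real L < real M" using \<delta>(1) by (simp only: mult_less_cancel_right_pos)
    then show ?thesis by linarith
  qed
  moreover have "p / (1 - (1 - p) ^ d) + (1 - p) ^ (d * (2 * L)) + (L + 1) * p
      + (2 * L * p + 3 / 10 + (1 - p) ^ ((d - 1) * L)) * (3 / 10) \<le> 3 / 10"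
  proof -
    have t1: "p / (1 - (1 - p) ^ d) \<le> 1 / 39 + 1 / 39000"
    proof -
      let ?x = "real d * \<delta>"
      have x: "0 < ?x" using d0 \<delta> by simp
      have "1 + ?x \<le> exp ?x" by (rule exp_ge_add_one_self)
      then have "exp (- ?x) \<le> 1 / (1 + ?x)" using x by (simp add: exp_minus field_simps)
      then have "?x / (1 + ?x) \<le> 1 - (1 - p) ^ d" using x unfolding pw by (simp add: field_simps)
      then have "p / (1 - (1 - p) ^ d) \<le> \<delta> / (?x / (1 + ?x))"
        using p x \<delta> by (intro frac_le) auto
      also have "\<dots> = 1 / real d + \<delta>" using d0 \<delta> by (simp add: field_simps)
      also have "\<dots> \<le> 1 / 39 + 1 / 39000" using d0 \<delta>s by (intro add_mono divide_left_mono) auto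
      finally show ?thesis .
    qed
    \<comment> \<open>The fourth power of the quadratic Taylor bound is sharp enough for the
      exponents 5.9 and 2.9 below and needs rational arithmetic only.\<close>
    have e4: "exp (- (4 * x)) \<le> 1 / c" if "0 \<le> x" "0 < c" "c \<le> (1 + x + x\<^sup>2 / 2) ^ 4" for x c :: real
    proof -
      have "(1 + x + x\<^sup>2 / 2) ^ 4 \<le> exp x ^ 4"
        using exp_lower_Taylor_quadratic[OF that(1)] that(1) by (intro power_mono) auto
      also have "exp x ^ 4 = exp (4 * x)" by (simp add: exp_of_nat_mult[symmetric])
      finally have "c \<le> exp (4 * x)" using that(3) by simp
      then show ?thesis using that(2) by (simp add: exp_minus field_simps)
    qed
    have t2: "(1 - p) ^ (d * (2 * L)) \<le> 1 / 100"
    proof -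
      have "(1 - p) ^ (d * (2 * L)) \<le> exp (- (4 * (59 / 40)))"
        unfolding pw using Ld' d\<delta> by (simp add: algebra_simps)
      also have "\<dots> \<le> 1 / 100" by (rule e4) (simp_all add: power2_eq_square eval_nat_numeral)
      finally show ?thesis .
    qed
    have t3: "(1 - p) ^ ((d - 1) * L) \<le> 1 / 12"
    proof -
      have "real (d - 1) = real d - 1" using d by (simp add: of_nat_diff)
      then have "real ((d - 1) * L) * \<delta> = real d * (real L * \<delta>) - real L * \<delta>"
        by (simp add: algebra_simps)
      then have "29 / 10 \<le> real ((d - 1) * L) * \<delta>" using Ld' L\<delta> d\<delta> by linarith
      then have "(1 - p) ^ ((d - 1) * L) \<le> exp (- (4 * (29 / 40)))"
        unfolding pw exp_le_cancel_iff by linarith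
      also have "\<dots> \<le> 1 / 12" by (rule e4) (simp_all add: power2_eq_square eval_nat_numeral)
      finally show ?thesis .
    qed
    have t4: "real L * p \<le> 3 / 39"
      using mult_left_mono[OF p(3), of "real L"] L\<delta> by simp
    have t5: "p \<le> 1 / 39000" using p \<delta>s by simp
    show ?thesis using t1 t2 t3 t4 t5 by (simp add: algebra_simps)
  qed
  ultimately show ?thesis by (rule that)
qed

context tree
begin

lemma walk_trail:
  assumes "i \<le> M" "0 < M"
  shows "fst ((walk M A ^^ i) (u, M - 1)) = trail A 0 i u"
  using assms(1)
proof (induction i)
  case (Suc i)
  have "Suc (M - 1 + i) mod M = i" using Suc.prems by simp
  then have "Suc (snd ((walk M A ^^ i) (u, M - 1))) mod M = i"
    by (subst snd_walk_from_start[OF assms(2)]) (simp only: mod_Suc_eq)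
  moreover have "fst (walk M A s) = swp A (Suc (snd s) mod M) (fst s)" for s by (simp add: walk_def)
  ultimately have "fst ((walk M A ^^ Suc i) (u, M - 1)) = swp A (0 + i) (trail A 0 i u)"
    using Suc by (simp only: funpow.simps comp_apply add_0 Suc_leD)
  then show ?case by (simp only: trail_Suc)
qed simp

section \<open>Probabilities of the exceptional events\<close>

definition far :: "real \<Rightarrow> nat \<Rightarrow> nat \<Rightarrow> 'a \<Rightarrow> ('a set \<times> nat \<Rightarrow> real) set" where
  "far T n M u = {\<omega> \<in> space P. \<exists>i\<le>M. n \<le> lev (fst ((walk M (bits_of T n M \<omega>) ^^ i) (u, M - 1)))}"

definition clumped :: "real \<Rightarrow> nat \<Rightarrow> nat \<Rightarrow> ('a set \<times> nat \<Rightarrow> real) set" where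
  "clumped T n M = {\<omega> \<in> space P. \<not> separated T n M \<omega>}"

text \<open>Since \<open>M\<close> times the bit probability is at most \<open>T\<close>, the growth
  factor of \<open>reach_bound\<close> over \<open>M\<close> slots is at most
  \<open>exp (T * D)\<close>, whatever \<open>M\<close> is.\<close>

lemma far:
  assumes T: "0 \<le> T" and M: "0 < M" and D: "\<And>v. length (ch v) \<le> D"
  shows "far T n M u \<in> sets P"
    "measure P (far T n M u) \<le> exp (T * D) * 2 ^ lev u * (1 / 2) ^ n"
proof -
  let ?R = "far T n M u"
  let ?p = "1 - exp (- (T / M))"
  have R: "?R = {\<omega> \<in> space P. \<exists>i\<le>M. n \<le> lev (trail (bits_of T n M \<omega>) 0 i u)}"
    unfolding far_def using walk_trail[OF _ M] by (auto simp del: One_nat_def)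
  show "?R \<in> sets P" unfolding R by (rule bits_event(1)[OF T])
  have p: "0 \<le> ?p" "?p \<le> 1" "?p \<le> T / M"
    using T exp_ge_add_one_self[of "- (T / M)"] by auto
  have "(1 + ?p * D) ^ M \<le> exp (?p * D) ^ M"
    using p by (intro power_mono exp_ge_add_one_self) auto
  also have "exp (?p * D) ^ M = exp (real M * (?p * D))" by (rule exp_of_nat_mult[symmetric])
  also have "\<dots> \<le> exp (T * D)"
  proof -
    have "real M * ?p \<le> T" using p(3) M by (simp add: field_simps)
    then have "real M * ?p * D \<le> T * D" by (rule mult_right_mono) simp
    then show ?thesis by (simp add: mult.assoc)
  qed
  finally have growth: "(1 + ?p * D) ^ M \<le> exp (T * D)" .
  have "measure P ?R = bexp ?p (nonroot n \<times> {..<M}) (\<lambda>A. of_bool (\<exists>i\<le>M. n \<le> lev (trail A 0 i u)))"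
    unfolding R by (rule bits_event(2)[OF T])
  also have "{..<M} = {0..<0 + M}" by auto
  also have "bexp ?p (nonroot n \<times> {0..<0 + M}) (\<lambda>A. of_bool (\<exists>i\<le>M. n \<le> lev (trail A 0 i u)))
      \<le> (1 + ?p * D) ^ M * 2 ^ lev u / 2 ^ n"
  proof (rule reach_bound[OF p(1,2) finite_nonroot D])
    fix A :: "('a \<times> nat) set" assume A: "A \<subseteq> nonroot n \<times> UNIV"
    show "bars A"
      unfolding bars_def
    proof (intro allI impI)
      fix w m assume "(w, m) \<in> A"
      then have "w \<in> V - {r}" using A nonroot_subset by blast
      then show "w \<in> set (ch (par w))" by (simp add: in_ch)
    qed
  qed
  also have "\<dots> \<le> exp (T * D) * 2 ^ lev u / 2 ^ n"
    by (intro divide_right_mono mult_right_mono growth) auto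
  also have "\<dots> = exp (T * D) * 2 ^ lev u * (1 / 2) ^ n" by (simp add: power_one_over)
  finally show "measure P ?R \<le> exp (T * D) * 2 ^ lev u * (1 / 2) ^ n" .
qed

text \<open>Union bound over slots: a pair of edges, or two rings of one edge, share a given slot
  with probability at most \<open>(T / M)\<^sup>2\<close>, and there are only \<open>M\<close>
  slots. For fixed \<open>n\<close> the total is of order \<open>1 / M\<close>.\<close>

lemma clumped:
  assumes T: "0 \<le> T" and M: "0 < M"
  shows "clumped T n M \<in> sets P"
    "measure P (clumped T n M) \<le> ((real (card (nonroot n)))\<^sup>2 + real (card (nonroot n))) * T\<^sup>2 / M"
proof -
  interpret prob_space P by (rule prob_space_P)
  let ?C = "clumped T n M"
  let ?p = "1 - exp (- (T / M))" and ?N = "nonroot n" and ?S = "nonroot n \<times> {..<M}"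
  let ?A = "{\<omega> \<in> space P. \<not> simple_bars (bits_of T n M \<omega>)}"
  let ?D = "\<lambda>w m. {\<omega> \<in> space P. slot_double (T / M) m (seq_of (pedge w) \<omega>)}"
  let ?U = "\<Union>w\<in>?N. \<Union>m\<in>{..<M}. ?D w m"
  have C: "?C = ?A \<union> ?U" by (auto simp: clumped_def separated_def)
  have A: "?A \<in> sets P" by (rule bits_event(1)[OF T])
  have D: "?D w m \<in> sets P" if "w \<in> ?N" for w m using sets_slot_double[OF that] .
  have U: "?U \<in> sets P" using D finite_nonroot by (intro sets.finite_UN) auto
  show "?C \<in> sets P" unfolding C using A U by auto
  have p: "0 \<le> ?p" "?p \<le> 1" "?p \<le> T / M"
    using T exp_ge_add_one_self[of "- (T / M)"] by auto
  have fin: "finite ?S" using finite_nonroot by simp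
  have "measure P ?A = bexp ?p ?S (\<lambda>A. of_bool (\<not> simple_bars A))"
    by (rule bits_event(2)[OF T])
  also have "\<dots> \<le> bexp ?p ?S (\<lambda>A. \<Sum>m<M. \<Sum>w\<in>?N. \<Sum>w'\<in>?N - {w}. of_bool ((w, m) \<in> A \<and> (w', m) \<in> A))"
  proof (rule bexp_mono[OF p(1,2)])
    fix A assume A: "A \<subseteq> ?S"
    show "of_bool (\<not> simple_bars A) \<le> (\<Sum>m<M. \<Sum>w\<in>?N. \<Sum>w'\<in>?N - {w}. of_bool ((w, m) \<in> A \<and> (w', m) \<in> A) :: real)"
    proof (cases "simple_bars A")
      case False
      then obtain w w' m where w: "(w, m) \<in> A" "(w', m) \<in> A" "w \<noteq> w'"
        using bars_bits[OF A] by (auto simp: simple_bars_def)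
      then have "1 \<le> (\<Sum>w'\<in>?N - {w}. of_bool ((w, m) \<in> A \<and> (w', m) \<in> A) :: real)"
        using A member_le_sum[of w' "?N - {w}" "\<lambda>w'. of_bool ((w, m) \<in> A \<and> (w', m) \<in> A) :: real"] finite_nonroot by auto
      also have "\<dots> \<le> (\<Sum>w\<in>?N. \<Sum>w'\<in>?N - {w}. of_bool ((w, m) \<in> A \<and> (w', m) \<in> A) :: real)"
        using A w finite_nonroot
        by (intro member_le_sum[of w ?N "\<lambda>w. \<Sum>w'\<in>?N - {w}. of_bool ((w, m) \<in> A \<and> (w', m) \<in> A) :: real"] sum_nonneg) auto
      also have "\<dots> \<le> (\<Sum>m<M. \<Sum>w\<in>?N. \<Sum>w'\<in>?N - {w}. of_bool ((w, m) \<in> A \<and> (w', m) \<in> A) :: real)"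
        using A w
        by (intro member_le_sum[of m "{..<M}" "\<lambda>m. \<Sum>w\<in>?N. \<Sum>w'\<in>?N - {w}. of_bool ((w, m) \<in> A \<and> (w', m) \<in> A) :: real"] sum_nonneg) auto
      finally show ?thesis using False by simp
    qed (simp add: sum_nonneg)
  qed
  also have "\<dots> = (\<Sum>m<M. \<Sum>w\<in>?N. \<Sum>w'\<in>?N - {w}. ?p\<^sup>2)"
    unfolding bexp_sum using fin by (intro sum.cong refl bexp_mem2) auto
  also have "\<dots> \<le> (\<Sum>m<M. \<Sum>w\<in>?N. real (card ?N) * (T / M)\<^sup>2)"
  proof (intro sum_mono)
    fix w assume "w \<in> ?N"
    have "card (?N - {w}) \<le> card ?N" using finite_nonroot by (intro card_mono) auto
    then have "real (card (?N - {w})) * ?p\<^sup>2 \<le> real (card ?N) * (T / M)\<^sup>2"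
      using p by (intro mult_mono power_mono) auto
    then show "(\<Sum>w'\<in>?N - {w}. ?p\<^sup>2) \<le> real (card ?N) * (T / M)\<^sup>2" by simp
  qed
  also have "\<dots> = (real (card ?N))\<^sup>2 * (T\<^sup>2 / M)"
    using M by (simp add: power2_eq_square field_simps)
  finally have 1: "measure P ?A \<le> (real (card ?N))\<^sup>2 * (T\<^sup>2 / M)" .
  have d: "measure P (?D w m) \<le> (T / M)\<^sup>2" if w: "w \<in> ?N" for w m
  proof -
    have "measure P (?D w m) = measure (distr P expS (seq_of (pedge w))) {x. slot_double (T / M) m x}"
      by (subst measure_distr[OF measurable_seq_pedge[OF w] sets_slot(2)])
        (rule arg_cong[where f = "measure P"], auto)
    also have "\<dots> = measure expS {x. slot_double (T / M) m x}"
      unfolding P_eq distr_seq_of[OF pedge_in_edges[OF w]] ..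
    also have "\<dots> \<le> (T / M)\<^sup>2" using T by (intro measure_slot_double) auto
    finally show ?thesis .
  qed
  have "measure P ?U \<le> (\<Sum>w\<in>?N. measure P (\<Union>m\<in>{..<M}. ?D w m))"
    using D finite_nonroot by (intro finite_measure_subadditive_finite) (auto intro!: sets.finite_UN)
  also have "\<dots> \<le> (\<Sum>w\<in>?N. \<Sum>m<M. measure P (?D w m))"
    using D by (intro sum_mono finite_measure_subadditive_finite) auto
  also have "\<dots> \<le> (\<Sum>w\<in>?N. \<Sum>m<M. (T / M)\<^sup>2)"
    by (intro sum_mono d)
  also have "\<dots> = real (card ?N) * (T\<^sup>2 / M)"
    using M by (simp add: power2_eq_square field_simps)
  finally have 2: "measure P ?U \<le> real (card ?N) * (T\<^sup>2 / M)" .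
  have "measure P ?C \<le> measure P ?A + measure P ?U"
    unfolding C using A U by (intro measure_Un_le)
  also have "\<dots> \<le> ((real (card ?N))\<^sup>2 + real (card ?N)) * T\<^sup>2 / M"
    using 1 2 by (simp add: algebra_simps add_divide_distrib)
  finally show "measure P ?C \<le> ((real (card ?N))\<^sup>2 + real (card ?N)) * T\<^sup>2 / M" .
qed

definition all_exit :: "real \<Rightarrow> nat \<Rightarrow> nat \<Rightarrow> nat \<Rightarrow> ('a \<times> nat) set \<Rightarrow> bool" where
  "all_exit T l n M A \<longleftrightarrow> (\<forall>v\<in>layer l. exit_slot M ch (n - l) v A (M - 1) \<noteq> None)"

lemma all_exit_event:
  assumes d: "39 \<le> d" and T: "429 / real d \<le> T" and M: "1000 * real d * T \<le> real M"
    and deg: "\<And>v. v \<in> V \<Longrightarrow> d \<le> length (ch v)" and l: "1 \<le> l" "l \<le> n"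
  shows "measure P {\<omega> \<in> space P. all_exit T l n M (bits_of T n M \<omega>)} \<le> (3 / 10) ^ card (layer l)"
proof -
  let ?p = "1 - exp (- (T / M))"
  obtain L where L: "3 * L < M"
    "?p / (1 - (1 - ?p) ^ d) + (1 - ?p) ^ (d * (2 * L)) + real (L + 1) * ?p
      + (real (2 * L) * ?p + 3 / 10 + (1 - ?p) ^ ((d - 1) * L)) * (3 / 10) \<le> 3 / 10"
    by (rule recursion_parameters[OF d T M])
  have "0 < 429 / real d" using d by simp
  then have T0: "0 < T" using T by linarith
  have M0: "0 < M" using L by simp
  have p: "0 < ?p" "?p \<le> 1" using T0 M0 by auto
  interpret stir_scan par lev ch M L d ?p "3 / 10" V
    by unfold_locales (use p deg L d in_ch in auto)
  define S where "S v = dsc ch (n - l) v \<times> {..<M} \<union> {v} \<times> {..<M}" for v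
  \<comment> \<open>Cutting \<open>A\<close> down to \<open>S v\<close> makes \<open>F v\<close>
    local for every \<open>A\<close>, as \<open>bexp_prod_le\<close> demands; by
    \<open>fail_F\<close> the value on the occurring bit sets is unchanged.\<close>
  define F where "F v A = fail (n - l) v (M - 1) (A \<inter> S v)" for v A
  have Ssub: "(\<Union>v\<in>layer l. S v) \<subseteq> nonroot n \<times> {..<M}"
    using dsc_nonroot l by (fastforce simp: S_def layer_def nonroot_def)
  have fin: "finite (nonroot n \<times> {..<M})" using finite_nonroot by simp
  have fail_F: "of_bool (exit_slot M ch (n - l) v A (M - 1) \<noteq> None) = F v A" if "A \<subseteq> nonroot n \<times> {..<M}" for v A
  proof -
    have "exit_slot M ch (n - l) v A (M - 1) = exit_slot M ch (n - l) v (A \<inter> S v) (M - 1)"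
      by (rule exit_slot_cong) (use that in \<open>auto simp: S_def\<close>)
    then show ?thesis by (simp add: F_def fail_def)
  qed
  have "measure P {\<omega> \<in> space P. all_exit T l n M (bits_of T n M \<omega>)}
      = bexp ?p (nonroot n \<times> {..<M}) (\<lambda>A. of_bool (all_exit T l n M A))"
    using T0 by (intro bits_event(2)) auto
  also have "\<dots> = bexp ?p (nonroot n \<times> {..<M}) (\<lambda>A. \<Prod>v\<in>layer l. F v A)"
  proof (rule bexp_cong)
    fix A assume A: "A \<subseteq> nonroot n \<times> {..<M}"
    have "(\<Prod>v\<in>layer l. F v A) = (\<Prod>v\<in>layer l. of_bool (exit_slot M ch (n - l) v A (M - 1) \<noteq> None))"
      using fail_F[OF A] by simp
    also have "\<dots> = of_bool (all_exit T l n M A)"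
      unfolding all_exit_def using finite_layer[of l] by (induction rule: finite_induct) auto
    finally show "of_bool (all_exit T l n M A) = (\<Prod>v\<in>layer l. F v A)" ..
  qed
  also have "\<dots> = bexp ?p (\<Union>v\<in>layer l. S v) (\<lambda>A. \<Prod>v\<in>layer l. F v A)"
  proof (rule bexp_restrict[OF fin Ssub])
    fix A
    have "A \<inter> (\<Union>v\<in>layer l. S v) \<inter> S v = A \<inter> S v" if "v \<in> layer l" for v using that by auto
    then show "(\<Prod>v\<in>layer l. F v A) = (\<Prod>v\<in>layer l. F v (A \<inter> (\<Union>v\<in>layer l. S v)))"
      by (intro prod.cong refl) (simp add: F_def)
  qed
  also have "\<dots> \<le> (3 / 10) ^ card (layer l)"
  proof (rule bexp_prod_le)
    show "disjoint_family_on S (layer l)"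
    proof (unfold disjoint_family_on_def, intro ballI impI)
      fix v w assume vw: "v \<in> layer l" "w \<in> layer l" "v \<noteq> w"
      have "insert v (dsc ch (n - l) v) \<inter> insert w (dsc ch (n - l) w) = {}"
        by (rule dsc_disj) (use vw in \<open>auto simp: layer_def\<close>)
      then show "S v \<inter> S w = {}" by (auto simp: S_def)
    qed
    show "F v A = F v (A \<inter> S v)" for v A by (simp add: F_def Int_assoc)
    show "finite (S v)" for v by (simp add: S_def)
    show "0 \<le> F v A" for v A by (simp add: F_def fail_def)
    fix v assume v: "v \<in> layer l"
    have "bexp ?p (S v) (F v) = bexp ?p (S v) (fail (n - l) v (M - 1))"
      by (rule bexp_cong) (simp add: F_def Int_absorb2)
    also have "\<dots> \<le> 3 / 10"
      unfolding S_def using v M0 by (intro exit_bound) (auto simp: layer_def)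
    finally show "bexp ?p (S v) (F v) \<le> 3 / 10" .
  qed (use p finite_layer in auto)
  finally show ?thesis .
qed

end

section \<open>Infinite cycles\<close>

context tree
begin

text \<open>After each \<open>M\<close> steps the walk is at slot \<open>M - 1\<close> in a vertex
  of the invariant set \<open>U\<close>, and in between it follows a path at levels below
  \<open>n\<close>. So it never reaches level \<open>n\<close>, whereas by \<open>exit_walk\<close>
  the value \<open>None\<close> would take it there.\<close>

lemma finite_orbit_exit:
  assumes T: "0 < T" and M: "0 < M" and sep: "separated T n M \<omega>"
    and pos: "\<forall>w\<in>V - {r}. \<forall>i. 0 < seq_of (pedge w) \<omega> i"
    and U: "v \<in> U" "U \<subseteq> V" "\<And>u. u \<in> U \<Longrightarrow> stir_perm V adj T \<omega> u \<in> U"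
    and low: "\<And>u i. \<lbrakk>u \<in> U; i \<le> M\<rbrakk> \<Longrightarrow> lev (fst ((walk M (bits_of T n M \<omega>) ^^ i) (u, M - 1))) < n"
    and n: "lev v \<le> n"
  shows "exit_slot M ch (n - lev v) v (bits_of T n M \<omega>) (M - 1) \<noteq> None"
proof
  let ?A = "bits_of T n M \<omega>"
  assume "exit_slot M ch (n - lev v) v ?A (M - 1) = None"
  moreover have "simple_bars ?A" using sep by (simp add: separated_def)
  ultimately obtain k where k: "lev (fst ((walk M ?A ^^ k) (v, M - 1))) = n"
    using exit_walk[of ?A "M - 1" M "n - lev v" v] M n by auto
  have period: "\<exists>u\<in>U. (walk M ?A ^^ (q * M)) (v, M - 1) = (u, M - 1)" for q
  proof (induction q)
    case 0
    then show ?case using U(1) by (intro bexI[of _ v]) simp_all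
  next
    case (Suc q)
    then obtain u where u: "u \<in> U" "(walk M ?A ^^ (q * M)) (v, M - 1) = (u, M - 1)" by auto
    have "(walk M ?A ^^ (Suc q * M)) (v, M - 1) = (walk M ?A ^^ M) (u, M - 1)"
      using u(2) by (simp add: funpow_add)
    also have "\<dots> = (stir_perm V adj T \<omega> u, M - 1)"
    proof (rule prod_eqI)
      show "fst ((walk M ?A ^^ M) (u, M - 1)) = fst (stir_perm V adj T \<omega> u, M - 1)"
        using stir_walk(1)[OF T M sep pos _ low[OF u(1)]] u(1) U(2) by auto
      show "snd ((walk M ?A ^^ M) (u, M - 1)) = snd (stir_perm V adj T \<omega> u, M - 1)"
        unfolding snd_walk_from_start[OF M] mod_add_self2 using M by simp
    qed
    finally show ?case using U(3)[OF u(1)] by blast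
  qed
  obtain u where u: "u \<in> U" "(walk M ?A ^^ (k div M * M)) (v, M - 1) = (u, M - 1)"
    using period by blast
  have "k = k mod M + k div M * M" by simp
  then have "(walk M ?A ^^ k) (v, M - 1) = (walk M ?A ^^ (k mod M)) (u, M - 1)"
    using u(2) by (metis comp_apply funpow_add)
  moreover have "k mod M \<le> M" using M by (simp add: less_imp_le)
  ultimately show False using k low[OF u(1), of "k mod M"] by simp
qed

end

lemma (in prob_space) measure_liminf_le:
  fixes G :: "nat \<Rightarrow> 'a set"
  assumes G: "\<And>n. G n \<in> events" and le: "\<And>n. n0 \<le> n \<Longrightarrow> prob (G n) \<le> c"
  shows "(\<Union>N. \<Inter>n\<in>{N..}. G n) \<in> events" "prob (\<Union>N. \<Inter>n\<in>{N..}. G n) \<le> c"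
proof -
  let ?I = "\<lambda>N. \<Inter>n\<in>{N..}. G n"
  have I: "?I N \<in> events" for N
    using G by (intro sets.countable_INT' countable_subset[OF subset_UNIV countableI_type]) auto
  then show "(\<Union>N. ?I N) \<in> events" by (intro sets.countable_UN) auto
  have "(\<lambda>N. prob (?I N)) \<longlonglongrightarrow> prob (\<Union>N. ?I N)"
  proof (rule finite_Lim_measure_incseq)
    show "range ?I \<subseteq> events" using I by auto
    show "incseq ?I" by (auto simp: incseq_def)
  qed
  moreover have "prob (?I N) \<le> c" for N
  proof -
    have "prob (?I N) \<le> prob (G (max N n0))" using G by (intro finite_measure_mono) auto
    also have "\<dots> \<le> c" by (rule le) simp
    finally show ?thesis .
  qed
  ultimately show "prob (\<Union>N. ?I N) \<le> c" by (intro LIMSEQ_le_const2) auto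
qed

theorem theorem2:
  fixes V :: "'a set" and adj :: "'a \<Rightarrow> 'a \<Rightarrow> bool" and r :: 'a
    and d :: nat and T :: real
  assumes "39 \<le> d"
    and "rooted_tree V adj r"
    and "infinite V"
    and "\<exists>D::nat. \<forall>v\<in>V. finite (neighbours V adj v) \<and> card (neighbours V adj v) \<le> D"
    and "\<forall>v\<in>V. d \<le> card (offspring V adj r v)"
    and "429 / real d \<le> T"
  shows "AE \<omega> in stirring_space V adj. \<exists>v\<in>V. infinite (orbit (stir_perm V adj T \<omega>) v)"
proof -
  obtain D where D: "\<And>v. v \<in> V \<Longrightarrow> finite (neighbours V adj v) \<and> card (neighbours V adj v) \<le> D"
    using assms(4) by blast
  interpret tree V adj r by unfold_locales (use assms(2) D in auto)
  interpret P: prob_space P by (rule prob_space_P)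
  have "0 < 429 / real d" using assms(1) by simp
  then have T: "0 < T" using assms(6) by linarith
  have chD: "length (ch v) \<le> D" for v
  proof (cases "v \<in> V")
    case True
    have "card (offspring V adj r v) \<le> card (neighbours V adj v)"
      using D[OF True] by (intro card_mono) (auto simp: offspring_def neighbours_def)
    then show ?thesis using D[OF True] by (simp add: length_ch)
  next
    case False
    then have "w \<notin> set (ch v)" for w using in_ch[of w v] par(3)[of w] by auto
    then have "ch v = []" using hd_in_set by blast
    then show ?thesis by simp
  qed
  have chd: "d \<le> length (ch v)" if "v \<in> V" for v using assms(5) that by (simp add: length_ch)
  \<comment> \<open>The second condition is what \<open>recursion_parameters\<close> asks for; the
    third makes the clumping probabilities summable over the levels \<open>n\<close>.\<close>
  have "\<exists>M::nat. 0 < M \<and> 1000 * real d * T \<le> real M \<and>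
      ((real (card (nonroot n)))\<^sup>2 + real (card (nonroot n))) * T\<^sup>2 / M \<le> (1 / 2) ^ n" for n
  proof -
    let ?c = "((real (card (nonroot n)))\<^sup>2 + real (card (nonroot n))) * T\<^sup>2"
    obtain M :: nat where M: "max 1 (max (1000 * real d * T) (?c * 2 ^ n)) \<le> real M"
      using real_arch_simple by blast
    then have "0 < M" by (cases M) auto
    moreover have "?c / M \<le> (1 / 2) ^ n" using M \<open>0 < M\<close> by (simp add: field_simps power_one_over)
    ultimately show ?thesis using M by auto
  qed
  then obtain Mn :: "nat \<Rightarrow> nat" where Mn: "\<And>n. 0 < Mn n" "\<And>n. 1000 * real d * T \<le> real (Mn n)"
    "\<And>n. ((real (card (nonroot n)))\<^sup>2 + real (card (nonroot n))) * T\<^sup>2 / Mn n \<le> (1 / 2) ^ n"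
    by metis
  have geo: "summable (\<lambda>n. (1 / 2) ^ n :: real)" by simp
  have "AE \<omega> in P. \<forall>\<^sub>F n in sequentially. \<omega> \<in> space P - clumped T n (Mn n)"
  proof (rule borel_cantelli_AE1)
    show "summable (\<lambda>n. measure P (clumped T n (Mn n)))"
    proof (rule summable_comparison_test'[OF geo, of 0])
      fix n
      show "norm (measure P (clumped T n (Mn n))) \<le> (1 / 2) ^ n"
        using order.trans[OF clumped(2)[OF less_imp_le[OF T] Mn(1)] Mn(3)] by simp
    qed
  qed (use clumped(1) T Mn(1) in \<open>auto simp: P.emeasure_eq_measure\<close>)
  \<comment> \<open>The threshold in \<open>n\<close> depends on \<open>u\<close>, which is
    harmless: countability of \<open>V\<close> allows one null set for all starting points.\<close>
  moreover have "AE \<omega> in P. \<forall>u\<in>V. \<forall>\<^sub>F n in sequentially. \<omega> \<in> space P - far T n (Mn n) u"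
  proof (subst AE_ball_countable[OF countable_V], intro ballI)
    fix u
    show "AE \<omega> in P. \<forall>\<^sub>F n in sequentially. \<omega> \<in> space P - far T n (Mn n) u"
    proof (rule borel_cantelli_AE1)
      show "summable (\<lambda>n. measure P (far T n (Mn n) u))"
      proof (rule summable_comparison_test'[OF summable_mult[OF geo], of 0])
        fix n
        show "norm (measure P (far T n (Mn n) u)) \<le> exp (T * D) * 2 ^ lev u * (1 / 2) ^ n"
          using far(2)[OF less_imp_le[OF T] Mn(1) chD] by simp
      qed
    qed (use far(1)[of T _ D] T Mn(1) chD in \<open>auto simp: P.emeasure_eq_measure\<close>)
  qed
  moreover define G where "G l n = {\<omega> \<in> space P. all_exit T l n (Mn n) (bits_of T n (Mn n) \<omega>)}" for l n
  \<comment> \<open>A lower limit in \<open>n\<close>: if all cycles were finite, the exits from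
    layer \<open>l\<close> would be known for all large \<open>n\<close> only, with a threshold
    depending on the outcome.\<close>
  define Z where "Z l = (\<Union>N. \<Inter>n\<in>{N..}. G l n)" for l
  have Z: "Z l \<in> sets P" "measure P (Z l) \<le> (3 / 10) ^ l" if l: "1 \<le> l" for l
  proof -
    have G: "G l n \<in> sets P" for n unfolding G_def using T by (intro bits_event(1)) auto
    have "2 \<le> length (ch v)" if "v \<in> V" for v using chd[OF that] assms(1) by linarith
    then have "2 ^ l \<le> card (layer l)" by (rule card_layer)
    \<comment> \<open>A crude linear bound on the layer size already makes the bound on
      \<open>Z l\<close> tend to zero.\<close>
    then have "l \<le> card (layer l)" using less_exp[of l] by linarith
    then have c: "(3 / 10 :: real) ^ card (layer l) \<le> (3 / 10) ^ l" by (intro power_decreasing) auto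
    have "measure P (G l n) \<le> (3 / 10) ^ l" if "l \<le> n" for n
      unfolding G_def using all_exit_event[OF assms(1,6) Mn(2) chd l that] c by (rule order.trans)
    from P.measure_liminf_le[OF G this] show "Z l \<in> sets P" "measure P (Z l) \<le> (3 / 10) ^ l"
      by (simp_all add: Z_def)
  qed
  have "AE \<omega> in P. \<omega> \<notin> (\<Inter>l\<in>{1..}. Z l)"
  proof -
    have sets: "(\<Inter>l\<in>{1..}. Z l) \<in> sets P" using Z(1)
      by (intro sets.countable_INT' countable_subset[OF subset_UNIV countableI_type]) auto
    have "measure P (\<Inter>l\<in>{1..}. Z l) \<le> (3 / 10) ^ l" if "1 \<le> l" for l
    proof -
      have "measure P (\<Inter>l\<in>{1..}. Z l) \<le> measure P (Z l)"
        using that by (intro P.finite_measure_mono Z) auto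
      then show ?thesis using Z(2)[OF that] by linarith
    qed
    then have "measure P (\<Inter>l\<in>{1..}. Z l) \<le> 0"
      by (intro LIMSEQ_le_const[OF LIMSEQ_power_zero[of "3 / 10 :: real"]]) auto
    then have "emeasure P (\<Inter>l\<in>{1..}. Z l) = 0"
      by (simp add: P.emeasure_eq_measure measure_le_0_iff)
    then show ?thesis using sets by (intro AE_not_in) auto
  qed
  ultimately show ?thesis
    using AE_pos AE_space
  proof eventually_elim
    case (elim \<omega>)
    let ?\<sigma> = "stir_perm V adj T \<omega>"
    note pos = elim(4)
    show ?case
    proof (rule ccontr)
      assume "\<not> ?case"
      then have fin: "finite (orbit ?\<sigma> v)" if "v \<in> V" for v using that by auto
      have sep: "\<forall>\<^sub>F n in sequentially. separated T n (Mn n) \<omega>"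
        using elim(1) by eventually_elim (auto simp: clumped_def)
      have near: "\<forall>\<^sub>F n in sequentially. \<forall>i\<le>Mn n. lev (fst ((walk (Mn n) (bits_of T n (Mn n) \<omega>) ^^ i) (u, Mn n - 1))) < n"
        if "u \<in> V" for u
        using elim(2)[rule_format, OF that] by eventually_elim (simp add: far_def, meson linorder_not_le)
      \<comment> \<open>\<open>stir_perm\<close> is a definite description, so membership of its
        value in \<open>V\<close> is read off from the walk at some suitable
        \<open>n\<close>.\<close>
      have \<sigma>V: "?\<sigma> u \<in> V" if u: "u \<in> V" for u
      proof -
        obtain n where n: "separated T n (Mn n) \<omega>"
          "\<forall>i\<le>Mn n. lev (fst ((walk (Mn n) (bits_of T n (Mn n) \<omega>) ^^ i) (u, Mn n - 1))) < n"
          using eventually_happens'[OF _ eventually_conj[OF sep near[OF u]]] by auto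
        then show ?thesis using stir_walk[OF T Mn(1) n(1) elim(4) u] by auto
      qed
      have "\<omega> \<in> Z l" if "1 \<le> l" for l
      proof -
        have "\<forall>\<^sub>F n in sequentially. exit_slot (Mn n) ch (n - l) v (bits_of T n (Mn n) \<omega>) (Mn n - 1) \<noteq> None"
          if v: "v \<in> layer l" for v
        proof -
          have vV: "v \<in> V" "lev v = l" using v by (auto simp: layer_def)
          \<comment> \<open>\<open>orbit\<close> collects the iterates from the first one on, so the
            starting point is added explicitly.\<close>
          define U where "U = insert v (orbit ?\<sigma> v)"
          have "u \<in> V" if "u \<in> orbit ?\<sigma> v" for u
            using that by induction (auto intro: \<sigma>V vV)
          then have U: "v \<in> U" "U \<subseteq> V" "finite U" "\<And>u. u \<in> U \<Longrightarrow> ?\<sigma> u \<in> U"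
            using vV fin by (auto simp: U_def intro: orbit.intros)
          \<comment> \<open>Here finiteness of the cycle is used: finitely many thresholds in
            \<open>n\<close> combine into one that serves every vertex of \<open>U\<close>.\<close>
          have "\<forall>\<^sub>F n in sequentially. \<forall>u\<in>U. \<forall>i\<le>Mn n. lev (fst ((walk (Mn n) (bits_of T n (Mn n) \<omega>) ^^ i) (u, Mn n - 1))) < n"
            by (rule eventually_ball_finite[OF U(3)], intro ballI near) (use U(2) in blast)
          with sep eventually_ge_at_top[of l] show ?thesis
          proof eventually_elim
            case (elim n)
            have "exit_slot (Mn n) ch (n - lev v) v (bits_of T n (Mn n) \<omega>) (Mn n - 1) \<noteq> None"
              by (rule finite_orbit_exit[OF T Mn(1) elim(1) pos U(1,2,4)]) (use elim vV in blast)+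
            then show ?case unfolding vV(2) .
          qed
        qed
        then have "\<forall>\<^sub>F n in sequentially. \<forall>v\<in>layer l. exit_slot (Mn n) ch (n - l) v (bits_of T n (Mn n) \<omega>) (Mn n - 1) \<noteq> None"
          by (intro eventually_ball_finite finite_layer) auto
        then have "\<forall>\<^sub>F n in sequentially. \<omega> \<in> G l n"
          by eventually_elim (use elim(5) in \<open>auto simp: G_def all_exit_def\<close>)
        then show ?thesis by (auto simp: Z_def eventually_sequentially)
      qed
      then show False using elim(3) by auto
    qed
  qed
qed

end
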